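(* Let $k$ be a field with $\mathrm{char}(k)=0$. Let $M$ be a (nonzero, finitely generated) graded module over $R=k[x_1,\ldots,x_n]$, where $\deg(x_i)=1$. Let $e_M(t)$ be the multiplicity polynomial of $M$, so that the Hilbert series of $M$ has the form $H_M(t)=e_M(t)(1-t)^{-d(M)}$, where $d(M)$ is the Krull dimension of $M$. Assume that $M$ is annihilated by a homogeneous polynomial $\boldsymbol{w}$ of even degree such that the corresponding projective hypersurface is smooth. Then $e_M(-1)$ is divisible by $2^{d(M)-\lfloor\frac{n}{2}\rfloor}$.
   Context: The Hilbert series is $H_M(t)=\sum_j\dim_k(M_j)t^j$. $e_M(t)$ is a Laurent polynomial with integer coefficients, so $e_M(-1)$ is an integer; divisibility by $2^a$ means $e_M(-1)/2^a\in\mathbb{Z}$ (no condition when $a\le 0$). Smoothness of the projective hypersurface $\boldsymbol{w}=0$ in $\mathbb{P}^{n-1}$ means that $\partial_1\boldsymbol{w},\ldots,\partial_n\boldsymbol{w}$ have no common zero other than the origin over an algebraic closure of $k$. *)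

theory Defs
  imports
    "HOL-Library.Poly_Mapping"
    "HOL-Library.Extended_Nat"
    "HOL-Library.Cardinality"
    "HOL-Computational_Algebra.Formal_Laurent_Series"
    "HOL-Algebra.Algebraic_Closure_Type"
begin

section \<open>Polynomials in finitely many variables\<close>

text \<open>The variables are indexed by the finite type \<open>'n\<close>, so the polynomial ring has
  \<open>CARD('n)\<close> variables. A monomial is its exponent function, and the ring structure is
  the convolution product of \<^theory>\<open>HOL-Library.Poly_Mapping\<close>.\<close>

type_synonym ('n, 'k) mpoly = "('n \<Rightarrow>\<^sub>0 nat) \<Rightarrow>\<^sub>0 'k"

definition mpoly_const :: "'k::zero \<Rightarrow> ('n, 'k) mpoly" where
  "mpoly_const c = Poly_Mapping.single 0 c"

definition monomial_degree :: "('n::finite \<Rightarrow>\<^sub>0 nat) \<Rightarrow> nat" where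
  "monomial_degree m = (\<Sum>i\<in>UNIV. Poly_Mapping.lookup m i)"

definition homogeneous :: "nat \<Rightarrow> ('n::finite, 'k::zero) mpoly \<Rightarrow> bool" where
  "homogeneous D p \<longleftrightarrow> (\<forall>m\<in>Poly_Mapping.keys p. monomial_degree m = D)"

text \<open>The truncated subtraction of exponents is harmless: if the \<open>i\<close>-th exponent is \<open>0\<close>,
  the coefficient of the term vanishes.\<close>

definition partial_deriv :: "'n \<Rightarrow> ('n, 'k::comm_semiring_1) mpoly \<Rightarrow> ('n, 'k) mpoly" where
  "partial_deriv i p = (\<Sum>m\<in>Poly_Mapping.keys p.
     Poly_Mapping.single (m - Poly_Mapping.single i 1)
       (of_nat (Poly_Mapping.lookup m i) * Poly_Mapping.lookup p m))"

definition eval_alg_closure ::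
    "('n::finite, 'k::field) mpoly \<Rightarrow> ('n \<Rightarrow> 'k alg_closure) \<Rightarrow> 'k alg_closure" where
  "eval_alg_closure p a = (\<Sum>m\<in>Poly_Mapping.keys p.
     to_ac (Poly_Mapping.lookup p m) * (\<Prod>i\<in>UNIV. a i ^ Poly_Mapping.lookup m i))"

definition smooth_projective_hypersurface :: "('n::finite, 'k::field) mpoly \<Rightarrow> bool" where
  "smooth_projective_hypersurface w \<longleftrightarrow>
     (\<forall>a. (\<forall>i. eval_alg_closure (partial_deriv i w) a = 0) \<longrightarrow> a = (\<lambda>_. 0))"


section \<open>Graded modules\<close>

definition const_scale :: "(('n, 'k::zero) mpoly \<Rightarrow> 'm \<Rightarrow> 'm) \<Rightarrow> 'k \<Rightarrow> 'm \<Rightarrow> 'm" where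
  "const_scale scale c x = scale (mpoly_const c) x"

text \<open>The module is the whole type \<open>'m\<close>, and \<open>gr j\<close> is its component of degree \<open>j\<close>.\<close>

locale graded_module = Modules.module scale
  for scale :: "('n::finite, 'k::field) mpoly \<Rightarrow> 'm::ab_group_add \<Rightarrow> 'm" +
  fixes gr :: "int \<Rightarrow> 'm set"
  assumes gr_subspace: "module.subspace (const_scale scale) (gr j)"
    and gr_decomposition:
      "\<exists>!f. (\<forall>j. f j \<in> gr j) \<and> finite {j. f j \<noteq> 0} \<and> x = (\<Sum>j | f j \<noteq> 0. f j)"
    and scale_gr:
      "homogeneous D p \<Longrightarrow> x \<in> gr j \<Longrightarrow> scale p x \<in> gr (int D + j)"

lemma (in graded_module) vector_space_const_scale: "vector_space (const_scale scale)"
proof -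
  have add: "mpoly_const (a + b) = mpoly_const a + (mpoly_const b :: ('n, 'k) mpoly)" for a b :: 'k
    by (simp add: mpoly_const_def single_add)
  have mult: "mpoly_const (a * b) = mpoly_const a * (mpoly_const b :: ('n, 'k) mpoly)" for a b :: 'k
    by (simp add: mpoly_const_def mult_single)
  have one: "mpoly_const 1 = (1 :: ('n, 'k) mpoly)"
    by (simp add: mpoly_const_def)
  show ?thesis
    by unfold_locales
      (simp_all add: const_scale_def add mult one scale_right_distrib scale_left_distrib)
qed

definition finitely_generated_module ::
    "('r::comm_ring_1 \<Rightarrow> 'm::ab_group_add \<Rightarrow> 'm) \<Rightarrow> bool" where
  "finitely_generated_module scale \<longleftrightarrow> (\<exists>S. finite S \<and> module.span scale S = UNIV)"

definition annihilator :: "('r \<Rightarrow> 'm::zero \<Rightarrow> 'm) \<Rightarrow> 'r set" where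
  "annihilator scale = {r. \<forall>x. scale r x = 0}"

text \<open>The Krull dimension of a module is that of the ring modulo its annihilator: the
  supremum of the lengths of chains of prime ideals containing the annihilator.\<close>

definition krull_dim_module :: "('r::comm_ring_1 \<Rightarrow> 'm::zero \<Rightarrow> 'm) \<Rightarrow> enat" where
  "krull_dim_module scale =
     (SUP l \<in> {l::nat. \<exists>P. (\<forall>i\<le>l. primeideal (P i) ring_of_type_algebra \<and> annihilator scale \<subseteq> P i)
                         \<and> (\<forall>i<l. P i \<subset> P (Suc i))}. enat l)"

text \<open>\<open>Abs_fls\<close> is meaningful only if the components vanish in all sufficiently negative
  degrees; this is the case for finitely generated graded modules.\<close>

definition hilbert_series ::
    "(('n, 'k::field) mpoly \<Rightarrow> 'm::ab_group_add \<Rightarrow> 'm) \<Rightarrow> (int \<Rightarrow> 'm set) \<Rightarrow> rat fls" where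
  "hilbert_series scale gr =
     Abs_fls (\<lambda>j. of_nat (vector_space.dim (const_scale scale) (gr j)))"


section \<open>Laurent polynomials with integer coefficients\<close>

type_synonym laurent_poly = "int \<Rightarrow>\<^sub>0 int"

definition laurent_fls :: "laurent_poly \<Rightarrow> rat fls" where
  "laurent_fls e = Abs_fls (\<lambda>j. of_int (Poly_Mapping.lookup e j))"

lemma laurent_fls_nth [simp]: "fls_nth (laurent_fls e) j = of_int (Poly_Mapping.lookup e j)"
proof -
  have "finite {n::nat. Poly_Mapping.lookup e (- int n) \<noteq> 0}"
    using finite_vimageI[OF finite_keys[of e], of "\<lambda>n. - int n"]
    by (simp add: inj_def vimage_def in_keys_iff)
  then show ?thesis
    unfolding laurent_fls_def by (intro nth_Abs_fls) (simp add: eventually_cofinite)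
qed

definition laurent_eval :: "laurent_poly \<Rightarrow> rat \<Rightarrow> rat" where
  "laurent_eval e x = (\<Sum>j\<in>Poly_Mapping.keys e. of_int (Poly_Mapping.lookup e j) * x powi j)"

end

theory Submission
  imports Defs "HOL-Computational_Algebra.Polynomial_FPS" "HOL-Library.Function_Algebras"
begin

text \<open>Let \<open>h = e(-1) / 2\<^sup>d\<close> be the value at \<open>t = -1\<close> of the Hilbert series of \<open>M\<close>. It suffices to show
  that \<open>2\<^sup>n h\<^sup>2\<close> is an integer. Write \<open>w(x) - w(y) = \<Sum> (x\<^sub>i - y\<^sub>i) w\<^sub>i(x, y)\<close>. On \<open>\<Lambda> \<otimes> M \<otimes> M\<close>, where
  \<open>\<Lambda>\<close> is the exterior algebra on \<open>n\<close> generators and \<open>M \<otimes> M\<close> is formed over the field, contraction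
  with \<open>(x\<^sub>i - y\<^sub>i)\<close> plus multiplication by \<open>\<Sum> w\<^sub>i e\<^sub>i\<close> is a differential, because \<open>w\<close> annihilates
  both factors. Its homology is finitely generated over \<open>k[x, y]\<close> and annihilated by all \<open>x\<^sub>i - y\<^sub>i\<close> and
  all \<open>w\<^sub>i\<close>, hence by the Jacobian ideal of \<open>w\<close>. By the Nullstellensatz it is finite-dimensional, so its
  Euler characteristic at \<open>t = -1\<close> is an integer; computed from the complex, it is \<open>\<plusminus> 2\<^sup>n h\<^sup>2\<close>. The degree
  of \<open>w\<close> must be even for the differential to be homogeneous in a suitable integral grading. Boundaries
  and cycles contribute only Hilbert series without a pole at \<open>-1\<close>, by Hilbert-Serre.

  To avoid tensor products, the complex is replaced by its graded dual, which consists of families of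
  bilinear forms on \<open>M\<close>; finite generation then turns into the descending chain condition.\<close>

section \<open>Dimensions of subspaces\<close>

text \<open>Why t = -1, and where 2^n comes from: let w have degree 2b. With exterior generators of
  degree 1 - b, both halves of the differential have degree b and change the exterior parity.
  Boundaries therefore cancel in "even part minus t^b times odd part". In this combination each
  generator contributes a factor 1 - t^b t^(1-b) = 1 - t up to shifts, which is 2 at t = -1; n
  generators give 2^n, and the two copies of M give h^2.

  Why two copies of M: on the tensor square w(x) - w(y) acts as zero, while on the diagonal x = y
  the coefficients w_i become the partial derivatives of w. Since x and y agree on homology, this is
  how the Jacobian ideal enters.

  Why the integrality suffices: 2^n e(-1)^2 / 4^d being an integer bounds the 2-adic valuation of
  e(-1) below by d - n/2, and the valuation is an integer, so the bound rounds up to d - floor(n/2).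

  Quotients are avoided like tensor products: a statement about U/W is phrased for a pair of
  families W \<le> U.\<close>

locale vspace = vector_space scale for scale :: "'a::field \<Rightarrow> 'b::ab_group_add \<Rightarrow> 'b"
begin

text \<open>\<open>dim\<close> takes the value 0 on infinite-dimensional sets, so finiteness is
  carried as a separate predicate. The ambient space of families of bilinear forms may be
  infinite-dimensional; only its graded pieces are finite.\<close>

definition fdim :: "'b set \<Rightarrow> bool" where
  "fdim U \<longleftrightarrow> (\<exists>B. finite B \<and> U \<subseteq> span B)"

lemma fdim_subset: "fdim U \<Longrightarrow> W \<subseteq> U \<Longrightarrow> fdim W"
  unfolding fdim_def by blast

lemma fdim_basis:
  assumes "fdim U"
  obtains B where "finite B" "B \<subseteq> U" "independent B" "U \<subseteq> span B" "card B = dim U"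
proof -
  obtain A where A: "finite A" "U \<subseteq> span A" using assms unfolding fdim_def by blast
  obtain B where B: "B \<subseteq> U" "independent B" "U \<subseteq> span B" "card B = dim U"
    using basis_exists by blast
  have "finite B" using independent_span_bound[OF A(1) B(2)] B(1) A(2) by blast
  then show thesis using that B by blast
qed

lemma dim_insert_Suc:
  assumes "fdim S" "x \<notin> span S"
  shows "dim (insert x S) = Suc (dim S)"
proof -
  obtain B where B: "finite B" "B \<subseteq> S" "independent B" "S \<subseteq> span B" "card B = dim S"
    using fdim_basis[OF assms(1)] by blast
  have eq: "span B = span S" using B by (metis span_mono span_eq subset_antisym span_span)
  then have "x \<notin> span B" using assms(2) by simp
  then have ind: "independent (insert x B)" "x \<notin> B"
    using B(3) by (auto simp: independent_insert span_base)
  have "dim (insert x S) = card (insert x B)"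
  proof (rule dim_unique)
    show "insert x B \<subseteq> insert x S" using B by blast
    show "insert x S \<subseteq> span (insert x B)"
      using B(4) span_mono[of B "insert x B"] span_base[of x "insert x B"] by blast
  qed (use ind in auto)
  then show ?thesis using ind(2) B by simp
qed

lemma dim_mono_fdim:
  assumes "fdim U" "W \<subseteq> U"
  shows "dim W \<le> dim U"
proof -
  obtain B where B: "finite B" "B \<subseteq> U" "independent B" "U \<subseteq> span B" "card B = dim U"
    using fdim_basis[OF assms(1)] by blast
  have "dim W \<le> card B" by (rule dim_le_card) (use assms B in auto)
  then show ?thesis using B by simp
qed

lemma dim_eq_imp_eq:
  assumes "fdim U" "W \<subseteq> U" "subspace W" "dim W = dim U"
  shows "W = U"
proof (rule ccontr)
  assume "W \<noteq> U"
  then obtain x where x: "x \<in> U" "x \<notin> W" using assms by blast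
  then have "x \<notin> span W" using assms(3) by (simp add: span_eq_iff[THEN iffD2])
  then have "dim (insert x W) = Suc (dim W)"
    using dim_insert_Suc fdim_subset[OF assms(1,2)] by blast
  moreover have "dim (insert x W) \<le> dim U"
    by (rule dim_mono_fdim) (use assms x in auto)
  ultimately show False using assms by simp
qed

lemma subspace_preimage_sub:
  assumes f: "Vector_Spaces.linear scale scale f" and "subspace U" "subspace W"
  shows "subspace {u \<in> U. f u \<in> W}"
proof -
  interpret f: Vector_Spaces.linear scale scale f by fact
  show ?thesis using assms(2,3)
    by (auto simp: subspace_def f.add f.scale f.zero)
qed

lemma subspace_image_sum:
  assumes f: "Vector_Spaces.linear scale scale f" and "subspace U" "subspace W"
  shows "subspace {f u + w | u w. u \<in> U \<and> w \<in> W}"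
proof -
  interpret f: Vector_Spaces.linear scale scale f by fact
  have "{f u + w | u w. u \<in> U \<and> w \<in> W} = {x + y | x y. x \<in> f ` U \<and> y \<in> W}" by blast
  then show ?thesis
    using subspace_sums[OF f.subspace_image[OF assms(2)] assms(3)] by simp
qed

text \<open>Rank-nullity for the map from U to (f(U) + W)/W induced by \<open>f\<close>, written
  additively so that neither a quotient nor a subtraction of naturals occurs. A basis of the
  preimage of W is extended to one of U; the images of the new basis vectors are independent modulo
  W.\<close>

lemma dim_preimage_image_sum:
  assumes f: "Vector_Spaces.linear scale scale f"
    and U: "subspace U" "fdim U" and W: "subspace W" "fdim W"
  shows "dim U + dim W = dim {u \<in> U. f u \<in> W} + dim {f u + w | u w. u \<in> U \<and> w \<in> W}"
proof -
  interpret f: Vector_Spaces.linear scale scale f by fact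
  let ?K = "{u \<in> U. f u \<in> W}"
  have K: "subspace ?K" by (rule subspace_preimage_sub[OF f U(1) W(1)])
  have fK: "fdim ?K" by (rule fdim_subset[OF U(2)]) auto
  obtain C where C: "finite C" "C \<subseteq> ?K" "independent C" "?K \<subseteq> span C" "card C = dim ?K"
    using fdim_basis[OF fK] by blast
  have spC: "span C = ?K" using C K by (simp add: span_subspace)
  have CU: "C \<subseteq> U" using C by blast
  obtain B where B: "C \<subseteq> B" "B \<subseteq> U" "independent B" "U \<subseteq> span B"
    using maximal_independent_subset_extend[OF CU C(3)] by blast
  obtain A where "finite A" "U \<subseteq> span A" using U unfolding fdim_def by blast
  then have finB: "finite B" using independent_span_bound[of A B] B by blast
  have spB: "span B = U" using B U(1) by (simp add: span_subspace)
  have cB: "card B = dim U" using B by (simp add: basis_card_eq_dim)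
  \<comment> \<open>Each vector of \<open>E\<close> raises the dimension by one: a relation of its
    image modulo \<open>W\<close> would place it, up to a combination of the earlier vectors of
    \<open>E\<close>, in the preimage \<open>?K\<close> spanned by \<open>C\<close>.\<close>
  have main: "finite E \<Longrightarrow> E \<inter> C = {} \<Longrightarrow> independent (C \<union> E) \<Longrightarrow> E \<subseteq> U \<Longrightarrow>
      fdim (f ` E \<union> W) \<and> dim (f ` E \<union> W) = card E + dim W" for E
  proof (induction E rule: finite_induct)
    case empty
    then show ?case using W by simp
  next
    case (insert e E)
    have IH: "fdim (f ` E \<union> W)" "dim (f ` E \<union> W) = card E + dim W"
      using insert independent_mono[of "C \<union> insert e E" "C \<union> E"] by auto
    have ne: "e \<notin> span (C \<union> E)"
    proof
      assume "e \<in> span (C \<union> E)"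
      moreover have "(C \<union> insert e E) - {e} = C \<union> E" using insert by auto
      ultimately show False using insert.prems(2) unfolding dependent_def by auto
    qed
    have "f e \<notin> span (f ` E \<union> W)"
    proof
      assume "f e \<in> span (f ` E \<union> W)"
      then obtain x w where xw: "f e = x + w" "x \<in> span (f ` E)" "w \<in> span W"
        unfolding span_Un by blast
      have "w \<in> W" using xw W by (simp add: span_eq_iff[THEN iffD2])
      obtain u where u: "u \<in> span E" "x = f u" using xw(2) f.span_image by blast
      have uU: "u \<in> U" using u insert.prems U(1) span_minimal[of E U] by auto
      have "f (e - u) = w" using xw u by (simp add: f.diff)
      then have "e - u \<in> ?K" using insert.prems uU U(1) \<open>w \<in> W\<close> by (simp add: subspace_diff)
      then have "e - u \<in> span (C \<union> E)" using spC span_mono[of C "C \<union> E"] by blast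
      moreover have "u \<in> span (C \<union> E)" using u span_mono[of E "C \<union> E"] by blast
      ultimately have "e - u + u \<in> span (C \<union> E)" by (rule span_add)
      then show False using ne by simp
    qed
    then have "dim (insert (f e) (f ` E \<union> W)) = Suc (card E + dim W)"
      using dim_insert_Suc[OF IH(1)] IH(2) by simp
    moreover have "fdim (insert (f e) (f ` E \<union> W))"
    proof -
      obtain A where A: "finite A" "f ` E \<union> W \<subseteq> span A" using IH unfolding fdim_def by blast
      have "insert (f e) (f ` E \<union> W) \<subseteq> span (insert (f e) A)"
        using A(2) span_mono[of A "insert (f e) A"] span_base[of "f e" "insert (f e) A"] by blast
      then show ?thesis using A(1) unfolding fdim_def by blast
    qed
    ultimately show ?case using insert by simp
  qed
  define E where "E = B - C"
  have E: "finite E" "E \<inter> C = {}" "C \<union> E = B" using B finB E_def by auto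
  have d: "dim (f ` E \<union> W) = card E + dim W"
    using main[OF E(1,2)] E(3) B by auto
  have "span (f ` E \<union> W) = {f u + w | u w. u \<in> U \<and> w \<in> W}" (is "_ = ?S")
  proof
    have S: "subspace ?S" by (rule subspace_image_sum[OF f U(1) W(1)])
    have "f e \<in> ?S" if "e \<in> E" for e
    proof -
      have "e \<in> U" "0 \<in> W" using that E(3) B(2) W(1) by (auto simp: subspace_0)
      then show ?thesis by (metis (mono_tags, lifting) add.right_neutral mem_Collect_eq)
    qed
    moreover have "w \<in> ?S" if "w \<in> W" for w
    proof -
      have "f 0 + w \<in> ?S" using that U(1) subspace_0 by blast
      then show ?thesis by (simp add: f.zero)
    qed
    ultimately show "span (f ` E \<union> W) \<subseteq> ?S" by (intro span_minimal[OF _ S]) blast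
  next
    show "?S \<subseteq> span (f ` E \<union> W)"
    proof clarify
      fix u w assume u: "u \<in> U" and w: "w \<in> W"
      have "u \<in> span (C \<union> E)" using u spB E(3) by simp
      then obtain c x where cx: "u = c + x" "c \<in> span C" "x \<in> span E"
        unfolding span_Un by blast
      have 1: "f c \<in> span (f ` E \<union> W)" using cx(2) spC span_base by auto
      have "f x \<in> span (f ` E)" using cx(3) f.span_image by blast
      then have 2: "f x \<in> span (f ` E \<union> W)" using span_mono[of "f ` E" "f ` E \<union> W"] by blast
      show "f u + w \<in> span (f ` E \<union> W)"
        using 1 2 w span_base[of w "f ` E \<union> W"] by (simp add: cx(1) f.add span_add)
    qed
  qed
  then have "dim ?S = card E + dim W" using d by (metis dim_span)
  moreover have "card B = card C + card E" using E C(1) by (metis card_Un_disjoint inf_commute)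
  ultimately show ?thesis using cB C by simp
qed

end

section \<open>Values of rational power series at -1\<close>

text \<open>Evaluation at -1 of a series that need not converge there: F = p/(1 - X)^N has its only
  possible pole at 1, and (1 - X)^N takes the value 2^N at -1. The pair (N, p) is not unique, but
  the value is.\<close>

definition has_val :: "rat fps \<Rightarrow> rat \<Rightarrow> bool" where
  "has_val F c \<longleftrightarrow> (\<exists>N p. F * (1 - fps_X) ^ N = fps_of_poly p \<and> c = poly p (-1) / 2 ^ N)"

lemma fps_one_minus_X: "(1 - fps_X :: rat fps) = fps_of_poly [:1, -1:]"
  by (simp add: fps_of_poly_pCons)

lemma has_val_raise:
  assumes "F * (1 - fps_X) ^ N = fps_of_poly p" "N \<le> N'"
  shows "F * (1 - fps_X) ^ N' = fps_of_poly (p * [:1, -1:] ^ (N' - N))"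
    "poly (p * [:1, -1:] ^ (N' - N)) (-1) / 2 ^ N' = poly p (-1) / (2::rat) ^ N"
proof -
  have "F * (1 - fps_X) ^ N' = F * (1 - fps_X) ^ N * (1 - fps_X) ^ (N' - N)"
    using assms(2) by (simp add: mult.assoc flip: power_add)
  then show "F * (1 - fps_X) ^ N' = fps_of_poly (p * [:1, -1:] ^ (N' - N))"
    by (simp only: assms(1)[unfolded fps_one_minus_X] fps_of_poly_mult fps_of_poly_power fps_one_minus_X)
  have "(2::rat) ^ N' = 2 ^ N * 2 ^ (N' - N)"
    using assms(2) by (simp flip: power_add)
  then show "poly (p * [:1, -1:] ^ (N' - N)) (-1) / 2 ^ N' = poly p (-1) / (2::rat) ^ N"
    by (simp add: poly_power)
qed

lemma has_val_unique:
  assumes "has_val F a" "has_val F b"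
  shows "a = b"
proof -
  obtain N p where N: "F * (1 - fps_X) ^ N = fps_of_poly p" "a = poly p (-1) / 2 ^ N"
    using assms(1) unfolding has_val_def by blast
  obtain M q where M: "F * (1 - fps_X) ^ M = fps_of_poly q" "b = poly q (-1) / 2 ^ M"
    using assms(2) unfolding has_val_def by blast
  note 1 = has_val_raise[OF N(1) max.cobounded1[of N M]] and 2 = has_val_raise[OF M(1) max.cobounded2[of M N]]
  have "p * [:1, -1:] ^ (max N M - N) = q * [:1, -1:] ^ (max N M - M)"
    by (rule iffD1[OF fps_of_poly_eq_iff], rule trans[OF 1(1)[symmetric] 2(1)])
  then show ?thesis using 1(2) 2(2) N(2) M(2) by metis
qed

lemma has_val_add:
  assumes "has_val F a" "has_val G b"
  shows "has_val (F + G) (a + b)"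
proof -
  obtain N p where N: "F * (1 - fps_X) ^ N = fps_of_poly p" "a = poly p (-1) / 2 ^ N"
    using assms(1) unfolding has_val_def by blast
  obtain M q where M: "G * (1 - fps_X) ^ M = fps_of_poly q" "b = poly q (-1) / 2 ^ M"
    using assms(2) unfolding has_val_def by blast
  let ?K = "max N M"
  note 1 = has_val_raise[OF N(1), of ?K] and 2 = has_val_raise[OF M(1), of ?K]
  let ?p = "p * [:1, -1:] ^ (?K - N)" and ?q = "q * [:1, -1:] ^ (?K - M)"
  have "(F + G) * (1 - fps_X) ^ ?K = fps_of_poly (?p + ?q)"
    using 1(1) 2(1) by (simp only: distrib_right fps_of_poly_add max.cobounded1 max.cobounded2 simp_thms)
  moreover have "a + b = poly (?p + ?q) (-1) / 2 ^ ?K"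
    using 1(2) 2(2) N(2) M(2) by (simp only: poly_add add_divide_distrib max.cobounded1 max.cobounded2)
  ultimately show ?thesis unfolding has_val_def by blast
qed

lemma has_val_mult:
  assumes "has_val F a" "has_val G b"
  shows "has_val (F * G) (a * b)"
proof -
  obtain N p where N: "F * (1 - fps_X) ^ N = fps_of_poly p" "a = poly p (-1) / 2 ^ N"
    using assms(1) unfolding has_val_def by blast
  obtain M q where M: "G * (1 - fps_X) ^ M = fps_of_poly q" "b = poly q (-1) / 2 ^ M"
    using assms(2) unfolding has_val_def by blast
  have "F * G * (1 - fps_X) ^ (N + M) = (F * (1 - fps_X) ^ N) * (G * (1 - fps_X) ^ M)"
    by (simp add: power_add mult_ac)
  then have "F * G * (1 - fps_X) ^ (N + M) = fps_of_poly (p * q)"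
    using N M by (simp add: fps_of_poly_mult)
  moreover have "a * b = poly (p * q) (-1) / 2 ^ (N + M)"
    using N M by (simp add: power_add)
  ultimately show ?thesis unfolding has_val_def by blast
qed

lemma has_val_poly: "has_val (fps_of_poly p) (poly p (-1))"
  unfolding has_val_def by (intro exI[of _ 0] exI[of _ p]) simp

lemma has_val_X_power: "has_val (fps_X ^ k) ((-1) ^ k)"
  using has_val_poly[of "monom 1 k"] by (simp add: fps_of_poly_monom' poly_monom)

lemma has_val_const: "has_val (fps_const c) c"
  using has_val_poly[of "[:c:]"] by (simp add: fps_of_poly_pCons)

lemma has_val_diff:
  assumes "has_val F a" "has_val G b"
  shows "has_val (F - G) (a - b)"
proof -
  have "F - G = F + fps_const (-1) * G" by (rule fps_ext) simp
  then show ?thesis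
    using has_val_add[OF assms(1) has_val_mult[OF has_val_const[of "-1"] assms(2)]]
    by (simp only: mult_minus_left mult_1 add_uminus_conv_diff)
qed

lemma has_val_sum:
  assumes "\<And>x. x \<in> S \<Longrightarrow> has_val (F x) (a x)"
  shows "has_val (\<Sum>x\<in>S. F x) (\<Sum>x\<in>S. a x)"
  using assms
proof (induction S rule: infinite_finite_induct)
  case (insert x S)
  then show ?case by (simp add: has_val_add)
qed (use has_val_const[of 0] in auto)

lemma has_val_cancel:
  assumes "has_val (F * (1 - fps_X) ^ k) c"
  shows "has_val F (c / 2 ^ k)"
proof -
  obtain N p where N: "F * (1 - fps_X) ^ k * (1 - fps_X) ^ N = fps_of_poly p" "c = poly p (-1) / 2 ^ N"
    using assms unfolding has_val_def by blast
  then have "F * (1 - fps_X) ^ (k + N) = fps_of_poly p" "c / 2 ^ k = poly p (-1) / 2 ^ (k + N)"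
    by (simp_all add: power_add mult_ac)
  then show ?thesis unfolding has_val_def by blast
qed

lemma has_val_finite_support:
  assumes "\<And>r. r \<ge> K \<Longrightarrow> a r = 0"
  shows "has_val (Abs_fps a) (\<Sum>r<K. a r * (-1) ^ r)"
proof -
  have "Abs_fps a = (\<Sum>r<K. fps_const (a r) * fps_X ^ r)"
    using assms by (intro fps_ext)
      (auto simp: fps_sum_nth fps_X_power_nth if_distrib[of "\<lambda>x. _ * x"] not_less cong: if_cong)
  then show ?thesis
    by (simp add: has_val_sum has_val_mult has_val_const has_val_X_power)
qed

section \<open>Graded families with commuting lowering operators\<close>

lemma antitone_nat_stable:
  fixes f :: "nat \<Rightarrow> nat"
  assumes "\<And>r. f (Suc r) \<le> f r"
  obtains r0 where "\<And>r. r \<ge> r0 \<Longrightarrow> f r = f r0"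
proof -
  define v where "v = (LEAST v. v \<in> range f)"
  have "v \<in> range f" unfolding v_def by (rule LeastI_ex) blast
  then obtain r0 where r0: "v = f r0" by blast
  have "f r = f r0" if "r \<ge> r0" for r
  proof (rule antisym)
    show "f r \<le> f r0" using lift_Suc_antimono_le[of f] assms that by blast
    show "f r0 \<le> f r" unfolding r0[symmetric] v_def by (rule Least_le) blast
  qed
  then show thesis using that by blast
qed

text \<open>Models the graded dual of a graded module over a polynomial ring: the transpose of a
  variable of degree 1 lowers degrees by 1. Degrees belong to the families of subspaces, not to the
  ambient space.\<close>

locale lowering_ops = vspace scale for scale :: "'a::field \<Rightarrow> 'b::ab_group_add \<Rightarrow> 'b" +
  fixes act :: "'i \<Rightarrow> 'b \<Rightarrow> 'b"
  assumes linear_act: "Vector_Spaces.linear scale scale (act i)"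
    and act_commute: "act i (act j v) = act j (act i v)"
begin

definition fam :: "(int \<Rightarrow> 'b set) \<Rightarrow> bool" where
  "fam U \<longleftrightarrow> (\<forall>j. subspace (U j) \<and> (\<forall>i. \<forall>u\<in>U j. act i u \<in> U (j - 1)))"

text \<open>The descending chain condition for graded submodules of U/W, dual to
  noetherianity.\<close>

definition dcc :: "(int \<Rightarrow> 'b set) \<Rightarrow> (int \<Rightarrow> 'b set) \<Rightarrow> bool" where
  "dcc W U \<longleftrightarrow> (\<forall>C::nat \<Rightarrow> int \<Rightarrow> 'b set.
     (\<forall>r. fam (C r) \<and> W \<le> C r \<and> C r \<le> U \<and> C (Suc r) \<le> C r) \<longrightarrow> (\<exists>r0. \<forall>r\<ge>r0. C r = C r0))"

text \<open>For an operator \<open>f\<close> that lowers degrees by \<open>s\<close>,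
  \<open>ker_fam\<close> modulo W is the kernel of the map that \<open>f\<close> induces on
  quotients by W; \<open>im_fam\<close> below is its image, with W added back so that it is again a
  family above W.\<close>

definition ker_fam where "ker_fam f s U W = (\<lambda>j::int. {u \<in> U j. f u \<in> W (j - s)})"

definition im_fam where "im_fam f s U W = (\<lambda>j::int. {f u + w | u w. u \<in> U (j + s) \<and> w \<in> W j})"

lemma le_famD: "U \<le> U' \<Longrightarrow> u \<in> U j \<Longrightarrow> u \<in> U' j" for U :: "int \<Rightarrow> 'b set"
  by (auto simp: le_fun_def)

lemma fam_subspace: "fam U \<Longrightarrow> subspace (U j)"
  unfolding fam_def by blast

lemma fam_act: "fam U \<Longrightarrow> u \<in> U j \<Longrightarrow> act i u \<in> U (j - 1)"
  unfolding fam_def by blast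

lemma act_add: "act i (u + v) = act i u + act i v"
proof -
  interpret f: Vector_Spaces.linear scale scale "act i" by (rule linear_act)
  show ?thesis by (rule f.add)
qed

lemma linear_foldr_act: "Vector_Spaces.linear scale scale (foldr act xs)"
proof (induction xs)
  case Nil
  then show ?case by (simp add: id_def linear_ident)
next
  case (Cons i xs)
  interpret f: Vector_Spaces.linear scale scale "act i" by (rule linear_act)
  interpret g: Vector_Spaces.linear scale scale "foldr act xs" by (rule Cons.IH)
  show ?case by (simp add: Vector_Spaces.linear_iff vector_space_axioms f.add f.scale g.add g.scale)
qed

lemma fam_foldr_act: "fam U \<Longrightarrow> u \<in> U j \<Longrightarrow> foldr act xs u \<in> U (j - int (length xs))"
proof (induction xs)
  case (Cons i xs)
  then have "act i (foldr act xs u) \<in> U (j - int (length xs) - 1)" by (simp add: fam_act)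
  then show ?case by (simp add: algebra_simps)
qed simp

lemma linear_act_pow: "Vector_Spaces.linear scale scale (act i ^^ s)"
  using linear_foldr_act[of "replicate s i"] by simp

lemma act_pow_commute: "(act i ^^ s) (act j v) = act j ((act i ^^ s) v)"
  by (induction s) (simp_all add: act_commute)

lemma fam_act_pow: "fam U \<Longrightarrow> u \<in> U j \<Longrightarrow> (act i ^^ s) u \<in> U (j - int s)"
  using fam_foldr_act[of U u j "replicate s i"] by simp

lemma fam_ker:
  assumes f: "Vector_Spaces.linear scale scale f" "\<And>i v. f (act i v) = act i (f v)"
    and "fam U" "fam W"
  shows "fam (ker_fam f s U W)"
  unfolding fam_def ker_fam_def
proof (intro allI conjI ballI)
  fix j i u assume u: "u \<in> {u \<in> U j. f u \<in> W (j - s)}"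
  then have "act i (f u) \<in> W (j - s - 1)" using fam_act[OF assms(4)] by blast
  then show "act i u \<in> {u \<in> U (j - 1). f u \<in> W (j - 1 - s)}"
    using u fam_act[OF assms(3)] f(2) by (simp add: algebra_simps)
qed (use subspace_preimage_sub[OF f(1)] assms fam_subspace in auto)

lemma fam_im:
  assumes f: "Vector_Spaces.linear scale scale f" "\<And>i v. f (act i v) = act i (f v)"
    and "fam U" "fam W"
  shows "fam (im_fam f s U W)"
  unfolding fam_def im_fam_def
proof (intro allI conjI ballI)
  fix j i x assume "x \<in> {f u + w |u w. u \<in> U (j + s) \<and> w \<in> W j}"
  then obtain u w where uw: "x = f u + w" "u \<in> U (j + s)" "w \<in> W j" by blast
  have "act i x = f (act i u) + act i w" by (simp add: uw(1) act_add f(2))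
  moreover have "act i u \<in> U (j - 1 + s)" using fam_act[OF assms(3) uw(2), of i] by (simp add: algebra_simps)
  moreover have "act i w \<in> W (j - 1)" using fam_act[OF assms(4) uw(3)] .
  ultimately show "act i x \<in> {f u + w |u w. u \<in> U (j - 1 + s) \<and> w \<in> W (j - 1)}" by blast
qed (use subspace_image_sum[OF f(1)] assms fam_subspace in auto)

section \<open>Descending chain condition: the dual of Hilbert's basis theorem\<close>

lemma dcc_sub: "dcc W U \<Longrightarrow> W \<le> W' \<Longrightarrow> U' \<le> U \<Longrightarrow> dcc W' U'"
  unfolding dcc_def by (meson order_trans)

text \<open>The stabilization index has to be uniform in \<open>s\<close>. The diagonal stabilizes
  at some \<open>r1\<close>, and by monotonicity this settles all rows from \<open>r1\<close> on;
  the finitely many rows before it stabilize one at a time, and a maximum is taken.\<close>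

lemma dcc_double:
  fixes L :: "nat \<Rightarrow> nat \<Rightarrow> int \<Rightarrow> 'b set"
  assumes "dcc W K" and L: "\<And>s i. fam (L s i)" "\<And>s i. W \<le> L s i" "\<And>s i. L s i \<le> K"
    and dec: "\<And>s i. L (Suc s) i \<le> L s i" "\<And>s i. L s (Suc i) \<le> L s i"
  shows "\<exists>r0. \<forall>s. \<forall>i\<ge>r0. L s i = L s r0"
proof -
  have d1: "L s' i \<le> L s i" if "s \<le> s'" for s s' i
    using lift_Suc_antimono_le[of "\<lambda>s. L s i"] dec(1) that by blast
  have d2: "L s i' \<le> L s i" if "i \<le> i'" for s i i'
    using lift_Suc_antimono_le[of "\<lambda>i. L s i"] dec(2) that by blast
  have d: "L s' i' \<le> L s i" if "s \<le> s'" "i \<le> i'" for s s' i i'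
    using d1[OF that(1)] d2[OF that(2)] order_trans by blast
  have "\<exists>r0. \<forall>r\<ge>r0. L r r = L r0 r0"
    using assms(1) L d[of _ "Suc _" _ "Suc _"] unfolding dcc_def by (meson le_SucI order_refl)
  then obtain r1 where r1: "\<And>r. r \<ge> r1 \<Longrightarrow> L r r = L r1 r1" by blast
  have "\<exists>r0. \<forall>r\<ge>r0. L s r = L s r0" for s
    using assms(1) L dec(2) unfolding dcc_def by blast
  then obtain \<rho> where \<rho>: "\<And>s r. r \<ge> \<rho> s \<Longrightarrow> L s r = L s (\<rho> s)" by metis
  define r0 where "r0 = Max (insert r1 (\<rho> ` {..<r1}))"
  have r0: "r1 \<le> r0" "\<And>s. s < r1 \<Longrightarrow> \<rho> s \<le> r0" unfolding r0_def by auto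
  have "L s i = L s r0" if i: "i \<ge> r0" for s i
  proof (cases "s < r1")
    case True
    then show ?thesis using \<rho>[of s i] \<rho>[of s r0] r0(2)[of s] i by simp
  next
    case False
    have *: "L s i = L r1 r1" if "i \<ge> r1" for i
    proof (rule antisym)
      show "L s i \<le> L r1 r1" using d[of r1 s r1 i] False that by simp
      have "L (max s i) (max s i) \<le> L s i" by (rule d) auto
      then show "L r1 r1 \<le> L s i" using r1[of "max s i"] that by simp
    qed
    show ?thesis using *[of i] *[of r0] i r0(1) by simp
  qed
  then show ?thesis by blast
qed

text \<open>Outside the degrees from \<open>j0\<close> to \<open>j1 - 1\<close> every member of a
  chain equals W, so a chain can only move in finitely many finite-dimensional pieces; the sum of
  their dimensions decreases.\<close>

lemma dcc_finite:
  assumes fd: "\<And>j. fdim (U j)" and low: "\<And>j. j < j0 \<Longrightarrow> U j \<subseteq> W j" and high: "\<And>j. j \<ge> j1 \<Longrightarrow> U j \<subseteq> W j"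
  shows "dcc W U"
  unfolding dcc_def
proof (intro allI impI)
  fix C :: "nat \<Rightarrow> int \<Rightarrow> 'b set"
  assume C: "\<forall>r. fam (C r) \<and> W \<le> C r \<and> C r \<le> U \<and> C (Suc r) \<le> C r"
  have fC: "fdim (C r j)" for r j using fdim_subset[OF fd[of j]] C by (auto simp: le_fun_def)
  have CU: "C r j \<subseteq> U j" "W j \<subseteq> C r j" "C (Suc r) j \<subseteq> C r j" for r j using C by (auto simp: le_fun_def)
  have mono: "C r' j \<subseteq> C r j" if "r \<le> r'" for r r' j
    using lift_Suc_antimono_le[of "\<lambda>r. C r j"] CU(3) that by blast
  define f where "f r = (\<Sum>j\<in>{j0..<j1}. dim (C r j))" for r
  have "f (Suc r) \<le> f r" for r
    unfolding f_def by (intro sum_mono dim_mono_fdim fC CU)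
  then obtain r0 where r0: "\<And>r. r \<ge> r0 \<Longrightarrow> f r = f r0" using antitone_nat_stable by blast
  have "C r j = C r0 j" if r: "r \<ge> r0" for r j
  proof (cases "j \<in> {j0..<j1}")
    case True
    have "dim (C r j) = dim (C r0 j)"
      by (rule sum_mono_inv[OF r0[OF r, unfolded f_def] _ True])
        (use dim_mono_fdim[OF fC mono[OF r]] in auto)
    then show ?thesis using dim_eq_imp_eq[OF fC mono[OF r]] C fam_subspace by blast
  next
    case False
    then have "U j \<subseteq> W j" using low[of j] high[of j] by (cases "j < j0") auto
    then show ?thesis using CU by blast
  qed
  then show "\<exists>r0. \<forall>r\<ge>r0. C r = C r0" by blast
qed

text \<open>Dual of the leading-coefficient modules in the proof of Hilbert's basis theorem.\<close>

definition lead_fam where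
  "lead_fam m W s U = im_fam (act m ^^ s) (int s) (ker_fam (act m ^^ Suc s) (int (Suc s)) U W) W"

lemma mem_lead_fam:
  "x \<in> lead_fam m W s U j \<longleftrightarrow>
     (\<exists>u w. x = (act m ^^ s) u + w \<and> u \<in> U (j + int s) \<and> (act m ^^ Suc s) u \<in> W (j - 1) \<and> w \<in> W j)"
  unfolding lead_fam_def im_fam_def ker_fam_def by (auto simp: algebra_simps)

lemma fam_lead_fam: "fam W \<Longrightarrow> fam U \<Longrightarrow> fam (lead_fam m W s U)"
  unfolding lead_fam_def by (intro fam_im fam_ker linear_act_pow act_pow_commute)

text \<open>If \<open>u\<close> is a witness for \<open>Suc s\<close>, then \<open>act m u\<close>
  is one for \<open>s\<close>. Dually, leading-coefficient modules grow with the exponent.\<close>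

lemma lead_fam_Suc:
  assumes "fam U"
  shows "lead_fam m W (Suc s) U \<le> lead_fam m W s U"
proof (rule le_funI, rule subsetI)
  fix j x assume "x \<in> lead_fam m W (Suc s) U j"
  then obtain u w where u: "x = (act m ^^ Suc s) u + w" "u \<in> U (j + int (Suc s))"
     "(act m ^^ Suc (Suc s)) u \<in> W (j - 1)" "w \<in> W j" unfolding mem_lead_fam by blast
  have "act m u \<in> U (j + int s)" using fam_act[OF assms u(2), of m] by (simp add: algebra_simps)
  moreover have "(act m ^^ s) (act m u) = (act m ^^ Suc s) u" "(act m ^^ Suc s) (act m u) = (act m ^^ Suc (Suc s)) u"
    by (simp_all add: act_pow_commute)
  ultimately show "x \<in> lead_fam m W s U j" unfolding mem_lead_fam using u by metis
qed

lemma lead_fam_mono: "U \<le> U' \<Longrightarrow> lead_fam m W s U \<le> lead_fam m W s U'"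
  by (rule le_funI, rule subsetI, unfold mem_lead_fam) (blast dest: le_famD)

text \<open>Dual of the fact that nested submodules with the same leading coefficients coincide. The
  induction is on the power of \<open>act m\<close> that moves \<open>u\<close> into W: some
  \<open>v\<close> in U has the same penultimate image modulo W, and \<open>u - v\<close> is moved
  into W one power earlier.\<close>

lemma lead_fam_reflects:
  assumes fams: "fam W" "fam U" "fam U'" and "W \<le> U" "U \<le> U'"
    and low: "\<And>j. j < j0 \<Longrightarrow> U' j \<subseteq> W j"
    and lead: "\<And>s. lead_fam m W s U' \<le> lead_fam m W s U"
  shows "U' \<le> U"
proof (rule le_funI, rule subsetI)
  have main: "u \<in> U' j \<Longrightarrow> (act m ^^ s) u \<in> W (j - int s) \<Longrightarrow> u \<in> U j" for s j u
  proof (induction s arbitrary: u)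
    case 0
    then show ?case using assms(4) by (auto simp: le_fun_def)
  next
    case (Suc s)
    have "(act m ^^ s) u \<in> lead_fam m W s U' (j - int s)"
      unfolding mem_lead_fam
    proof (intro exI conjI)
      show "(act m ^^ s) u = (act m ^^ s) u + 0" by simp
      show "(act m ^^ Suc s) u \<in> W (j - int s - 1)" using Suc.prems(2) by (simp add: algebra_simps)
    qed (use Suc fam_subspace[OF fams(1)] subspace_0 in auto)
    then have "(act m ^^ s) u \<in> lead_fam m W s U (j - int s)" using lead by (auto simp: le_fun_def)
    then obtain v w where v: "(act m ^^ s) u = (act m ^^ s) v + w" "v \<in> U (j - int s + int s)"
      "(act m ^^ Suc s) v \<in> W (j - int s - 1)" "w \<in> W (j - int s)" unfolding mem_lead_fam by blast
    interpret f: Vector_Spaces.linear scale scale "act m ^^ s" by (rule linear_act_pow)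
    have "(act m ^^ s) (u - v) = w" using v(1) by (simp add: f.diff)
    moreover have "v \<in> U j" using v(2) by simp
    moreover have "u - v \<in> U' j"
      using Suc.prems(1) le_famD[OF assms(5) \<open>v \<in> U j\<close>] fam_subspace[OF fams(3)] subspace_diff by blast
    ultimately have "u - v \<in> U j" using Suc.IH v(4) by simp
    then have "u - v + v \<in> U j" using \<open>v \<in> U j\<close> fam_subspace[OF fams(2)] subspace_add by blast
    then show ?case by simp
  qed
  fix j u assume u: "u \<in> U' j"
  \<comment> \<open>So many steps lead to a degree below \<open>j0\<close>, where \<open>U'\<close>
    is contained in W.\<close>
  define s where "s = nat (j - j0) + 1"
  have "(act m ^^ s) u \<in> U' (j - int s)" using fam_act_pow[OF fams(3) u] .
  then have "(act m ^^ s) u \<in> W (j - int s)" using low[of "j - int s"] unfolding s_def by force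
  then show "u \<in> U j" using main u by blast
qed

text \<open>Dual of Hilbert's basis theorem, by induction on the set \<open>S\<close> of operators
  acting nontrivially on U/W. The hypothesis \<open>cogen\<close> bounds the degrees of the socle of
  U/W, as finite generation bounds degrees of generators. On the kernel K of \<open>act m\<close>
  modulo W one operator fewer acts, so K satisfies the chain condition; the leading families of a
  chain in U lie between W and K and form a doubly descending array.\<close>

lemma dcc_of_cogenerated:
  assumes "finite S"
    and "fam W" "fam U" "W \<le> U" "\<And>j. fdim (U j)"
    and low: "\<And>j. j < j0 \<Longrightarrow> U j \<subseteq> W j"
    and ann: "\<And>i j u. i \<notin> S \<Longrightarrow> u \<in> U j \<Longrightarrow> act i u \<in> W (j - 1)"
    and cogen: "\<And>j u. j \<ge> j1 \<Longrightarrow> u \<in> U j \<Longrightarrow> (\<And>i. i \<in> S \<Longrightarrow> act i u \<in> W (j - 1)) \<Longrightarrow> u \<in> W j"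
  shows "dcc W U"
  using assms
proof (induction S arbitrary: U rule: finite_induct)
  case empty
  then show ?case by (intro dcc_finite[of U j0 W j1]) auto
next
  case (insert m S)
  define K where "K = ker_fam (act m) 1 U W"
  have fK: "fam K" unfolding K_def by (intro fam_ker linear_act act_commute insert.prems)
  have KU: "K \<le> U" unfolding K_def ker_fam_def by (auto simp: le_fun_def)
  have memK: "u \<in> K j \<longleftrightarrow> u \<in> U j \<and> act m u \<in> W (j - 1)" for u j unfolding K_def ker_fam_def by simp
  have WK: "W \<le> K"
    by (rule le_funI, rule subsetI, unfold memK) (blast intro: fam_act[OF insert.prems(1)] le_famD[OF insert.prems(3)])
  have dK: "dcc W K"
  proof (rule insert.IH)
    show "fam W" "fam K" "W \<le> K" by fact+
    show "fdim (K j)" for j using fdim_subset[OF insert.prems(4)] KU by (auto simp: le_fun_def)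
    show "K j \<subseteq> W j" if "j < j0" for j using insert.prems(5)[OF that] memK by blast
    show "act i u \<in> W (j - 1)" if "i \<notin> S" "u \<in> K j" for i j u
      using that insert.prems(6)[of i u j] memK by (cases "i = m") auto
    show "u \<in> W j" if "j \<ge> j1" "u \<in> K j" "\<And>i. i \<in> S \<Longrightarrow> act i u \<in> W (j - 1)" for j u
      using insert.prems(7)[of j u] that memK by blast
  qed
  show ?case
    unfolding dcc_def
  proof (intro allI impI)
    fix C :: "nat \<Rightarrow> int \<Rightarrow> 'b set"
    assume C: "\<forall>r. fam (C r) \<and> W \<le> C r \<and> C r \<le> U \<and> C (Suc r) \<le> C r"
    have CU: "C r j \<subseteq> U j" for r j using C by (auto simp: le_fun_def)
    have mono: "C r' \<le> C r" if "r \<le> r'" for r r'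
      using lift_Suc_antimono_le[of C] C that by blast
    have "\<exists>r0. \<forall>s. \<forall>r\<ge>r0. lead_fam m W s (C r) = lead_fam m W s (C r0)"
    proof (rule dcc_double[OF dK])
      show "fam (lead_fam m W s (C r))" for s r using C fam_lead_fam insert.prems(1) by blast
      show "W \<le> lead_fam m W s (C r)" for s r
      proof (rule le_funI, rule subsetI)
        fix j w assume "w \<in> W j"
        moreover have "(act m ^^ t) 0 = 0" for t
        proof -
          interpret f: Vector_Spaces.linear scale scale "act m ^^ t" by (rule linear_act_pow)
          show ?thesis by (rule f.zero)
        qed
        ultimately show "w \<in> lead_fam m W s (C r) j" unfolding mem_lead_fam
          using C fam_subspace subspace_0 insert.prems(1) by (intro exI[of _ 0] exI[of _ w]) (auto simp del: funpow.simps)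
      qed
      show "lead_fam m W s (C r) \<le> K" for s r
      proof (rule le_funI, rule subsetI)
        fix j x assume "x \<in> lead_fam m W s (C r) j"
        then obtain u w where u: "x = (act m ^^ s) u + w" "u \<in> C r (j + int s)"
          "(act m ^^ Suc s) u \<in> W (j - 1)" "w \<in> W j" unfolding mem_lead_fam by blast
        have 1: "(act m ^^ s) u \<in> U j" 
          using fam_act_pow[OF insert.prems(2) subsetD[OF CU u(2)], where i = m and s = s] by simp
        have 2: "w \<in> U j" using insert.prems(3) u(4) by (auto simp: le_fun_def)
        have 3: "x \<in> U j" using 1 2 u(1) fam_subspace[OF insert.prems(2)] subspace_add by blast
        have "act m x = (act m ^^ Suc s) u + act m w" by (simp add: u(1) act_add)
        then have "act m x \<in> W (j - 1)"
          using u(3) fam_act[OF insert.prems(1) u(4)] fam_subspace[OF insert.prems(1)] subspace_add by metis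
        then show "x \<in> K j" using 3 memK by blast
      qed
      show "lead_fam m W (Suc s) (C r) \<le> lead_fam m W s (C r)" for s r using lead_fam_Suc C by blast
      show "lead_fam m W s (C (Suc r)) \<le> lead_fam m W s (C r)" for s r using lead_fam_mono C by blast
    qed
    then obtain r0 where r0: "\<And>s r. r \<ge> r0 \<Longrightarrow> lead_fam m W s (C r) = lead_fam m W s (C r0)" by blast
    have "C r = C r0" if "r \<ge> r0" for r
    proof (rule antisym)
      show "C r \<le> C r0" using mono that by blast
      show "C r0 \<le> C r"
      proof (rule lead_fam_reflects[where W=W and m=m and ?j0.0=j0])
        show "C r0 j \<subseteq> W j" if "j < j0" for j using insert.prems(5)[OF that] CU by blast
        show "lead_fam m W s (C r0) \<le> lead_fam m W s (C r)" for s using r0[OF that] by simp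
      qed (use C mono that insert.prems(1) in auto)
    qed
    then show "\<exists>r0. \<forall>r\<ge>r0. C r = C r0" by blast
  qed
qed

text \<open>Converse direction: the chain condition bounds the degrees of the socle of U/W, as
  noetherianity yields finitely many generators. The chain \<open>C\<close> below is constant from
  some \<open>r0\<close> on. A socle element of degree j > r0 lies in \<open>C (j - 1)\<close>,
  since every nonempty word of operators sends it into W; hence it lies in \<open>C j\<close>, where
  also the empty word counts, and this says that it is in W.\<close>

lemma dcc_cogenerated:
  assumes "fam W" "fam U" "W \<le> U" "dcc W U"
  obtains j1 where "\<And>j u. j \<ge> j1 \<Longrightarrow> u \<in> U j \<Longrightarrow> (\<And>i. act i u \<in> W (j - 1)) \<Longrightarrow> u \<in> W j"
proof -
  text \<open>\<open>C r\<close> is the largest family between \<open>W\<close> and \<open>U\<close> that agrees with \<open>W\<close> up to degree \<open>r\<close>.\<close>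
  define C where "C r j = {u \<in> U j. \<forall>xs. j - int (length xs) \<le> int r \<longrightarrow>
      foldr act xs u \<in> W (j - int (length xs))}" for r :: nat and j
  have "fam (C r)" for r
    unfolding fam_def
  proof (intro allI conjI ballI)
    fix j
    interpret g: Vector_Spaces.linear scale scale "foldr act xs" for xs by (rule linear_foldr_act)
    show "subspace (C r j)"
      using fam_subspace[OF assms(1)] fam_subspace[OF assms(2), of j]
      by (auto simp: subspace_def C_def g.add g.scale g.zero)
    fix u i assume u: "u \<in> C r j"
    show "act i u \<in> C r (j - 1)"
      unfolding C_def mem_Collect_eq
    proof (intro conjI allI impI)
      show "act i u \<in> U (j - 1)" using u fam_act[OF assms(2)] by (simp add: C_def)
      fix xs :: "'i list" assume "j - 1 - int (length xs) \<le> int r"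
      then have "j - int (length (xs @ [i])) \<le> int r" by simp
      then have "foldr act (xs @ [i]) u \<in> W (j - int (length (xs @ [i])))"
        using u unfolding C_def by blast
      then show "foldr act xs (act i u) \<in> W (j - 1 - int (length xs))" by (simp add: algebra_simps)
    qed
  qed
  moreover have "W \<le> C r" for r
    unfolding le_fun_def C_def using fam_foldr_act[OF assms(1)] le_famD[OF assms(3)] by blast
  moreover have "C r \<le> U" "C (Suc r) \<le> C r" for r by (auto simp: le_fun_def C_def)
  ultimately obtain r0 where r0: "\<And>r. r \<ge> r0 \<Longrightarrow> C r = C r0"
    using assms(4) unfolding dcc_def by blast
  show thesis
  proof (rule that[of "int r0 + 1"])
    fix j u assume j: "int r0 + 1 \<le> j" and u: "u \<in> U j" and a: "\<And>i. act i u \<in> W (j - 1)"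
    define r where "r = nat (j - 1)"
    have r: "int r = j - 1" "r \<ge> r0" using j by (auto simp: r_def)
    have "u \<in> C r j"
      unfolding C_def mem_Collect_eq
    proof (intro conjI allI impI u)
      fix xs :: "'i list" assume "j - int (length xs) \<le> int r"
      then obtain ys i where "xs = ys @ [i]" using r(1) by (cases xs rule: rev_cases) auto
      then show "foldr act xs u \<in> W (j - int (length xs))"
        using fam_foldr_act[OF assms(1) a[of i], of ys] by (simp add: algebra_simps)
    qed
    moreover have "C r = C (Suc r)" using r0[of r] r0[of "Suc r"] r by simp
    ultimately have "u \<in> C (Suc r) j" by simp
    then have "foldr act [] u \<in> W (j - int (length ([] :: 'i list)))"
      unfolding C_def mem_Collect_eq using r(1) by (elim conjE allE[of _ "[]"]) simp
    then show "u \<in> W j" by simp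
  qed
qed

text \<open>Induction on the operators acting nontrivially. With K the kernel and U/I the cokernel
  of \<open>act m\<close> on U/W, exactness gives (1 - X) H(U/W) = H(K/W) - X H(U/I), and
  \<open>act m\<close> vanishes on both K/W and U/I. If all operators vanish, U/W is its own socle
  and lives in finitely many degrees.\<close>

lemma hilbert_serre:
  assumes "finite S"
    and "fam W" "fam U" "W \<le> U" "\<And>j. fdim (U j)"
    and low: "\<And>j. j < j0 \<Longrightarrow> U j \<subseteq> W j"
    and ann: "\<And>i j u. i \<notin> S \<Longrightarrow> u \<in> U j \<Longrightarrow> act i u \<in> W (j - 1)"
    and "dcc W U"
  shows "\<exists>c. has_val (Abs_fps (\<lambda>r. of_nat (dim (U (j0 + int r))) - of_nat (dim (W (j0 + int r))))) c"
  using assms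
proof (induction S arbitrary: U W rule: finite_induct)
  case empty
  obtain j1 where j1: "\<And>j u. j \<ge> j1 \<Longrightarrow> u \<in> U j \<Longrightarrow> (\<And>i. act i u \<in> W (j - 1)) \<Longrightarrow> u \<in> W j"
    using dcc_cogenerated[OF empty.prems(1-3,7)] by blast
  have "U j = W j" if "j \<ge> j1" for j
    using j1[OF that] empty.prems(6) empty.prems(3) by (auto simp: le_fun_def)
  then have "of_nat (dim (U (j0 + int r))) - of_nat (dim (W (j0 + int r))) = (0::rat)" if "r \<ge> nat (j1 - j0)" for r
    using that by simp
  then show ?case by (intro exI) (rule has_val_finite_support)
next
  case (insert m S)
  have fdW: "fdim (W j)" for j using fdim_subset[OF insert.prems(4)] insert.prems(3) by (auto simp: le_fun_def)
  define K where "K = ker_fam (act m) 1 U W"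
  define I where "I = im_fam (act m) 1 U W"
  have fK: "fam K" "fam I" unfolding K_def I_def by (intro fam_ker fam_im linear_act act_commute insert.prems)+
  have memK: "u \<in> K j \<longleftrightarrow> u \<in> U j \<and> act m u \<in> W (j - 1)" for u j unfolding K_def ker_fam_def by simp
  have memI: "x \<in> I j \<longleftrightarrow> (\<exists>u w. x = act m u + w \<and> u \<in> U (j + 1) \<and> w \<in> W j)" for x j
    unfolding I_def im_fam_def by blast
  have WU: "w \<in> U j" if "w \<in> W j" for w j using insert.prems(3) that by (auto simp: le_fun_def)
  have WK: "W \<le> K" using WU fam_act[OF insert.prems(1)] by (auto simp: le_fun_def memK)
  have KU: "K \<le> U" by (auto simp: le_fun_def memK)
  have act0: "act i 0 = 0" for i
  proof -
    interpret f: Vector_Spaces.linear scale scale "act i" by (rule linear_act)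
    show ?thesis by (rule f.zero)
  qed
  have WI: "W \<le> I"
  proof (rule le_funI, rule subsetI)
    fix j w assume "w \<in> W j"
    then show "w \<in> I j" unfolding memI
      using fam_subspace[OF insert.prems(2)] subspace_0 act0 by (intro exI[of _ 0] exI[of _ w]) auto
  qed
  have IU: "I \<le> U"
  proof (rule le_funI, rule subsetI)
    fix j x assume "x \<in> I j"
    then obtain u w where uw: "x = act m u + w" "u \<in> U (j + 1)" "w \<in> W j" unfolding memI by blast
    have "act m u \<in> U j" using fam_act[OF insert.prems(2) uw(2), of m] by simp
    then show "x \<in> U j" using uw WU fam_subspace[OF insert.prems(2)] subspace_add by blast
  qed
  let ?k = "\<lambda>j. of_nat (dim (K j)) - of_nat (dim (W j)) :: rat"
  let ?q = "\<lambda>j. of_nat (dim (U j)) - of_nat (dim (I j)) :: rat"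
  let ?a = "\<lambda>j. of_nat (dim (U j)) - of_nat (dim (W j)) :: rat"
  have "\<exists>c. has_val (Abs_fps (\<lambda>r. ?k (j0 + int r))) c"
  proof (rule insert.IH)
    show "fdim (K j)" for j using fdim_subset[OF insert.prems(4)] KU by (auto simp: le_fun_def)
    show "K j \<subseteq> W j" if "j < j0" for j using insert.prems(5)[OF that] memK by blast
    show "act i u \<in> W (j - 1)" if "i \<notin> S" "u \<in> K j" for i j u
      using that insert.prems(6)[of i u j] memK by (cases "i = m") auto
    show "dcc W K" using dcc_sub[OF insert.prems(7) order_refl KU] .
  qed (use fK WK insert.prems in auto)
  then obtain ck where ck: "has_val (Abs_fps (\<lambda>r. ?k (j0 + int r))) ck" by blast
  have "\<exists>c. has_val (Abs_fps (\<lambda>r. ?q (j0 + int r))) c"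
  proof (rule insert.IH)
    show "U j \<subseteq> I j" if "j < j0" for j using insert.prems(5)[OF that] WI by (auto simp: le_fun_def)
    show "act i u \<in> I (j - 1)" if "i \<notin> S" "u \<in> U j" for i j u
    proof (cases "i = m")
      case True
      then show ?thesis unfolding memI using that fam_subspace[OF insert.prems(1)] subspace_0
        by (intro exI[of _ u] exI[of _ 0]) auto
    next
      case False
      then show ?thesis using that insert.prems(6)[of i u j] WI by (auto simp: le_fun_def)
    qed
    show "dcc I U" using dcc_sub[OF insert.prems(7) WI order_refl] .
  qed (use fK IU insert.prems in auto)
  then obtain cq where cq: "has_val (Abs_fps (\<lambda>r. ?q (j0 + int r))) cq" by blast
  have rel: "?a j - ?a (j - 1) = ?k j - ?q (j - 1)" for j
  proof -
    have "dim (U j) + dim (W (j - 1)) = dim {u \<in> U j. act m u \<in> W (j - 1)}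
        + dim {act m u + w | u w. u \<in> U j \<and> w \<in> W (j - 1)}"
      by (intro dim_preimage_image_sum linear_act fam_subspace insert.prems fdW)
    then have "dim (U j) + dim (W (j - 1)) = dim (K j) + dim (I (j - 1))"
      by (simp add: K_def I_def ker_fam_def im_fam_def)
    then have "(of_nat (dim (U j)) + of_nat (dim (W (j - 1))) :: rat) = of_nat (dim (K j)) + of_nat (dim (I (j - 1)))"
      by (metis of_nat_add)
    then show ?thesis by simp
  qed
  \<comment> \<open>The recurrence at \<open>j0\<close> refers to degree \<open>j0 - 1\<close>,
    which the series do not contain; this settles their constant coefficient.\<close>
  have low: "?a (j0 - 1) = 0" "?q (j0 - 1) = 0"
  proof -
    have "U (j0 - 1) = W (j0 - 1)" using insert.prems(5)[of "j0 - 1"] WU by auto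
    moreover have "I (j0 - 1) = W (j0 - 1)"
      using calculation WI IU unfolding le_fun_def by blast
    ultimately show "?a (j0 - 1) = 0" "?q (j0 - 1) = 0" by simp_all
  qed
  have "Abs_fps (\<lambda>r. ?a (j0 + int r)) * (1 - fps_X) ^ 1
      = Abs_fps (\<lambda>r. ?k (j0 + int r)) - fps_X ^ 1 * Abs_fps (\<lambda>r. ?q (j0 + int r))"
  proof (rule fps_ext)
    fix r
    show "(Abs_fps (\<lambda>r. ?a (j0 + int r)) * (1 - fps_X) ^ 1) $ r
      = (Abs_fps (\<lambda>r. ?k (j0 + int r)) - fps_X ^ 1 * Abs_fps (\<lambda>r. ?q (j0 + int r))) $ r"
    proof (cases r)
      case 0
      then show ?thesis using rel[of j0] low by (simp add: algebra_simps)
    next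
      case (Suc r')
      then show ?thesis using rel[of "j0 + int r"] by (simp add: algebra_simps)
    qed
  qed
  then have "has_val (Abs_fps (\<lambda>r. ?a (j0 + int r)) * (1 - fps_X) ^ 1) (ck - (- 1) ^ 1 * cq)"
    using has_val_diff[OF ck has_val_mult[OF has_val_X_power[of 1] cq]] by (simp only:)
  then show ?case using has_val_cancel by blast
qed

end

section \<open>Homogeneous polynomials\<close>

abbreviation "lookup \<equiv> Poly_Mapping.lookup"
abbreviation "single \<equiv> Poly_Mapping.single"
abbreviation "keys \<equiv> Poly_Mapping.keys"
abbreviation "mdeg \<equiv> monomial_degree"

type_synonym ('n, 'k) mpoly_pairs = "(('n, 'k) mpoly \<times> ('n, 'k) mpoly) list"

abbreviation mon :: "('n \<Rightarrow>\<^sub>0 nat) \<Rightarrow> ('n, 'k::comm_semiring_1) mpoly" where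
  "mon m \<equiv> single m 1"

abbreviation pvar :: "'n \<Rightarrow> ('n, 'k::comm_semiring_1) mpoly" where
  "pvar i \<equiv> mon (single i 1)"

lemma monomial_degree_zero [simp]: "monomial_degree 0 = 0"
  by (simp add: monomial_degree_def)

lemma monomial_degree_add [simp]: "mdeg (m + m') = mdeg m + mdeg m'"
  by (simp add: monomial_degree_def lookup_add sum.distrib)

lemma monomial_degree_single [simp]: "mdeg (single i k) = k"
  by (simp add: monomial_degree_def lookup_single when_def)

lemma monomial_degree_eq_0_iff [simp]: "mdeg m = 0 \<longleftrightarrow> m = 0"
  by (auto simp: monomial_degree_def poly_mapping_eq_iff fun_eq_iff)

lemma monomial_degree_SucE:
  assumes "mdeg m = Suc d"
  obtains i m' where "m = single i 1 + m'" "mdeg m' = d" "lookup m i > 0"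
proof -
  obtain i where i: "lookup m i > 0"
    using assms by (metis gr0I monomial_degree_eq_0_iff nat.distinct(1) poly_mapping_eqI lookup_zero)
  have "m = single i 1 + (m - single i 1)"
    using i by (intro poly_mapping_eqI) (auto simp: lookup_add lookup_minus lookup_single when_def)
  then show thesis using that[of i "m - single i 1"] i assms
    by (metis One_nat_def Suc_eq_plus1_left diff_add_inverse monomial_degree_add monomial_degree_single)
qed

lemma monomial_degree_split:
  assumes "mdeg m = s + t"
  obtains m1 m2 where "m = m1 + m2" "mdeg m1 = s" "mdeg m2 = t"
proof -
  have "mdeg m = s + t \<Longrightarrow> \<exists>m1 m2. m = m1 + m2 \<and> mdeg m1 = s \<and> mdeg m2 = t" for m :: "'a \<Rightarrow>\<^sub>0 nat"
  proof (induction s arbitrary: m)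
    case 0
    then show ?case by (intro exI[of _ 0] exI[of _ m]) simp
  next
    case (Suc s)
    then obtain i m' where m': "m = single i 1 + m'" "mdeg m' = s + t"
      using monomial_degree_SucE[of m "s + t"] by (metis add_Suc)
    from Suc.IH[OF m'(2)] obtain m1 m2 where "m' = m1 + m2" "mdeg m1 = s" "mdeg m2 = t"
      by blast
    then show ?case using m'(1)
      by (intro exI[of _ "single i 1 + m1"] exI[of _ m2]) (simp add: add.assoc)
  qed
  then show thesis using assms that by blast
qed

lemma finite_monomials: "finite {m :: 'n::finite \<Rightarrow>\<^sub>0 nat. mdeg m = s}"
proof -
  have "lookup ` {m :: 'n \<Rightarrow>\<^sub>0 nat. mdeg m = s} \<subseteq> PiE UNIV (\<lambda>_. {..s})"
    unfolding monomial_degree_def by (auto intro!: member_le_sum)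
  moreover have "finite (PiE (UNIV :: 'n set) (\<lambda>_. {..s}))" by (intro finite_PiE) auto
  ultimately have "finite (lookup ` {m :: 'n \<Rightarrow>\<^sub>0 nat. mdeg m = s})"
    by (rule finite_subset)
  then show ?thesis by (rule finite_imageD) (rule inj_onI, rule poly_mapping_eqI, simp)
qed

lemma mpoly_eq_sum: "p = (\<Sum>m\<in>keys p. single m (lookup p m))"
proof (rule poly_mapping_eqI)
  fix k
  show "lookup p k =
      lookup (\<Sum>m\<in>keys p. single m (lookup p m)) k"
    unfolding lookup_sum lookup_single when_def by (simp add: not_in_keys_iff_lookup_eq_zero)
qed

lemma mpoly_induct [case_names zero single add]:
  assumes "P 0" "\<And>m c. P (single m c)" "\<And>p q. P p \<Longrightarrow> P q \<Longrightarrow> P (p + q)"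
  shows "P (p :: ('n, 'k::comm_monoid_add) mpoly)"
proof -
  have "P (\<Sum>m\<in>S. single m (lookup p m))" if "finite S" for S
    using that by induction (auto simp: assms)
  from this[of "keys p"] show ?thesis by (simp flip: mpoly_eq_sum)
qed

lemma single_eq_const_mult: "single m c = mpoly_const c * mon (m :: 'n \<Rightarrow>\<^sub>0 nat)" for c :: "'k::comm_semiring_1"
  by (simp add: mpoly_const_def mult_single)

lemma mon_add: "mon (m + m') = mon m * (mon m' :: ('n, 'k::comm_semiring_1) mpoly)"
  by (simp add: mult_single)

lemma mpoly_const_simps [simp]:
  "mpoly_const (0::'k::comm_ring_1) = 0" "mpoly_const (1::'k) = 1"
  "mpoly_const (a + b :: 'k) = mpoly_const a + mpoly_const b"
  "mpoly_const (a - b :: 'k) = mpoly_const a - mpoly_const b"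
  "mpoly_const (- a :: 'k) = - mpoly_const a"
  "mpoly_const (a * b :: 'k) = mpoly_const a * mpoly_const b"
  by (simp_all add: mpoly_const_def single_add single_diff single_uminus mult_single)

lemma homogeneous_zero [simp]: "homogeneous d 0"
  by (simp add: homogeneous_def)

lemma homogeneous_single: "mdeg m = d \<Longrightarrow> homogeneous d (single m c)"
  by (cases "c = 0") (auto simp: homogeneous_def)

lemma homogeneous_const [simp]: "homogeneous 0 (mpoly_const c)"
  unfolding mpoly_const_def by (rule homogeneous_single) simp

lemma homogeneous_one [simp]: "homogeneous 0 (1 :: ('n::finite, 'k::comm_ring_1) mpoly)"
  using homogeneous_const[of "1::'k"] by simp

lemma homogeneous_pvar [simp]: "homogeneous (Suc 0) (pvar i)"
  by (rule homogeneous_single) simp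

lemmas homogeneous_pvar_Suc [simp] = homogeneous_pvar[unfolded One_nat_def]

lemma homogeneous_add: "homogeneous d p \<Longrightarrow> homogeneous d q \<Longrightarrow> homogeneous d (p + q)"
  unfolding homogeneous_def using keys_add[of p q] by blast

lemma homogeneous_uminus [simp]: "homogeneous d (- p) \<longleftrightarrow> homogeneous d (p :: ('n::finite, 'k::ab_group_add) mpoly)"
  unfolding homogeneous_def in_keys_iff by simp

lemma homogeneous_diff: "homogeneous d p \<Longrightarrow> homogeneous d q \<Longrightarrow> homogeneous d (p - q)"
  for p :: "('n::finite, 'k::ab_group_add) mpoly"
  using homogeneous_add[of d p "- q"] by simp

lemma homogeneous_sum: "(\<And>x. x \<in> S \<Longrightarrow> homogeneous d (f x)) \<Longrightarrow> homogeneous d (\<Sum>x\<in>S. f x)"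
  by (induction S rule: infinite_finite_induct) (simp_all add: homogeneous_add)

lemma homogeneous_mult:
  assumes "homogeneous d p" "homogeneous e (q :: ('n::finite, 'k::comm_semiring_1) mpoly)"
  shows "homogeneous (d + e) (p * q)"
  unfolding homogeneous_def
proof
  fix m assume "m \<in> keys (p * q)"
  then obtain a b where "m = a + b" "a \<in> keys p" "b \<in> keys q"
    using keys_mult[of p q] by blast
  then show "mdeg m = d + e" using assms by (simp add: homogeneous_def)
qed

lemma homogeneous_power:
  "homogeneous d (p :: ('n::finite, 'k::comm_ring_1) mpoly) \<Longrightarrow> homogeneous (k * d) (p ^ k)"
proof (induction k)
  case (Suc k)
  then show ?case using homogeneous_mult[of d p "k * d" "p ^ k"] by simp
qed simp

lemma homogeneous_unique: "homogeneous d p \<Longrightarrow> homogeneous e p \<Longrightarrow> p \<noteq> 0 \<Longrightarrow> d = e"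
proof -
  assume *: "homogeneous d p" "homogeneous e p" "p \<noteq> 0"
  then obtain m where "lookup p m \<noteq> 0" by (metis poly_mapping_eqI lookup_zero)
  then have "m \<in> keys p" by (simp add: in_keys_iff)
  then have "mdeg m = d" "mdeg m = e" using *(1,2) unfolding homogeneous_def by blast+
  then show "d = e" by simp
qed

lemma homogeneous_induct [consumes 1, case_names zero single add]:
  assumes "homogeneous d p" "P 0" "\<And>m c. mdeg m = d \<Longrightarrow> P (single m c)"
    "\<And>p q. homogeneous d p \<Longrightarrow> homogeneous d q \<Longrightarrow> P p \<Longrightarrow> P q \<Longrightarrow> P (p + q)"
  shows "P (p :: ('n::finite, 'k::comm_monoid_add) mpoly)"
proof -
  have "finite S \<Longrightarrow> S \<subseteq> keys p \<Longrightarrow>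
    P (\<Sum>m\<in>S. single m (lookup p m)) \<and>
    homogeneous d (\<Sum>m\<in>S. single m (lookup p m))" for S
  proof (induction rule: finite_induct)
    case (insert m S)
    then have m: "mdeg m = d" using assms(1) unfolding homogeneous_def by blast
    have S: "P (\<Sum>m\<in>S. single m (lookup p m))"
      "homogeneous d (\<Sum>m\<in>S. single m (lookup p m))"
      using insert by auto
    note h = homogeneous_single[OF m, of "lookup p m"]
    show ?case
      unfolding sum.insert[OF insert.hyps(1,2)]
      using assms(4)[OF h S(2) assms(3)[OF m] S(1)] homogeneous_add[OF h S(2)] by (rule conjI)
  qed (simp add: assms)
  from this[of "keys p"] show ?thesis by (simp flip: mpoly_eq_sum)
qed

section \<open>The projective Nullstellensatz\<close>

text \<open>Gaussian elimination: a pivot row \<open>r0\<close> clears the column \<open>m\<close>,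
  and its own coefficient is chosen afterwards so that the original relation holds.\<close>

lemma linear_dependence:
  fixes c :: "'r \<Rightarrow> 't \<Rightarrow> 'l::field"
  assumes "finite T" "finite R" "card T < card R"
  shows "\<exists>\<beta>. (\<exists>r\<in>R. \<beta> r \<noteq> 0) \<and> (\<forall>m\<in>T. (\<Sum>r\<in>R. \<beta> r * c r m) = 0)"
  using assms
proof (induction T arbitrary: R c rule: finite_induct)
  case empty
  then have "R \<noteq> {}" by auto
  then show ?case by (intro exI[of _ "\<lambda>_. 1"]) auto
next
  case (insert m T)
  show ?case
  proof (cases "\<forall>r\<in>R. c r m = 0")
    case True
    have "card T < card R" using insert by simp
    from insert.IH[OF insert.prems(1) this, of c] show ?thesis using True by auto
  next
    case False
    then obtain r0 where r0: "r0 \<in> R" "c r0 m \<noteq> 0" by blast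
    define R' where "R' = R - {r0}"
    define c' where "c' r t = c r t - c r m / c r0 m * c r0 t" for r t
    have R': "finite R'" "card T < card R'" "R = insert r0 R'" "r0 \<notin> R'"
      using insert r0 by (auto simp: R'_def)
    obtain \<beta> where \<beta>: "\<exists>r\<in>R'. \<beta> r \<noteq> 0" "\<And>t. t \<in> T \<Longrightarrow> (\<Sum>r\<in>R'. \<beta> r * c' r t) = 0"
      using insert.IH[OF R'(1,2), of c'] by blast
    define b where "b = - (\<Sum>r\<in>R'. \<beta> r * (c r m / c r0 m))"
    define \<gamma> where "\<gamma> = \<beta>(r0 := b)"
    have eq: "(\<Sum>r\<in>R. \<gamma> r * c r t) = (\<Sum>r\<in>R'. \<beta> r * c' r t)" for t
    proof -
      have "(\<Sum>r\<in>R. \<gamma> r * c r t) = b * c r0 t + (\<Sum>r\<in>R'. \<gamma> r * c r t)"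
        using R' by (simp add: \<gamma>_def)
      also have "(\<Sum>r\<in>R'. \<gamma> r * c r t) = (\<Sum>r\<in>R'. \<beta> r * c r t)"
        using R'(4) by (intro sum.cong) (auto simp: \<gamma>_def)
      finally show ?thesis
        by (simp add: b_def c'_def algebra_simps sum_subtractf sum_distrib_left)
    qed
    have "c' r m = 0" for r unfolding c'_def using r0 by simp
    then have "(\<Sum>r\<in>R. \<gamma> r * c r t) = 0" if "t \<in> insert m T" for t
      using that \<beta>(2) eq by auto
    moreover have "\<exists>r\<in>R. \<gamma> r \<noteq> 0" using \<beta>(1) R'(3,4) by (auto simp: \<gamma>_def)
    ultimately show ?thesis by blast
  qed
qed

definition poly_eval :: "('n::finite, 'l::field) mpoly \<Rightarrow> ('n \<Rightarrow> 'l) \<Rightarrow> 'l" where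
  "poly_eval p a = (\<Sum>m\<in>keys p. lookup p m * (\<Prod>i\<in>UNIV. a i ^ lookup m i))"

text \<open>A homogeneous ideal is represented by the set of its homogeneous elements.\<close>

definition hideal :: "('n::finite, 'l::field) mpoly set \<Rightarrow> bool" where
  "hideal I \<longleftrightarrow> 0 \<in> I \<and> (\<forall>p\<in>I. \<exists>d. homogeneous d p)
     \<and> (\<forall>d. \<forall>p\<in>I. \<forall>q\<in>I. homogeneous d p \<longrightarrow> homogeneous d q \<longrightarrow> p + q \<in> I)
     \<and> (\<forall>e r. \<forall>p\<in>I. homogeneous e r \<longrightarrow> r * p \<in> I)"

text \<open>The homogeneous elements of I + (f), where \<open>\<delta>\<close> is meant to be the
  degree of \<open>f\<close>. The alternative \<open>g = 0\<close> admits elements of I of degree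
  below \<open>\<delta>\<close>.\<close>

definition adjoin where
  "adjoin I f \<delta> = {q + g * f | q g d e. q \<in> I \<and> homogeneous d q \<and> homogeneous e g \<and> (e + \<delta> = d \<or> g = 0)}"

lemma hidealD:
  assumes "hideal I"
  shows "0 \<in> I" "p \<in> I \<Longrightarrow> \<exists>d. homogeneous d p"
    "p \<in> I \<Longrightarrow> q \<in> I \<Longrightarrow> homogeneous d p \<Longrightarrow> homogeneous d q \<Longrightarrow> p + q \<in> I"
    "p \<in> I \<Longrightarrow> homogeneous e r \<Longrightarrow> r * p \<in> I"
  using assms unfolding hideal_def by blast+

lemma hideal_diff:
  assumes "hideal I" "p \<in> I" "q \<in> I" "homogeneous d p" "homogeneous d q"
  shows "p - q \<in> I"
proof -
  have "mpoly_const (-1) * q \<in> I" by (rule hidealD(4)[OF assms(1,3) homogeneous_const])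
  then show ?thesis using hidealD(3)[OF assms(1,2), of "- q" d] assms(4,5) by simp
qed

lemma hideal_sum:
  assumes "hideal I" "\<And>x. x \<in> S \<Longrightarrow> f x \<in> I \<and> homogeneous d (f x)"
  shows "(\<Sum>x\<in>S. f x) \<in> I"
  using assms(2)
proof (induction S rule: infinite_finite_induct)
  case (insert x S)
  then show ?case using hidealD(3)[OF assms(1), of "f x" "sum f S" d] by (simp add: homogeneous_sum)
qed (simp_all add: hidealD(1)[OF assms(1)])

lemma hideal_all_monomials:
  assumes "hideal I" "\<And>m. mdeg m = d \<Longrightarrow> mon m \<in> I" "homogeneous d p"
  shows "p \<in> I"
  using assms(3)
proof (induction rule: homogeneous_induct)
  case (single m c)
  then show ?case
    using hidealD(4)[OF assms(1) assms(2)[OF single] homogeneous_const, of c]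
    by (simp add: single_eq_const_mult[of m c])
qed (use hidealD[OF assms(1)] in auto)

lemma hideal_adjoin:
  fixes f :: "('n::finite, 'l::field) mpoly"
  assumes I: "hideal I" and f: "homogeneous \<delta> f"
  shows "hideal (adjoin I f \<delta>)" "I \<subseteq> adjoin I f \<delta>" "f \<in> adjoin I f \<delta>"
proof -
  show sub: "I \<subseteq> adjoin I f \<delta>"
  proof
    fix q assume q: "q \<in> I"
    then obtain d where "homogeneous d q" using hidealD(2)[OF I] by blast
    then have "q = q + 0 * f \<and> q \<in> I \<and> homogeneous d q \<and> homogeneous 0 (0 :: ('n, 'l) mpoly) \<and> (0 + \<delta> = d \<or> (0 :: ('n, 'l) mpoly) = 0)"
      using q by simp
    then show "q \<in> adjoin I f \<delta>" unfolding adjoin_def by blast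
  qed
  show "f \<in> adjoin I f \<delta>"
  proof -
    have "f = 0 + 1 * f \<and> 0 \<in> I \<and> homogeneous \<delta> (0 :: ('n, 'l) mpoly) \<and> homogeneous 0 (1 :: ('n, 'l) mpoly) \<and> (0 + \<delta> = \<delta> \<or> (1 :: ('n, 'l) mpoly) = 0)"
      using hidealD(1)[OF I] by simp
    then show ?thesis unfolding adjoin_def by blast
  qed
  have hom: "homogeneous d (q + g * f)" if "homogeneous d q" "homogeneous e g" "e + \<delta> = d \<or> g = 0" for q g d e
    using that homogeneous_mult[OF that(2) f] by (auto intro: homogeneous_add)
  show "hideal (adjoin I f \<delta>)"
    unfolding hideal_def
  proof (intro conjI allI ballI impI)
    show "0 \<in> adjoin I f \<delta>" using sub hidealD(1)[OF I] by blast
    fix p assume "p \<in> adjoin I f \<delta>"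
    then obtain q g d e where "p = q + g * f" "homogeneous d q" "homogeneous e g" "e + \<delta> = d \<or> g = 0"
      unfolding adjoin_def by blast
    then show "\<exists>d. homogeneous d p" using hom by metis
  next
    fix d p p' assume p: "p \<in> adjoin I f \<delta>" "p' \<in> adjoin I f \<delta>" "homogeneous d p" "homogeneous d p'"
    show "p + p' \<in> adjoin I f \<delta>"
    \<comment> \<open>Zero is homogeneous of every degree, so the degrees of two decompositions can
      be compared only for nonzero elements.\<close>
    proof (cases "p = 0 \<or> p' = 0")
      case True
      then show ?thesis using p by auto
    next
      case False
      obtain q g d1 e where 1: "p = q + g * f" "q \<in> I" "homogeneous d1 q" "homogeneous e g" "e + \<delta> = d1 \<or> g = 0"
        using p(1) unfolding adjoin_def by blast
      obtain q' g' d1' e' where 2: "p' = q' + g' * f" "q' \<in> I" "homogeneous d1' q'" "homogeneous e' g'" "e' + \<delta> = d1' \<or> g' = 0"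
        using p(2) unfolding adjoin_def by blast
      have d: "d1 = d" "d1' = d"
        using homogeneous_unique hom[OF 1(3,4,5)] hom[OF 2(3,4,5)] p(3,4) 1(1) 2(1) False by blast+
      have eq: "p + p' = (q + q') + (g + g') * f" by (simp add: 1 2 algebra_simps)
      have q: "q + q' \<in> I" "homogeneous d (q + q')"
        using hidealD(3)[OF I 1(2) 2(2), of d] 1(3) 2(3) d homogeneous_add by auto
      have "\<exists>e. homogeneous e (g + g') \<and> (e + \<delta> = d \<or> g + g' = 0)"
      proof (cases "g = 0")
        case True
        then show ?thesis using 2 d by auto
      next
        case g: False
        show ?thesis
        proof (cases "g' = 0")
          case True
          then show ?thesis using 1 d by auto
        next
          case False
          then have "e + \<delta> = d" "e' = e" using g 1(5) 2(5) d by auto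
          then show ?thesis using 1(4) 2(4) homogeneous_add by blast
        qed
      qed
      then show ?thesis unfolding adjoin_def eq using q by blast
    qed
  next
    fix e p and r :: "('n, 'l) mpoly" assume p: "p \<in> adjoin I f \<delta>" and r: "homogeneous e r"
    obtain q g d1 e1 where 1: "p = q + g * f" "q \<in> I" "homogeneous d1 q" "homogeneous e1 g" "e1 + \<delta> = d1 \<or> g = 0"
      using p unfolding adjoin_def by blast
    have "r * p = r * q + (r * g) * f" by (simp add: 1 algebra_simps)
    moreover have "r * q \<in> I" using hidealD(4)[OF I 1(2) r] .
    moreover have "homogeneous (e + d1) (r * q)" "homogeneous (e + e1) (r * g)"
      using homogeneous_mult r 1 by blast+
    moreover have "(e + e1) + \<delta> = e + d1 \<or> r * g = 0" using 1(5) by auto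
    ultimately show "r * p \<in> adjoin I f \<delta>" unfolding adjoin_def by blast
  qed
qed

text \<open>A homogeneous ideal that is maximal among those without a power of the irrelevant ideal
  is prime, and modulo it all variables are proportional. It is therefore the ideal of a point.\<close>

locale maximal_nonirrelevant =
  fixes I :: "('n::finite, 'l::alg_closed_field) mpoly set"
  assumes hideal: "hideal I"
    and proper: "\<exists>m. mdeg m = s \<and> mon m \<notin> I"
    and maximal: "hideal I' \<Longrightarrow> I \<subset> I' \<Longrightarrow> \<exists>s. \<forall>m. mdeg m = s \<longrightarrow> mon m \<in> I'"
begin

lemma adjoin_monomials:
  assumes "homogeneous \<delta> f" "f \<notin> I"
  obtains s where "\<And>m. mdeg m = s \<Longrightarrow> mon m \<in> adjoin I f \<delta>"
  using maximal[OF hideal_adjoin(1)[OF hideal assms(1)]] hideal_adjoin(2,3)[OF hideal assms(1)] assms(2)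
  by blast

text \<open>The degree hidden in \<open>adjoin\<close> is determined by \<open>p\<close> because
  \<open>p\<close> is nonzero.\<close>

lemma adjoinE:
  assumes "p \<in> adjoin I f \<delta>" "homogeneous d p" "p \<noteq> 0" "homogeneous \<delta> f"
  obtains q g where "p = q + g * f" "q \<in> I" "homogeneous d q" "homogeneous d (g * f)"
    "\<exists>e. homogeneous e g \<and> (e + \<delta> = d \<or> g = 0)"
proof -
  obtain q g d1 e where 1: "p = q + g * f" "q \<in> I" "homogeneous d1 q" "homogeneous e g" "e + \<delta> = d1 \<or> g = 0"
    using assms(1) unfolding adjoin_def by blast
  have gf: "homogeneous d1 (g * f)" using homogeneous_mult[OF 1(4) assms(4)] 1(5) by auto
  then have "homogeneous d1 p" using homogeneous_add 1 by blast
  then have "d1 = d" using homogeneous_unique assms by blast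
  then show thesis using that 1 gf by blast
qed

lemma mon_nonzero: "mon m \<noteq> (0 :: ('n, 'l) mpoly)"
  by (metis lookup_single_eq lookup_zero zero_neq_one)

text \<open>If neither factor were in I, maximality would put all monomials of some degree s into I
  + (f) and all of some degree t into I + (g). Multiplying the two representations puts all
  monomials of degree s + t into I, since f g is in I.\<close>

lemma prime:
  assumes f: "homogeneous \<delta> f" and g: "homogeneous \<gamma> g" and fg: "f * g \<in> I"
  shows "f \<in> I \<or> g \<in> I"
proof (rule ccontr)
  assume "\<not> ?thesis"
  then obtain s t where s: "\<And>m. mdeg m = s \<Longrightarrow> mon m \<in> adjoin I f \<delta>"
    and t: "\<And>m. mdeg m = t \<Longrightarrow> mon m \<in> adjoin I g \<gamma>"
    using adjoin_monomials f g by metis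
  have "mon m \<in> I" if m: "mdeg m = s + t" for m
  proof -
    obtain m1 m2 where m12: "m = m1 + m2" "mdeg m1 = s" "mdeg m2 = t"
      using monomial_degree_split[OF m] by blast
    obtain q1 g1 where 1: "mon m1 = q1 + g1 * f" "q1 \<in> I" "homogeneous s q1" "homogeneous s (g1 * f)" "\<exists>e. homogeneous e g1"
      by (rule adjoinE[OF s[OF m12(2)] homogeneous_single[OF m12(2)] mon_nonzero f]) blast
    obtain q2 g2 where 2: "mon m2 = q2 + g2 * g" "q2 \<in> I" "homogeneous t q2" "homogeneous t (g2 * g)" "\<exists>e. homogeneous e g2"
      by (rule adjoinE[OF t[OF m12(3)] homogeneous_single[OF m12(3)] mon_nonzero g]) blast
    have h: "homogeneous (s + t) (q1 * mon m2)" "homogeneous (s + t) (g1 * f * q2)" "homogeneous (s + t) (g1 * f * (g2 * g))"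
      using homogeneous_mult 1 2 homogeneous_single[OF m12(3)] by blast+
    have eq: "mon m = q1 * mon m2 + (g1 * f * q2 + g1 * f * (g2 * g))"
      unfolding m12(1) mon_add 1(1) 2(1) by (simp add: algebra_simps)
    have "mon m2 * q1 \<in> I" using hidealD(4)[OF hideal 1(2) homogeneous_single[OF m12(3)]] .
    moreover have "g1 * f * q2 \<in> I" using hidealD(4)[OF hideal 2(2) 1(4)] .
    moreover have "g1 * f * (g2 * g) \<in> I"
    proof -
      obtain e where "homogeneous e (g1 * g2)" using 1(5) 2(5) homogeneous_mult by blast
      then have "(g1 * g2) * (f * g) \<in> I" using hidealD(4)[OF hideal fg] by blast
      then show ?thesis by (simp add: mult_ac)
    qed
    ultimately show ?thesis
      unfolding eq using h hidealD(3)[OF hideal] homogeneous_add by (metis mult.commute)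
  qed
  then show False using proper by blast
qed

lemma one_notin: "1 \<notin> I"
  using proper[of 0] by simp

lemma prime_power: "homogeneous \<delta> f \<Longrightarrow> f ^ k \<in> I \<Longrightarrow> f \<in> I"
proof (induction k)
  case 0
  then show ?case using one_notin by simp
next
  case (Suc k)
  then show ?case using prime[of \<delta> f "k * \<delta>" "f ^ k"] homogeneous_power by auto
qed

lemma exists_variable: "\<exists>i. pvar i \<notin> I"
proof -
  obtain m where m: "mdeg m = Suc 0" "mon m \<notin> I" using proper by blast
  then obtain i m' where "m = single i 1 + m'" "mdeg m' = 0"
    using monomial_degree_SucE by metis
  then show ?thesis using m by auto
qed

text \<open>The sum is the homogenization of \<open>p\<close> to degree \<open>N\<close> in
  \<open>pvar l\<close> and \<open>pvar i0\<close>. Over an algebraically closed field it splits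
  into linear factors and a power of \<open>pvar i0\<close>; I is prime and omits
  \<open>pvar i0\<close>, so it contains one of the linear factors.\<close>

lemma linear_factor_mem:
  assumes x: "pvar i0 \<notin> I"
  shows "p \<noteq> 0 \<Longrightarrow> degree p \<le> N \<Longrightarrow>
    (\<Sum>r\<le>N. mpoly_const (poly.coeff p r) * (pvar l ^ r * pvar i0 ^ (N - r))) \<in> I \<Longrightarrow>
    \<exists>a. pvar l - mpoly_const a * pvar i0 \<in> I"
proof (induction "degree p" arbitrary: p N)
  case 0
  then obtain c where p: "p = [:c:]" using degree_eq_zeroE by metis
  have "(\<Sum>r\<le>N. mpoly_const (poly.coeff p r) * (pvar l ^ r * pvar i0 ^ (N - r)))
      = (\<Sum>r\<in>{0}. mpoly_const (poly.coeff p r) * (pvar l ^ r * pvar i0 ^ (N - r)))"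
    by (rule sum.mono_neutral_right) (auto simp: p coeff_pCons split: nat.split)
  then have "mpoly_const c * pvar i0 ^ N \<in> I" using 0 by (simp add: p)
  then have "mpoly_const (inverse c) * (mpoly_const c * pvar i0 ^ N) \<in> I"
    using hidealD(4)[OF hideal _ homogeneous_const] by blast
  moreover have "mpoly_const (inverse c) * mpoly_const c = (1 :: ('n, 'l) mpoly)"
    using 0 p by (simp flip: mpoly_const_simps(6))
  ultimately have "pvar i0 ^ N \<in> I" by (simp add: mult.assoc[symmetric])
  then show ?case using prime_power x homogeneous_pvar by blast
next
  case (Suc n)
  obtain a where "poly p a = 0" using alg_closed_imp_poly_has_root[of p] Suc(2) by auto
  then obtain q where q: "p = [:- a, 1:] * q" by (metis poly_eq_0_iff_dvd dvdE)
  have q0: "q \<noteq> 0" using Suc q by auto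
  then have dq: "degree p = Suc (degree q)" unfolding q by (subst degree_mult_eq) auto
  obtain N' where N: "N = Suc N'" using Suc(2,4) by (cases N) auto
  have dN: "degree q \<le> N'" using Suc(4) dq N by simp
  define H where "H = (\<Sum>r\<le>N'. mpoly_const (poly.coeff q r) * (pvar l ^ r * pvar i0 ^ (N' - r)) :: ('n, 'l) mpoly)"
  have "(\<Sum>r\<le>N. mpoly_const (poly.coeff p r) * (pvar l ^ r * pvar i0 ^ (N - r)))
     = (pvar l - mpoly_const a * pvar i0) * H"
  proof -
    have c: "poly.coeff p r = (case r of 0 \<Rightarrow> 0 | Suc r' \<Rightarrow> poly.coeff q r') - a * poly.coeff q r" for r
      unfolding q by (cases r) (simp_all add: algebra_simps)
    have 1: "(\<Sum>r\<le>N. mpoly_const (case r of 0 \<Rightarrow> 0 | Suc r' \<Rightarrow> poly.coeff q r') * (pvar l ^ r * pvar i0 ^ (N - r)))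
      = pvar l * H"
      unfolding N sum.atMost_Suc_shift H_def by (simp add: sum_distrib_left mult_ac)
    have 2: "(\<Sum>r\<le>N. mpoly_const (a * poly.coeff q r) * (pvar l ^ r * pvar i0 ^ (N - r)))
      = mpoly_const a * pvar i0 * H"
    proof -
      have "poly.coeff q (Suc N') = 0" using dN by (simp add: coeff_eq_0)
      then have "(\<Sum>r\<le>N. mpoly_const (a * poly.coeff q r) * (pvar l ^ r * pvar i0 ^ (N - r)))
         = (\<Sum>r\<le>N'. mpoly_const (a * poly.coeff q r) * (pvar l ^ r * pvar i0 ^ (Suc N' - r)))"
        by (simp add: N)
      also have "\<dots> = mpoly_const a * pvar i0 * H"
        unfolding H_def sum_distrib_left by (rule sum.cong) (auto simp: Suc_diff_le mult_ac)
      finally show ?thesis .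
    qed
    show ?thesis unfolding c mpoly_const_simps(4) left_diff_distrib sum_subtractf 1 2 by simp
  qed
  then have "(pvar l - mpoly_const a * pvar i0) * H \<in> I" using Suc(5) by simp
  moreover have "homogeneous 1 (pvar l - mpoly_const a * pvar i0)"
    using homogeneous_mult[OF homogeneous_const homogeneous_pvar, of a i0] by (auto intro!: homogeneous_diff)
  moreover have "homogeneous N' H"
    unfolding H_def
  proof (rule homogeneous_sum)
    fix r assume "r \<in> {..N'}"
    then have "N' = 0 + (r * Suc 0 + (N' - r) * Suc 0)" by simp
    then show "homogeneous N' (mpoly_const (poly.coeff q r) * (pvar l ^ r * pvar i0 ^ (N' - r)))"
      using homogeneous_mult homogeneous_power homogeneous_pvar homogeneous_const by metis
  qed
  ultimately have "pvar l - mpoly_const a * pvar i0 \<in> I \<or> H \<in> I" using prime by blast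
  then show ?case using Suc(1)[of q N'] Suc(2) dq q0 dN unfolding H_def by auto
qed

text \<open>It suffices to find a nonzero binary form in the two variables inside I. Maximality
  makes every form of degree s + k congruent to x^k times a form of degree s, where x is
  \<open>pvar i0\<close>; the forms of degree s make up a space of fixed dimension, so sufficiently
  many binary monomials become dependent modulo I.\<close>

lemma variables_proportional:
  assumes x: "pvar i0 \<notin> I"
  shows "\<exists>a. pvar l - mpoly_const a * pvar i0 \<in> I"
proof -
  let ?x = "pvar i0 :: ('n, 'l) mpoly"
  obtain s where s: "\<And>m. mdeg m = s \<Longrightarrow> mon m \<in> adjoin I ?x (Suc 0)"
    using adjoin_monomials[OF homogeneous_pvar x] by blast
  have step: "\<exists>q g. p = q + g * ?x \<and> q \<in> I \<and> homogeneous (Suc (s + k)) q \<and> homogeneous (s + k) g"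
    if p: "homogeneous (Suc (s + k)) p" for p k
  proof (cases "p = 0")
    case True
    then show ?thesis using hidealD(1)[OF hideal] by (intro exI[of _ 0]) auto
  next
    case False
    have "p \<in> adjoin I ?x (Suc 0)"
    proof (rule hideal_all_monomials[OF hideal_adjoin(1)[OF hideal homogeneous_pvar] _ p])
      fix m :: "'n \<Rightarrow>\<^sub>0 nat" assume m: "mdeg m = Suc (s + k)"
      then have "mdeg m = s + Suc k" by simp
      then obtain m1 m2 where m12: "m = m1 + m2" "mdeg m1 = s" "mdeg m2 = Suc k"
        using monomial_degree_split by metis
      have "mon m2 * mon m1 \<in> adjoin I ?x (Suc 0)"
        by (rule hidealD(4)[OF hideal_adjoin(1)[OF hideal homogeneous_pvar] s[OF m12(2)] homogeneous_single[OF m12(3)]])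
      then show "mon m \<in> adjoin I ?x (Suc 0)"
        unfolding m12(1) mon_add by (simp only: mult.commute)
    qed
    from adjoinE[OF this p False homogeneous_pvar] obtain q g where
      1: "p = q + g * ?x" "q \<in> I" "homogeneous (Suc (s + k)) q" "\<exists>e. homogeneous e g \<and> (e + Suc 0 = Suc (s + k) \<or> g = 0)"
      by blast
    then have "homogeneous (s + k) g" by auto
    then show ?thesis using 1 by blast
  qed
  have red: "homogeneous (s + k) p \<Longrightarrow> \<exists>h. homogeneous s h \<and> p - ?x ^ k * h \<in> I" for k p
  proof (induction k arbitrary: p)
    case 0
    then show ?case using hidealD(1)[OF hideal] by (intro exI[of _ p]) simp
  next
    case (Suc k)
    then obtain q g where q: "p = q + g * ?x" "q \<in> I" "homogeneous (Suc (s + k)) q" "homogeneous (s + k) g"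
      using step[of k p] by auto
    obtain h where h: "homogeneous s h" "g - ?x ^ k * h \<in> I" using Suc.IH[OF q(4)] by blast
    have "homogeneous (s + k) (g - ?x ^ k * h)"
      using q(4) homogeneous_mult[OF homogeneous_power[OF homogeneous_pvar, of k i0] h(1)]
      by (intro homogeneous_diff) (simp_all add: add.commute)
    then have "homogeneous (Suc (s + k)) (?x * (g - ?x ^ k * h))"
      using homogeneous_mult[OF homogeneous_pvar] by fastforce
    then have "q + ?x * (g - ?x ^ k * h) \<in> I"
      using hidealD(3)[OF hideal q(2) hidealD(4)[OF hideal h(2) homogeneous_pvar] q(3)] by blast
    then show ?case using h(1) q(1) by (intro exI[of _ h]) (simp add: algebra_simps)
  qed
  define T where "T = {m :: 'n \<Rightarrow>\<^sub>0 nat. mdeg m = s}"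
  \<comment> \<open>In this degree a factor x^(card T) can be split off, leaving forms of degree s
    with \<open>card T\<close> coefficients. There are N + 1 > card T binary monomials, so the
    remainders are linearly dependent.\<close>
  define N where "N = s + card T"
  define u where "u r = pvar l ^ r * ?x ^ (N - r)" for r
  have hu: "homogeneous N (u r)" if "r \<le> N" for r
    using homogeneous_mult[OF homogeneous_power[OF homogeneous_pvar, of r l] homogeneous_power[OF homogeneous_pvar, of "N - r" i0]] that
    by (simp add: u_def)
  then have "\<exists>h. r \<le> N \<longrightarrow> homogeneous s h \<and> u r - ?x ^ card T * h \<in> I" for r
    using red[of "card T" "u r"] by (auto simp: N_def)
  then obtain h where h: "\<And>r. r \<le> N \<Longrightarrow> homogeneous s (h r)" "\<And>r. r \<le> N \<Longrightarrow> u r - ?x ^ card T * h r \<in> I" by metis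
  obtain \<beta> where \<beta>: "\<exists>r\<in>{..N}. \<beta> r \<noteq> 0" "\<And>m. m \<in> T \<Longrightarrow> (\<Sum>r\<in>{..N}. \<beta> r * lookup (h r) m) = 0"
    using linear_dependence[of T "{..N}" "\<lambda>r m. lookup (h r) m"] finite_monomials[of s]
    by (auto simp: N_def T_def)
  have lookup_const_mult: "lookup (mpoly_const b * p) m = b * lookup p m" for b :: 'l and p :: "('n, 'l) mpoly" and m
    by (induction p rule: mpoly_induct)
      (simp_all add: mpoly_const_def mult_single lookup_single when_def distrib_left lookup_add)
  have zero: "(\<Sum>r\<le>N. mpoly_const (\<beta> r) * h r) = 0"
  proof (rule poly_mapping_eqI)
    fix m
    show "lookup (\<Sum>r\<le>N. mpoly_const (\<beta> r) * h r) m = lookup 0 m"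
    proof (cases "m \<in> T")
      case True
      then show ?thesis using \<beta>(2) by (simp add: lookup_sum lookup_const_mult)
    next
      case False
      then have "lookup (h r) m = 0" if "r \<le> N" for r
        using h(1)[OF that] not_in_keys_iff_lookup_eq_zero unfolding homogeneous_def T_def by fastforce
      then show ?thesis by (simp add: lookup_sum lookup_const_mult)
    qed
  qed
  have "(\<Sum>r\<le>N. mpoly_const (\<beta> r) * (u r - ?x ^ card T * h r)) \<in> I"
  proof (rule hideal_sum[OF hideal, where d = N], rule conjI)
    fix r assume r: "r \<in> {..N}"
    show "mpoly_const (\<beta> r) * (u r - ?x ^ card T * h r) \<in> I"
      using hidealD(4)[OF hideal h(2) homogeneous_const] r by blast
    have "homogeneous N (u r - ?x ^ card T * h r)"
      using homogeneous_mult[OF homogeneous_power[OF homogeneous_pvar, of "card T" i0] h(1), of r] r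
      by (intro homogeneous_diff hu) (simp_all add: N_def add.commute)
    from homogeneous_mult[OF homogeneous_const this]
    show "homogeneous N (mpoly_const (\<beta> r) * (u r - ?x ^ card T * h r))" by simp
  qed
  also have "(\<Sum>r\<le>N. mpoly_const (\<beta> r) * (u r - ?x ^ card T * h r))
     = (\<Sum>r\<le>N. mpoly_const (\<beta> r) * u r) - ?x ^ card T * (\<Sum>r\<le>N. mpoly_const (\<beta> r) * h r)"
    by (simp add: right_diff_distrib sum_subtractf sum_distrib_left mult_ac)
  finally have mem: "(\<Sum>r\<le>N. mpoly_const (\<beta> r) * u r) \<in> I" by (simp add: zero)
  define p where "p = (\<Sum>r\<le>N. monom (\<beta> r) r)"
  have coeff: "poly.coeff p r = (if r \<le> N then \<beta> r else 0)" for r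
    unfolding p_def by (simp add: coeff_sum)
  have "p \<noteq> 0" using \<beta>(1) coeff by (metis atMost_iff coeff_0)
  moreover have "degree p \<le> N" by (rule degree_le) (simp add: coeff)
  moreover have "(\<Sum>r\<le>N. mpoly_const (poly.coeff p r) * (pvar l ^ r * pvar i0 ^ (N - r))) \<in> I"
    using mem by (simp add: coeff u_def)
  ultimately show ?thesis by (rule linear_factor_mem[OF x])
qed

text \<open>The point consists of the ratios of the variables to x = \<open>pvar i0\<close>. Modulo
  I a form \<open>p\<close> of degree d is congruent to p(a) x^d; if \<open>p\<close> is in I and
  p(a) were nonzero, then x^d and hence x would be in I.\<close>

lemma nontrivial_common_zero: "\<exists>a. a \<noteq> (\<lambda>_. 0) \<and> (\<forall>d p. p \<in> I \<longrightarrow> homogeneous d p \<longrightarrow> poly_eval p a = 0)"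
proof -
  obtain i0 where x: "pvar i0 \<notin> I" using exists_variable by blast
  let ?x = "pvar i0 :: ('n, 'l) mpoly"
  obtain a where a: "\<And>l. pvar l - mpoly_const (a l) * ?x \<in> I" using variables_proportional[OF x] by metis
  define ev where "ev m = (\<Prod>i\<in>UNIV. a i ^ lookup m i)" for m
  have ev_Suc: "ev (single i 1 + m) = a i * ev m" for i m
  proof -
    have "ev (single i 1 + m) = (\<Prod>j\<in>UNIV. (if j = i then a i else 1) * a j ^ lookup m j)"
      unfolding ev_def by (rule prod.cong) (auto simp: lookup_add lookup_single when_def)
    also have "\<dots> = a i * ev m" unfolding prod.distrib ev_def by (subst prod.delta) simp_all
    finally show ?thesis .
  qed
  have hx: "homogeneous d (mpoly_const c * ?x ^ d)" for c d
    using homogeneous_mult[OF homogeneous_const homogeneous_power[OF homogeneous_pvar, of d i0], of c] by simp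
  have main: "mdeg m = d \<Longrightarrow> mon m - mpoly_const (ev m) * ?x ^ d \<in> I" for m d
  proof (induction d arbitrary: m)
    case 0
    then show ?case using hidealD(1)[OF hideal] by (simp add: ev_def)
  next
    case (Suc d)
    obtain i m' where m: "m = single i 1 + m'" "mdeg m' = d"
      using monomial_degree_SucE[OF Suc.prems] by metis
    let ?A = "pvar i * (mon m' - mpoly_const (ev m') * ?x ^ d)"
    let ?B = "mpoly_const (ev m') * ?x ^ d * (pvar i - mpoly_const (a i) * ?x)"
    have "mon m - mpoly_const (ev m) * ?x ^ Suc d = ?A + ?B"
      unfolding m(1) ev_Suc mon_add by (simp add: algebra_simps)
    moreover have "?A \<in> I" "?B \<in> I"
      using hidealD(4)[OF hideal Suc.IH[OF m(2)] homogeneous_pvar] hidealD(4)[OF hideal a hx] by blast+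
    moreover have "homogeneous (Suc d) ?A"
      using homogeneous_mult[OF homogeneous_pvar homogeneous_diff[OF homogeneous_single[OF m(2)] hx]] by simp
    moreover have "homogeneous (Suc d) ?B"
      using homogeneous_mult[OF hx homogeneous_diff[OF homogeneous_pvar]] homogeneous_mult[OF homogeneous_const homogeneous_pvar]
      by fastforce
    ultimately show ?case using hidealD(3)[OF hideal] by metis
  qed
  have "poly_eval p a = 0" if p: "p \<in> I" "homogeneous d p" for p d
  proof (rule ccontr)
    assume ne: "poly_eval p a \<noteq> 0"
    let ?K = "keys p" and ?c = "lookup p"
    let ?t = "\<lambda>m. mpoly_const (?c m) * (mon m - mpoly_const (ev m) * ?x ^ d)"
    have deg: "mdeg m = d" if "m \<in> ?K" for m using p(2) that by (simp add: homogeneous_def)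
    have "(\<Sum>m\<in>?K. ?t m) \<in> I"
    proof (rule hideal_sum[OF hideal, where d = d], rule conjI)
      fix m assume m: "m \<in> ?K"
      show "?t m \<in> I"
        using hidealD(4)[OF hideal main[OF deg[OF m]] homogeneous_const] .
      show "homogeneous d (?t m)"
        using homogeneous_mult[OF homogeneous_const homogeneous_diff[OF homogeneous_single[OF deg[OF m]] hx]] by simp
    qed
    also have "(\<Sum>m\<in>?K. ?t m)
       = (\<Sum>m\<in>?K. single m (?c m)) - mpoly_const (poly_eval p a) * ?x ^ d"
    proof -
      have const_sum: "mpoly_const (\<Sum>m\<in>S. f m) = (\<Sum>m\<in>S. mpoly_const (f m) :: ('n, 'l) mpoly)" for S and f :: "('n \<Rightarrow>\<^sub>0 nat) \<Rightarrow> 'l"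
        by (induction S rule: infinite_finite_induct) simp_all
      show ?thesis
        unfolding poly_eval_def const_sum ev_def[symmetric] right_diff_distrib sum_subtractf sum_distrib_right
        by (simp add: mult.assoc single_eq_const_mult[symmetric])
    qed
    finally have "p - mpoly_const (poly_eval p a) * ?x ^ d \<in> I" by (simp flip: mpoly_eq_sum)
    then have "p - (p - mpoly_const (poly_eval p a) * ?x ^ d) \<in> I"
      by (rule hideal_diff[OF hideal p(1) _ p(2) homogeneous_diff[OF p(2) hx]])
    then have "mpoly_const (poly_eval p a) * ?x ^ d \<in> I" by simp
    then have "mpoly_const (inverse (poly_eval p a)) * (mpoly_const (poly_eval p a) * ?x ^ d) \<in> I"
      using hidealD(4)[OF hideal _ homogeneous_const] by blast
    moreover have "mpoly_const (inverse (poly_eval p a)) * mpoly_const (poly_eval p a) = (1 :: ('n, 'l) mpoly)"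
      using ne by (simp flip: mpoly_const_simps(6))
    ultimately have "?x ^ d \<in> I" by (simp add: mult.assoc[symmetric])
    then show False using prime_power x homogeneous_pvar by blast
  qed
  moreover have "a \<noteq> (\<lambda>_. 0)"
  proof
    assume "a = (\<lambda>_. 0)"
    then have "?x \<in> I" using a[of i0] by simp
    then show False using x by simp
  qed
  ultimately show ?thesis by blast
qed

end


text \<open>By contradiction: an ideal generated by the \<open>F i\<close> that contains no power of
  the irrelevant ideal extends, by Zorn's lemma, to a maximal one, and the point of the latter is a
  forbidden common zero. One degree \<open>e\<close> serves all cofactors because the
  \<open>F i\<close> share the degree \<open>\<delta>\<close>.\<close>

lemma projective_nullstellensatz:
  fixes F :: "'i::finite \<Rightarrow> ('n::finite, 'l::alg_closed_field) mpoly"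
  assumes F: "\<And>i. homogeneous \<delta> (F i)"
    and zero: "\<And>a. (\<forall>i. poly_eval (F i) a = 0) \<Longrightarrow> a = (\<lambda>_. 0)"
  shows "\<exists>s. \<forall>m. mdeg m = s \<longrightarrow> (\<exists>g e. (\<forall>i. homogeneous e (g i)) \<and> mon m = (\<Sum>i\<in>UNIV. g i * F i))"
proof (rule ccontr)
  assume "\<not> ?thesis"
  then have neg: "\<exists>m. mdeg m = s \<and> \<not> (\<exists>g e. (\<forall>i. homogeneous e (g i)) \<and> mon m = (\<Sum>i\<in>UNIV. g i * F i))" for s by blast
  define J where "J = {\<Sum>i\<in>UNIV. g i * F i | g. \<exists>e. \<forall>i. homogeneous e (g i)}"
  have homJ: "homogeneous (e + \<delta>) (\<Sum>i\<in>UNIV. g i * F i)" if "\<forall>i. homogeneous e (g i)" for g e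
    using that F by (intro homogeneous_sum homogeneous_mult) auto
  have memJ: "(\<Sum>i\<in>UNIV. g i * F i) \<in> J" if "\<And>i. homogeneous e (g i)" for g e
    unfolding J_def using that by blast
  have zeroJ: "0 \<in> J" using memJ[of 0 "\<lambda>_. 0"] by simp
  have J: "hideal J"
    unfolding hideal_def
  proof (intro conjI allI ballI impI)
    show "0 \<in> J" by (rule zeroJ)
    show "\<exists>d. homogeneous d p" if "p \<in> J" for p using that homJ unfolding J_def by blast
  next
    fix d p q assume pq: "p \<in> J" "q \<in> J" "homogeneous d p" "homogeneous d q"
    show "p + q \<in> J"
    proof (cases "p = 0 \<or> q = 0")
      case True
      then show ?thesis using pq by auto
    next
      case False
      obtain g e where 1: "p = (\<Sum>i\<in>UNIV. g i * F i)" "\<forall>i. homogeneous e (g i)" using pq(1) unfolding J_def by blast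
      obtain g' e' where 2: "q = (\<Sum>i\<in>UNIV. g' i * F i)" "\<forall>i. homogeneous e' (g' i)" using pq(2) unfolding J_def by blast
      have "e + \<delta> = d" "e' + \<delta> = d" using homJ[OF 1(2)] homJ[OF 2(2)] 1(1) 2(1) pq(3,4) False homogeneous_unique by blast+
      then have "e' = e" by simp
      then have "homogeneous e (g i + g' i)" for i using 1(2) 2(2) by (simp add: homogeneous_add)
      from memJ[OF this] show ?thesis unfolding 1(1) 2(1) sum.distrib[symmetric] distrib_right .
    qed
  next
    fix e p and r :: "('n, 'l) mpoly" assume p: "p \<in> J" and r: "homogeneous e r"
    obtain g e' where 1: "p = (\<Sum>i\<in>UNIV. g i * F i)" "\<forall>i. homogeneous e' (g i)" using p unfolding J_def by blast
    have "homogeneous (e + e') (r * g i)" for i by (rule homogeneous_mult[OF r spec[OF 1(2)]])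
    from memJ[OF this] show "r * p \<in> J" by (simp add: 1 sum_distrib_left mult.assoc)
  qed
  define \<A> where "\<A> = {I. hideal I \<and> J \<subseteq> I \<and> (\<forall>s. \<exists>m. mdeg m = s \<and> mon m \<notin> I)}"
  have "J \<in> \<A>" using J neg unfolding \<A>_def J_def by blast
  have "\<exists>I\<in>\<A>. \<forall>I'\<in>\<A>. I \<subseteq> I' \<longrightarrow> I' = I"
  proof (rule subset_Zorn_nonempty)
    show "\<A> \<noteq> {}" using \<open>J \<in> \<A>\<close> by blast
    fix C assume C: "C \<noteq> {}" "subset.chain \<A> C"
    have CA: "I \<in> \<A>" if "I \<in> C" for I using C(2) that unfolding subset.chain_def by blast
    have dir: "I \<subseteq> I' \<or> I' \<subseteq> I" if "I \<in> C" "I' \<in> C" for I I'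
      using C(2) that unfolding subset.chain_def by blast
    have "hideal (\<Union>C)"
      unfolding hideal_def
    proof (intro conjI allI ballI impI)
      show "0 \<in> \<Union>C" using C(1) CA unfolding \<A>_def hideal_def by blast
      show "\<exists>d. homogeneous d p" if "p \<in> \<Union>C" for p using that CA unfolding \<A>_def hideal_def by blast
      show "r * p \<in> \<Union>C" if "p \<in> \<Union>C" "homogeneous e r" for p e and r :: "('n, 'l) mpoly"
        using that CA unfolding \<A>_def hideal_def by blast
      fix d p q assume pq: "p \<in> \<Union>C" "q \<in> \<Union>C" "homogeneous d p" "homogeneous d q"
      then obtain I where I: "I \<in> C" "p \<in> I" "q \<in> I" using dir by blast
      then have "hideal I" using CA unfolding \<A>_def by blast
      then show "p + q \<in> \<Union>C" using hidealD(3) I pq by blast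
    qed
    moreover have "J \<subseteq> \<Union>C" using C(1) CA unfolding \<A>_def by blast
    \<comment> \<open>There are only finitely many monomials of degree \<open>s\<close>; if the
      union contained them all, a single member of the chain would.\<close>
    moreover have "\<exists>m. mdeg m = s \<and> mon m \<notin> \<Union>C" for s
    proof (rule ccontr)
      assume "\<not> ?thesis"
      then have "mon ` {m. mdeg m = s} \<subseteq> \<Union>C" by blast
      then obtain I where "I \<in> C" "mon ` {m. mdeg m = s} \<subseteq> I"
        using finite_subset_Union_chain[OF finite_imageI[OF finite_monomials] _ C] by blast
      then show False using CA[of I] unfolding \<A>_def by blast
    qed
    ultimately show "\<Union>C \<in> \<A>" unfolding \<A>_def by blast
  qed
  then obtain I where I: "I \<in> \<A>" "\<And>I'. I' \<in> \<A> \<Longrightarrow> I \<subseteq> I' \<Longrightarrow> I' = I" by blast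
  interpret maximal_nonirrelevant I
  proof
    show "hideal I" "\<exists>m. mdeg m = s \<and> mon m \<notin> I" for s using I(1) unfolding \<A>_def by blast+
    show "\<exists>s. \<forall>m. mdeg m = s \<longrightarrow> mon m \<in> I'" if "hideal I'" "I \<subset> I'" for I'
      using I that unfolding \<A>_def by blast
  qed
  have "F i \<in> J" for i
  proof -
    have "(\<Sum>j\<in>UNIV. (if j = i then 1 else 0) * F j) = (\<Sum>j\<in>UNIV. if j = i then F j else 0)"
      by (rule sum.cong) auto
    then show ?thesis using memJ[of 0 "\<lambda>j. if j = i then 1 else 0"] by simp
  qed
  then have "F i \<in> I" for i using I(1) unfolding \<A>_def by blast
  then show False using nontrivial_common_zero F zero by blast
qed

section \<open>Descent of the Nullstellensatz from the algebraic closure to the field\<close>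

definition map_coeffs :: "('a::zero \<Rightarrow> 'b::zero) \<Rightarrow> ('n, 'a) mpoly \<Rightarrow> ('n, 'b) mpoly" where
  "map_coeffs f p = Poly_Mapping.map f p"

lemma lookup_map_coeffs: "f 0 = 0 \<Longrightarrow> lookup (map_coeffs f p) m = f (lookup p m)"
  unfolding map_coeffs_def by (simp add: Poly_Mapping.map.rep_eq when_def)

lemma keys_map_to_ac: "keys (map_coeffs to_ac p) = keys p"
  by (auto simp only: in_keys_iff lookup_map_coeffs[of to_ac, OF to_ac_0] to_ac_eq_0_iff)

text \<open>The vector 1 is extended to a basis of the closure over the field; the linear map sends
  1 to 1.\<close>

lemma exists_retraction:
  "\<exists>\<pi> :: 'k::field alg_closure \<Rightarrow> 'k. (\<forall>x y. \<pi> (x + y) = \<pi> x + \<pi> y) \<and> (\<forall>c x. \<pi> (x * to_ac c) = \<pi> x * c) \<and> \<pi> 1 = 1"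
proof -
  interpret vector_space_pair "\<lambda>c x. to_ac c * x :: 'k alg_closure" "(*) :: 'k \<Rightarrow> 'k \<Rightarrow> 'k"
    by unfold_locales (simp_all add: algebra_simps)
  have "vs1.independent {1 :: 'k alg_closure}" by (simp add: vs1.dependent_single)
  then obtain \<pi> :: "'k alg_closure \<Rightarrow> 'k" where \<pi>: "Vector_Spaces.linear (\<lambda>c x. to_ac c * x) (*) \<pi>" "\<forall>x\<in>{1}. \<pi> x = (\<lambda>_. 1) x"
    using linear_independent_extend[of "{1}" "\<lambda>_. 1"] by metis
  interpret \<pi>: Vector_Spaces.linear "\<lambda>c x. to_ac c * x :: 'k alg_closure" "(*) :: 'k \<Rightarrow> 'k \<Rightarrow> 'k" \<pi> by (rule \<pi>(1))
  show ?thesis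
  proof (intro exI[of _ \<pi>] conjI allI)
    fix c x show "\<pi> (x * to_ac c) = \<pi> x * c" using \<pi>.scale[of c x] by (simp add: mult.commute)
  qed (use \<pi>(2) \<pi>.add in auto)
qed

text \<open>An identity over the closure is carried back by applying the retraction
  \<open>\<pi>\<close> to all coefficients of the cofactors. This commutes with multiplication by
  the \<open>F i\<close>, whose coefficients lie in the small field (\<open>P_mult\<close>).\<close>

lemma projective_nullstellensatz_alg_closure:
  fixes F :: "'i::finite \<Rightarrow> ('n::finite, 'k::field) mpoly"
  assumes F: "\<And>i. homogeneous \<delta> (F i)"
    and zero: "\<And>a. (\<forall>i. eval_alg_closure (F i) a = 0) \<Longrightarrow> a = (\<lambda>_. 0)"
  shows "\<exists>s. \<forall>m. mdeg m = s \<longrightarrow> (\<exists>g e. (\<forall>i. homogeneous e (g i)) \<and> mon m = (\<Sum>i\<in>UNIV. g i * F i))"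
proof -
  let ?F = "\<lambda>i. map_coeffs to_ac (F i)"
  have "homogeneous \<delta> (?F i)" for i
    using F[of i] unfolding homogeneous_def keys_map_to_ac .
  moreover have "poly_eval (?F i) a = eval_alg_closure (F i) a" for i a
    unfolding poly_eval_def eval_alg_closure_def keys_map_to_ac lookup_map_coeffs[of to_ac, OF to_ac_0] ..
  ultimately obtain s where s: "\<And>m. mdeg m = s \<Longrightarrow> \<exists>g e. (\<forall>i. homogeneous e (g i)) \<and> mon m = (\<Sum>i\<in>UNIV. g i * ?F i)"
    using projective_nullstellensatz[of \<delta> ?F] zero by auto
  obtain \<pi> :: "'k alg_closure \<Rightarrow> 'k" where \<pi>: "\<And>x y. \<pi> (x + y) = \<pi> x + \<pi> y" "\<And>c x. \<pi> (x * to_ac c) = \<pi> x * c" "\<pi> 1 = 1"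
    using exists_retraction by blast
  have \<pi>0: "\<pi> 0 = 0" using \<pi>(2)[of 0 0] by simp
  let ?P = "map_coeffs \<pi> :: ('n, 'k alg_closure) mpoly \<Rightarrow> ('n, 'k) mpoly"
  have P_add: "?P (p + q) = ?P p + ?P q" for p q
    by (rule poly_mapping_eqI) (simp add: lookup_map_coeffs \<pi>0 \<pi>(1) lookup_add)
  have P_0: "?P 0 = 0" by (rule poly_mapping_eqI) (simp add: lookup_map_coeffs \<pi>0)
  have P_single: "?P (single m c) = single m (\<pi> c)" for m c
    by (rule poly_mapping_eqI) (simp add: lookup_map_coeffs \<pi>0 lookup_single when_def)
  have P_sum: "?P (\<Sum>i\<in>S. f i) = (\<Sum>i\<in>S. ?P (f i))" for S and f :: "'i \<Rightarrow> _"
    by (induction S rule: infinite_finite_induct) (simp_all add: P_0 P_add)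
  have A_add: "map_coeffs to_ac (p + q) = map_coeffs to_ac p + (map_coeffs to_ac q :: ('n, 'k alg_closure) mpoly)" for p q
    by (rule poly_mapping_eqI) (simp add: lookup_map_coeffs lookup_add)
  have A_0: "map_coeffs to_ac 0 = (0 :: ('n, 'k alg_closure) mpoly)" by (rule poly_mapping_eqI) (simp add: lookup_map_coeffs)
  have A_single: "map_coeffs to_ac (single m c) = (single m (to_ac c) :: ('n, 'k alg_closure) mpoly)" for m c
    by (rule poly_mapping_eqI) (simp add: lookup_map_coeffs lookup_single when_def)
  have P_mult: "?P (g * map_coeffs to_ac p) = ?P g * p" for g p
  proof (induction p rule: mpoly_induct)
    case (single m c)
    show ?case
      by (induction g rule: mpoly_induct)
        (simp_all add: A_single P_0 P_single P_add mult_single \<pi>(2) distrib_right)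
  qed (simp_all add: A_0 P_0 A_add P_add distrib_left)
  show ?thesis
  proof (intro exI[of _ s] allI impI)
    fix m :: "'n \<Rightarrow>\<^sub>0 nat" assume "mdeg m = s"
    then obtain g e where g: "\<forall>i. homogeneous e (g i)" "mon m = (\<Sum>i\<in>UNIV. g i * ?F i)" using s by blast
    have "keys (?P (g i)) \<subseteq> keys (g i)" for i
      by (auto simp only: in_keys_iff lookup_map_coeffs[of \<pi>, OF \<pi>0] \<pi>0)
    then have hom: "\<forall>i. homogeneous e (?P (g i))" using g(1) unfolding homogeneous_def by blast
    have "mon m = ?P (mon m)" by (simp add: P_single \<pi>(3))
    also have "\<dots> = (\<Sum>i\<in>UNIV. ?P (g i) * F i)" unfolding g(2) by (simp add: P_sum P_mult)
    finally have "mon m = (\<Sum>i\<in>UNIV. ?P (g i) * F i)" .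
    with hom show "\<exists>g e. (\<forall>i. homogeneous e (g i)) \<and> mon m = (\<Sum>i\<in>UNIV. g i * F i)"
      by (intro exI[of _ "\<lambda>i. ?P (g i)"] exI[of _ e] conjI)
  qed
qed

section \<open>Polarization and graded modules\<close>

lemma partial_deriv_superset:
  assumes "finite S" "keys p \<subseteq> S"
  shows "partial_deriv i p = (\<Sum>m\<in>S. single (m - single i 1)
       (of_nat (lookup m i) * lookup p m))"
  unfolding partial_deriv_def
  by (rule sum.mono_neutral_left) (use assms in \<open>auto simp: not_in_keys_iff_lookup_eq_zero\<close>)

lemma partial_deriv_add: "partial_deriv i (p + q) = partial_deriv i p + partial_deriv i q"
proof -
  let ?S = "keys p \<union> keys q"
  have "keys (p + q) \<subseteq> ?S" by (rule keys_add)
  then show ?thesis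
    by (simp add: partial_deriv_superset[of ?S] lookup_add distrib_left single_add sum.distrib)
qed

lemma partial_deriv_zero [simp]: "partial_deriv i 0 = 0"
  by (simp add: partial_deriv_def)

lemma partial_deriv_single:
  "partial_deriv i (single m c) = single (m - single i 1) (of_nat (lookup m i) * c)"
  by (subst partial_deriv_superset[of "{m}"]) auto

text \<open>Leibniz rule in the form that matches the recursion of
  \<open>polarization_monomial\<close>.\<close>

lemma partial_deriv_pvar_mult:
  "partial_deriv i (single (single l 1 + m) c) =
     (if i = l then single m c else 0) + pvar l * partial_deriv i (single m c)"
proof (cases "i = l")
  case True
  have 1: "single i 1 + m - single i (1::nat) = m"
    by (rule poly_mapping_eqI) (simp add: lookup_minus lookup_add)
  have 2: "single i 1 + (m - single i 1) = m" if "lookup m i \<noteq> 0"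
    by (rule poly_mapping_eqI) (use that in \<open>auto simp: lookup_minus lookup_add lookup_single when_def\<close>)
  show ?thesis
    using 2 True unfolding partial_deriv_single mult_single 1 True[symmetric]
    by (cases "lookup m i = 0") (simp_all add: lookup_add distrib_right single_add 1 1[unfolded One_nat_def])
next
  case False
  have "single l 1 + m - single i 1 = single l 1 + (m - single i (1::nat))"
    by (rule poly_mapping_eqI) (use False in \<open>auto simp: lookup_minus lookup_add lookup_single when_def\<close>)
  then show ?thesis using False unfolding partial_deriv_single mult_single
    by (simp add: lookup_add lookup_single when_def)
qed

text \<open>The balanced biadditive maps \<open>g\<close> stand for the tensor square of the polynomial ring over the
  field; the list \<open>L i\<close> of pairs \<open>(p, q)\<close> stands for the polynomial \<open>w\<^sub>i(x, y) = \<Sum> p(x) q(y)\<close> in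
  \<open>w(x) - w(y) = \<Sum> (x\<^sub>i - y\<^sub>i) w\<^sub>i(x, y)\<close>.\<close>

definition balanced :: "(('n::finite, 'k::comm_ring_1) mpoly \<Rightarrow> ('n, 'k) mpoly \<Rightarrow> 'z::ab_group_add) \<Rightarrow> bool" where
  "balanced g \<longleftrightarrow> (\<forall>p q r. g (p + q) r = g p r + g q r) \<and> (\<forall>p q r. g p (q + r) = g p q + g p r)
     \<and> (\<forall>c p q. g (mpoly_const c * p) q = g p (mpoly_const c * q))"

text \<open>The first clause gives w_i total degree D - 1, without truncated subtraction. The second
  restricts w_i to the diagonal y = x, where it becomes a partial derivative; through it the
  Jacobian ideal acts on homology.\<close>

definition polarization ::
    "nat \<Rightarrow> ('n::finite, 'k::comm_ring_1) mpoly \<Rightarrow> ('n \<Rightarrow> ('n, 'k) mpoly_pairs) \<Rightarrow> bool" where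
  "polarization D w L \<longleftrightarrow>
     (\<forall>i. \<forall>(p, q)\<in>set (L i). \<exists>a b. homogeneous a p \<and> homogeneous b q \<and> a + b + 1 = D) \<and>
     (\<forall>i. (\<Sum>(p, q)\<leftarrow>L i. p * q) = partial_deriv i w)"

definition telescopes ::
    "('n::finite, 'k::comm_ring_1) mpoly \<Rightarrow> ('n \<Rightarrow> ('n, 'k) mpoly_pairs)
      \<Rightarrow> (('n, 'k) mpoly \<Rightarrow> ('n, 'k) mpoly \<Rightarrow> 'z::ab_group_add) \<Rightarrow> bool" where
  "telescopes w L g \<longleftrightarrow>
     (\<Sum>i\<in>UNIV. \<Sum>(p, q)\<leftarrow>L i. g (pvar i * p) q - g p (pvar i * q)) = g w 1 - g 1 w"

lemma balanced_zero:
  assumes "balanced g"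
  shows "g 0 q = 0" "g q 0 = 0"
proof -
  have "g (0 + 0) q = g 0 q + g 0 q" "g q (0 + 0) = g q 0 + g q 0"
    using assms unfolding balanced_def by blast+
  then show "g 0 q = 0" "g q 0 = 0" by simp_all
qed

text \<open>Recursion by splitting off a variable: x_l m'(x) - y_l m'(y) = (x_l - y_l) m'(x) + y_l
  (m'(x) - m'(y)). The first summand adds the pair (m', 1) at \<open>l\<close>, the second
  multiplies the right entries of the old pairs by \<open>pvar l\<close>.\<close>

lemma polarization_monomial:
  fixes c :: "'k::comm_ring_1" and m :: "'n::finite \<Rightarrow>\<^sub>0 nat"
  assumes "mdeg m = D"
  shows "\<exists>L. polarization D (single m c) L \<and>
    (\<forall>g :: _ \<Rightarrow> _ \<Rightarrow> 'z::ab_group_add. balanced g \<longrightarrow> telescopes (single m c) L g)"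
  using assms
proof (induction D arbitrary: m)
  case 0
  then have m: "m = 0" by simp
  have "telescopes (single m c) (\<lambda>_. []) g" if "balanced g" for g :: "_ \<Rightarrow> _ \<Rightarrow> 'z"
  proof -
    have "g (mpoly_const c * 1) 1 = g 1 (mpoly_const c * 1)" using that unfolding balanced_def by blast
    then show ?thesis unfolding telescopes_def m mpoly_const_def by simp
  qed
  then show ?case
    by (intro exI[of _ "\<lambda>_. []"]) (simp add: polarization_def m partial_deriv_single)
next
  case (Suc D)
  obtain l m' where m: "m = single l 1 + m'" "mdeg m' = D"
    using monomial_degree_SucE[OF Suc.prems] by metis
  obtain L where L: "polarization D (single m' c) L"
    "\<And>g :: _ \<Rightarrow> _ \<Rightarrow> 'z. balanced g \<Longrightarrow> telescopes (single m' c) L g"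
    using Suc.IH[OF m(2)] by blast
  define L' where "L' i = (if i = l then [(single m' c, 1)] else []) @ map (\<lambda>(p, q). (p, pvar l * q)) (L i)" for i
  have "polarization (Suc D) (single m c) L'"
    unfolding polarization_def
  proof (intro conjI allI)
    fix i
    have "\<exists>a b. homogeneous a p \<and> homogeneous b (pvar l * q) \<and> a + b + 1 = Suc D" if pq: "(p, q) \<in> set (L i)" for p q
    proof -
      obtain a b where ab: "homogeneous a p" "homogeneous b q" "a + b + 1 = D"
        using L(1) pq unfolding polarization_def by fast
      then show ?thesis using homogeneous_mult[OF homogeneous_pvar ab(2), of l]
        by (intro exI[of _ a] exI[of _ "Suc 0 + b"]) simp
    qed
    moreover have "\<exists>a b. homogeneous a (single m' c) \<and> homogeneous b (1 :: ('n, 'k) mpoly) \<and> a + b + 1 = Suc D"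
      using homogeneous_single[OF m(2)] by (intro exI[of _ D] exI[of _ 0]) simp
    ultimately show "\<forall>(p, q)\<in>set (L' i). \<exists>a b. homogeneous a p \<and> homogeneous b q \<and> a + b + 1 = Suc D"
      unfolding L'_def by auto
    have "(\<Sum>(p, q)\<leftarrow>map (\<lambda>(p, q). (p, pvar l * q)) (L i). p * q) = pvar l * (\<Sum>(p, q)\<leftarrow>L i. p * q)"
      by (induction "L i" arbitrary: i rule: list.induct) (simp_all add: sum_list_const_mult[symmetric] o_def case_prod_unfold mult_ac)
    then show "(\<Sum>(p, q)\<leftarrow>L' i. p * q) = partial_deriv i (single m c)"
      using L(1) unfolding polarization_def L'_def m(1) partial_deriv_pvar_mult by simp
  qed
  moreover have "telescopes (single m c) L' g" if g: "balanced g" for g :: "_ \<Rightarrow> _ \<Rightarrow> 'z"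
  proof -
    \<comment> \<open>Multiplication by y_l is absorbed into the test map, so the induction
      hypothesis has to be available for every balanced map.\<close>
    define g' where "g' p q = g p (pvar l * q)" for p q
    have "balanced g'" using g unfolding balanced_def g'_def by (simp add: distrib_left mult.left_commute)
    then have IH: "(\<Sum>i\<in>UNIV. \<Sum>(p, q)\<leftarrow>L i. g' (pvar i * p) q - g' p (pvar i * q))
        = g' (single m' c) 1 - g' 1 (single m' c)"
      using L(2) unfolding telescopes_def by blast
    have "(\<Sum>(p, q)\<leftarrow>L' i. g (pvar i * p) q - g p (pvar i * q)) =
       (if i = l then g (pvar l * single m' c) 1 - g (single m' c) (pvar l) else 0)
       + (\<Sum>(p, q)\<leftarrow>L i. g' (pvar i * p) q - g' p (pvar i * q))" for i
      by (simp add: L'_def g'_def o_def case_prod_unfold mult.left_commute)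
    then have "(\<Sum>i\<in>UNIV. \<Sum>(p, q)\<leftarrow>L' i. g (pvar i * p) q - g p (pvar i * q)) =
       (g (pvar l * single m' c) 1 - g (single m' c) (pvar l))
       + (g' (single m' c) 1 - g' 1 (single m' c))"
      unfolding IH[symmetric] by (simp only: sum.distrib sum.delta finite UNIV_I if_True)
    then show ?thesis
      unfolding telescopes_def g'_def m(1) by (simp add: mult_single)
  qed
  ultimately show ?case by blast
qed

lemma polarization_exists:
  fixes w :: "('n::finite, 'k::comm_ring_1) mpoly"
  assumes "homogeneous D w"
  shows "\<exists>L. polarization D w L \<and> (\<forall>g :: _ \<Rightarrow> _ \<Rightarrow> 'z::ab_group_add. balanced g \<longrightarrow> telescopes w L g)"
  using assms
proof (induction rule: homogeneous_induct)
  case zero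
  show ?case
    by (intro exI[of _ "\<lambda>_. []"]) (simp add: polarization_def telescopes_def balanced_zero)
next
  case (single m c)
  then show ?case by (rule polarization_monomial)
next
  case (add p q)
  obtain L L' where L: "polarization D p L" "\<And>g :: _ \<Rightarrow> _ \<Rightarrow> 'z. balanced g \<Longrightarrow> telescopes p L g"
    "polarization D q L'" "\<And>g :: _ \<Rightarrow> _ \<Rightarrow> 'z. balanced g \<Longrightarrow> telescopes q L' g"
    using add.IH by blast
  have "polarization D (p + q) (\<lambda>i. L i @ L' i)"
    using L(1,3) unfolding polarization_def partial_deriv_add by auto
  moreover have "telescopes (p + q) (\<lambda>i. L i @ L' i) g" if "balanced g" for g :: "_ \<Rightarrow> _ \<Rightarrow> 'z"
  proof -
    have "g (p + q) 1 = g p 1 + g q 1" "g 1 (p + q) = g 1 p + g 1 q" using that unfolding balanced_def by blast+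
    then show ?thesis using L(2,4)[OF that] unfolding telescopes_def by (simp add: sum.distrib)
  qed
  ultimately show ?case by blast
qed

section \<open>Components and homogeneous generators of a graded module\<close>

context graded_module
begin

sublocale vs: vector_space "const_scale scale" by (rule vector_space_const_scale)

lemma scale_mon_mon: "scale (mon m) (scale (mon m') x) = scale (mon (m + m')) x"
  by (simp add: mult_single)

lemma gr_zero: "0 \<in> gr j"
  using gr_subspace vs.subspace_0 by blast

definition is_decomp :: "'m \<Rightarrow> (int \<Rightarrow> 'm) \<Rightarrow> bool" where
  "is_decomp x f \<longleftrightarrow> (\<forall>j. f j \<in> gr j) \<and> finite {j. f j \<noteq> 0} \<and> x = (\<Sum>j | f j \<noteq> 0. f j)"

definition component :: "'m \<Rightarrow> int \<Rightarrow> 'm" where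
  "component x = (THE f. is_decomp x f)"

lemma is_decomp_component: "is_decomp x (component x)"
proof -
  have "\<exists>!f. is_decomp x f" unfolding is_decomp_def by (rule gr_decomposition)
  from theI'[OF this] show ?thesis unfolding component_def .
qed

lemma component_unique: "is_decomp x f \<Longrightarrow> component x = f"
  using gr_decomposition[of x] is_decomp_component[of x] unfolding is_decomp_def by blast

lemma is_decompI:
  assumes "finite J" "\<And>j. f j \<in> gr j" "\<And>j. j \<notin> J \<Longrightarrow> f j = 0" "x = (\<Sum>j\<in>J. f j)"
  shows "is_decomp x f"
  unfolding is_decomp_def
proof (intro conjI allI)
  have sub: "{j. f j \<noteq> 0} \<subseteq> J" using assms(3) by blast
  then show "finite {j. f j \<noteq> 0}" using assms(1) finite_subset by blast
  show "x = (\<Sum>j | f j \<noteq> 0. f j)"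
    unfolding assms(4) by (rule sum.mono_neutral_right) (use assms(1) sub in auto)
qed (rule assms(2))

lemma component_sum:
  assumes "finite J" "{j. component x j \<noteq> 0} \<subseteq> J"
  shows "x = (\<Sum>j\<in>J. component x j)"
proof -
  have "x = (\<Sum>j | component x j \<noteq> 0. component x j)" using is_decomp_component unfolding is_decomp_def by blast
  also have "\<dots> = (\<Sum>j\<in>J. component x j)" by (rule sum.mono_neutral_left) (use assms in auto)
  finally show ?thesis .
qed

lemma component_in_gr [simp]: "component x j \<in> gr j"
  using is_decomp_component unfolding is_decomp_def by blast

lemma finite_component: "finite {j. component x j \<noteq> 0}"
  using is_decomp_component unfolding is_decomp_def by blast

lemma component_add: "component (x + y) j = component x j + component y j"
proof -
  let ?J = "{j. component x j \<noteq> 0} \<union> {j. component y j \<noteq> 0}"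
  have "is_decomp (x + y) (\<lambda>j. component x j + component y j)"
  proof (rule is_decompI[of ?J])
    show "x + y = (\<Sum>j\<in>?J. component x j + component y j)"
      using component_sum[of ?J x] component_sum[of ?J y] finite_component by (simp add: sum.distrib)
  qed (use finite_component vs.subspace_add[OF gr_subspace] in auto)
  then show ?thesis using component_unique by metis
qed

lemma component_scale: "component (const_scale scale c x) j = const_scale scale c (component x j)"
proof -
  let ?J = "{j. component x j \<noteq> 0}"
  have "is_decomp (const_scale scale c x) (\<lambda>j. const_scale scale c (component x j))"
  proof (rule is_decompI[of ?J])
    show "const_scale scale c x = (\<Sum>j\<in>?J. const_scale scale c (component x j))"
      using component_sum[of ?J x] finite_component by (simp flip: vs.scale_sum_right)
  qed (use finite_component vs.subspace_scale[OF gr_subspace] in auto)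
  then show ?thesis using component_unique by metis
qed

lemma component_homogeneous:
  assumes x: "x \<in> gr i"
  shows "component x j = (if j = i then x else 0)"
proof -
  have "is_decomp x (\<lambda>j. if j = i then x else 0)"
    by (rule is_decompI[of "{i}"]) (use x gr_zero in auto)
  from component_unique[OF this] show ?thesis by simp
qed

lemma homogeneous_generators:
  assumes "finitely_generated_module scale"
  obtains G deg where "finite G" "span G = UNIV" "\<And>g. g \<in> G \<Longrightarrow> g \<in> gr (deg g)"
proof -
  obtain S where S: "finite S" "span S = UNIV"
    using assms unfolding finitely_generated_module_def by blast
  define G where "G = (\<Union>s\<in>S. component s ` {j. component s j \<noteq> 0})"
  have "finite G" unfolding G_def using S(1) finite_component by blast
  moreover have "span G = UNIV"
  proof -
    have "s \<in> span G" if "s \<in> S" for s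
    proof -
      have "(\<Sum>j | component s j \<noteq> 0. component s j) \<in> span G"
        by (rule span_sum) (use that in \<open>auto simp: G_def intro!: span_base\<close>)
      then show ?thesis using component_sum[of "{j. component s j \<noteq> 0}" s] finite_component by simp
    qed
    then have "span S \<subseteq> span G" by (intro span_minimal) auto
    then show ?thesis using S(2) by blast
  qed
  moreover have "\<forall>g\<in>G. \<exists>j. g \<in> gr j" unfolding G_def using component_in_gr by blast
  then have "\<exists>deg. \<forall>g\<in>G. g \<in> gr (deg g)" by metis
  ultimately show thesis using that by blast
qed

lemma span_mon_multiples:
  assumes "span G = UNIV"
  shows "vs.span {scale (mon m) g | m g. g \<in> G} = UNIV"
proof -
  let ?B = "{scale (mon m) g | m g. g \<in> G}"
  have mon: "scale (mon m) x \<in> vs.span ?B" if "x \<in> vs.span ?B" for x m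
    using that
  proof (induction rule: vs.span_induct)
    case base
    show ?case
    proof (rule vs.subspaceI)
      show "0 \<in> {x. scale (mon m) x \<in> vs.span ?B}" by (simp add: vs.span_zero)
    next
      fix c x assume "x \<in> {x. scale (mon m) x \<in> vs.span ?B}"
      then have "const_scale scale c (scale (mon m) x) \<in> vs.span ?B" by (simp add: vs.span_scale)
      then show "const_scale scale c x \<in> {x. scale (mon m) x \<in> vs.span ?B}"
        by (simp add: const_scale_def mult.commute)
    qed (simp add: scale_right_distrib vs.span_add)
  next
    case (step x)
    then obtain m' g where "x = scale (mon m') g" "g \<in> G" by blast
    then have "scale (mon m) x \<in> ?B" using scale_mon_mon by blast
    then show ?case by (rule vs.span_base)
  qed
  have "subspace (vs.span ?B)"
  proof (rule subspaceI)
    fix p x assume x: "x \<in> vs.span ?B"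
    show "scale p x \<in> vs.span ?B"
    proof (induction p rule: mpoly_induct)
      case (single m c)
      have "const_scale scale c (scale (mon m) x) \<in> vs.span ?B" using mon[OF x] by (rule vs.span_scale)
      moreover have "const_scale scale c (scale (mon m) x) = scale (single m c) x"
        by (simp add: const_scale_def single_eq_const_mult[of m c])
      ultimately show ?case by (simp only:)
    qed (simp_all add: vs.span_zero vs.span_add scale_left_distrib)
  qed (simp_all add: vs.span_zero vs.span_add)
  moreover have "G \<subseteq> vs.span ?B"
  proof
    fix g assume "g \<in> G"
    then have "scale (mon 0) g \<in> ?B" by blast
    then have "scale (mon 0) g \<in> vs.span ?B" by (rule vs.span_base)
    then show "g \<in> vs.span ?B" by simp
  qed
  ultimately have "span G \<subseteq> vs.span ?B" by (intro span_minimal)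
  then show ?thesis using assms by blast
qed

text \<open>Each \<open>gr j\<close> is spanned by the finitely many products of degree j of a
  monomial with a homogeneous generator. Above the largest generator degree the monomial is not
  constant, so a variable can be split off.\<close>

lemma gr_structure:
  assumes "finitely_generated_module scale"
  obtains j0 j1 where "\<And>j. \<exists>B. finite B \<and> gr j \<subseteq> vs.span B" "\<And>j. j < j0 \<Longrightarrow> gr j = {0}"
    "\<And>j. j \<ge> j1 \<Longrightarrow> gr (j + 1) \<subseteq> vs.span {scale (pvar i) y | i y. y \<in> gr j}"
proof -
  obtain G deg where G: "finite G" "span G = UNIV" "\<And>g. g \<in> G \<Longrightarrow> g \<in> gr (deg g)"
    using homogeneous_generators[OF assms] by blast
  define N where "N j = {scale (mon m) g | m g. g \<in> G \<and> int (mdeg m) + deg g = j}" for j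
  have gr_N: "gr j \<subseteq> vs.span (N j)" for j
  proof
    fix x assume x: "x \<in> gr j"
    have "x \<in> vs.span {scale (mon m) g | m g. g \<in> G}" using span_mon_multiples[OF G(2)] by blast
    then have "component x j \<in> vs.span (N j)"
    proof (induction rule: vs.span_induct)
      case base
      have "component 0 j = 0" using component_homogeneous[OF gr_zero[of j]] by simp
      then show ?case
        by (intro vs.subspaceI) (simp_all add: component_add component_scale vs.span_zero vs.span_add vs.span_scale)
    next
      case (step y)
      then obtain m g where y: "y = scale (mon m) g" "g \<in> G" by blast
      have "y \<in> gr (int (mdeg m) + deg g)"
        unfolding y(1) by (intro scale_gr homogeneous_single refl G y(2))
      moreover have "y \<in> N j" if "int (mdeg m) + deg g = j" unfolding N_def using y that by blast
      ultimately show ?case by (auto simp: component_homogeneous vs.span_zero intro: vs.span_base)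
    qed
    then show "x \<in> vs.span (N j)" using component_homogeneous[OF x] by simp
  qed
  have fin: "finite (N j)" for j
  proof -
    have "N j \<subseteq> (\<Union>g\<in>G. (\<lambda>m. scale (mon m) g) ` {m. mdeg m = nat (j - deg g)})"
      unfolding N_def by auto
    then show ?thesis by (rule finite_subset) (intro finite_UN_I G(1) finite_imageI finite_monomials)
  qed
  \<comment> \<open>Inserting 0 keeps \<open>Min\<close> and \<open>Max\<close> meaningful when
    \<open>G\<close> is empty.\<close>
  define j0 where "j0 = Min (insert 0 (deg ` G))"
  define j1 where "j1 = Max (insert 0 (deg ` G))"
  have j0: "j0 \<le> deg g" and j1: "deg g \<le> j1" if "g \<in> G" for g
    using that G(1) by (simp_all add: j0_def j1_def)
  show thesis
  proof (rule that)
    show "\<exists>B. finite B \<and> gr j \<subseteq> vs.span B" for j using gr_N fin by blast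
    show "gr j = {0}" if "j < j0" for j
    proof -
      have "N j = {}" unfolding N_def using j0 that by force
      then show ?thesis using gr_N[of j] gr_zero[of j] by (auto simp: vs.span_empty)
    qed
    show "gr (j + 1) \<subseteq> vs.span {scale (pvar i) y | i y. y \<in> gr j}" if "j \<ge> j1" for j
    proof -
      have "N (j + 1) \<subseteq> {scale (pvar i) y | i y. y \<in> gr j}"
      proof
        fix x assume "x \<in> N (j + 1)"
        then obtain m g where mg: "x = scale (mon m) g" "g \<in> G" "int (mdeg m) + deg g = j + 1"
          unfolding N_def by blast
        then have "mdeg m = Suc (nat (j - deg g))" using j1[OF mg(2)] that by linarith
        then obtain i m' where m: "m = single i 1 + m'" "mdeg m' = nat (j - deg g)"
          using monomial_degree_SucE by metis
        have "scale (mon m') g \<in> gr (int (mdeg m') + deg g)"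
          by (intro scale_gr homogeneous_single refl G mg(2))
        then have "scale (mon m') g \<in> gr j" using m(2) j1[OF mg(2)] that by simp
        moreover have "x = scale (pvar i) (scale (mon m') g)" unfolding mg(1) m(1) scale_mon_mon ..
        ultimately show "x \<in> {scale (pvar i) y | i y. y \<in> gr j}" by blast
      qed
      from order_trans[OF gr_N[of "j + 1"] vs.span_mono[OF this]] show ?thesis .
    qed
  qed
qed

end

section \<open>The Koszul complex of bilinear forms\<close>

text \<open>Contraction removes an index from an exterior monomial and multiplication inserts one.
  Toggling treats both halves of the differential by one formula.\<close>

definition flip :: "'n \<Rightarrow> 'n set \<Rightarrow> 'n set" where
  "flip i A = (if i \<in> A then A - {i} else insert i A)"

lemma flip_flip [simp]: "flip i (flip i A) = A"
  by (auto simp: flip_def)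

lemma flip_commute: "flip i (flip j A) = flip j (flip i A)"
  by (auto simp: flip_def)

lemma mem_flip [simp]: "j \<in> flip i A \<longleftrightarrow> (if j = i then j \<notin> A else j \<in> A)"
  by (auto simp: flip_def)

lemma card_flip: "finite A \<Longrightarrow> int (card (flip i A)) = (if i \<in> A then int (card A) - 1 else int (card A) + 1)"
proof -
  assume "finite A"
  moreover have "card A > 0" if "i \<in> A" using that calculation card_gt_0_iff by blast
  ultimately show ?thesis by (auto simp: flip_def)
qed

lemma even_card_flip: "finite A \<Longrightarrow> even (card (flip i A)) \<longleftrightarrow> odd (card A)"
  using card_Suc_Diff1[of A i] by (cases "i \<in> A") (auto simp: flip_def simp flip: even_Suc)

text \<open>An arbitrary total order on the variables, needed for the exterior signs.\<close>

definition idx :: "'n::finite \<Rightarrow> nat" where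
  "idx = (SOME f. inj f)"

lemma inj_idx: "inj (idx :: 'n::finite \<Rightarrow> nat)"
proof -
  obtain f :: "'n \<Rightarrow> nat" where "inj f"
    using finite_imp_inj_to_nat_seg[OF finite[of "UNIV :: 'n set"]] by blast
  then have "inj (SOME f :: 'n \<Rightarrow> nat. inj f)" by (rule someI[of "\<lambda>f :: 'n \<Rightarrow> nat. inj f"])
  then show ?thesis by (simp only: idx_def)
qed

text \<open>The usual exterior sign, counting the factors that e_i has to pass. The strict
  inequality makes it independent of whether \<open>i\<close> itself is in \<open>A\<close>, so
  contraction and multiplication carry the same sign.\<close>

definition sg :: "'n::finite \<Rightarrow> 'n set \<Rightarrow> 'k::comm_ring_1" where
  "sg i A = (- 1) ^ card {j \<in> A. idx j < idx i}"

lemma sg_flip_le: "idx i \<le> idx j \<Longrightarrow> sg i (flip j A) = sg i A"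
proof -
  assume "idx i \<le> idx j"
  then have "{k \<in> flip j A. idx k < idx i} = {k \<in> A. idx k < idx i}" by (auto split: if_splits)
  then show ?thesis by (simp add: sg_def)
qed

lemma sg_flip_less: "idx i < idx j \<Longrightarrow> sg j (flip i A) = - (sg j A :: 'k::comm_ring_1)"
proof -
  assume "idx i < idx j"
  then have *: "{k \<in> flip i A. idx k < idx j} = flip i {k \<in> A. idx k < idx j}" (is "_ = flip i ?B")
    by (auto split: if_splits)
  have "even (card (flip i ?B)) \<longleftrightarrow> odd (card ?B)" by (rule even_card_flip) simp
  then show ?thesis unfolding sg_def * by (cases "even (card ?B)") simp_all
qed

lemma sg_square [simp]: "sg i A * sg i A = (1 :: 'k::comm_ring_1)"
  by (simp add: sg_def flip: power_mult_distrib)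

text \<open>Toggling an index reverses the sign of the larger indices and leaves that of the smaller
  ones, so exactly one of the two signs changes.\<close>

lemma sg_anticommute:
  assumes "i \<noteq> j"
  shows "sg i A * sg j (flip i A) = - (sg j A * sg i (flip j A) :: 'k::comm_ring_1)"
proof -
  have "idx i \<noteq> idx j" using assms inj_idx by (metis injD)
  then consider "idx i < idx j" | "idx j < idx i" by linarith
  then show ?thesis by cases (simp_all add: sg_flip_less sg_flip_le)
qed

lemma sum_list_swap: "(\<Sum>x\<leftarrow>xs. \<Sum>y\<leftarrow>ys. f x y) = (\<Sum>y\<leftarrow>ys. \<Sum>x\<leftarrow>xs. f x y :: 'a::comm_monoid_add)"
  by (induction xs) (simp_all add: sum_list_addf)

text \<open>Here \<open>b\<close> is half the degree of \<open>w\<close>. The assumption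
  \<open>telescopes\<close> concerns maps into the field because it is applied to g(p u, q v) as a
  function of p and q, for a bilinear form g.\<close>

locale hypersurface_module = graded_module scale gr
  for scale :: "('n::finite, 'k::field_char_0) mpoly \<Rightarrow> 'm::ab_group_add \<Rightarrow> 'm" and gr +
  fixes w :: "('n, 'k) mpoly"
    and L :: "'n \<Rightarrow> ('n, 'k) mpoly_pairs"
    and b :: nat and j0 j1 :: int
  assumes b_pos: "b \<ge> 1"
    and scale_w: "scale w x = 0"
    and polarization: "polarization (2 * b) w L"
    and telescopes: "balanced g \<Longrightarrow> telescopes w L (g :: ('n, 'k) mpoly \<Rightarrow> ('n, 'k) mpoly \<Rightarrow> 'k)"
    and gr_finite: "\<exists>B. finite B \<and> gr j \<subseteq> vs.span B"
    and gr_low: "j < j0 \<Longrightarrow> gr j = {0}"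
    and gr_gen: "j \<ge> j1 \<Longrightarrow> gr (j + 1) \<subseteq> vs.span {scale (pvar i) y | i y. y \<in> gr j}"
    and jacobian: "\<exists>s. \<forall>m. mdeg m = s \<longrightarrow>
       (\<exists>g e. (\<forall>i. homogeneous e (g i)) \<and> mon m = (\<Sum>i\<in>UNIV. g i * partial_deriv i w))"
begin

section \<open>Bilinear forms, the dual differential and its homotopies\<close>

definition bilin :: "('m \<Rightarrow> 'm \<Rightarrow> 'k) \<Rightarrow> bool" where
  "bilin g \<longleftrightarrow> (\<forall>x y z. g (x + y) z = g x z + g y z) \<and> (\<forall>x y z. g x (y + z) = g x y + g x z)
     \<and> (\<forall>c x y. g (const_scale scale c x) y = c * g x y) \<and> (\<forall>c x y. g x (const_scale scale c y) = c * g x y)"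

lemma bilinD:
  assumes "bilin g"
  shows "g (x + y) z = g x z + g y z" "g x (y + z) = g x y + g x z"
    "g (scale (mpoly_const c) x) y = c * g x y" "g x (scale (mpoly_const c) y) = c * g x y"
    "g 0 x = 0" "g x 0 = 0" "g (- x) y = - g x y" "g x (- y) = - g x y"
proof -
  note bil = assms[unfolded bilin_def const_scale_def]
  show *: "g (x + y) z = g x z + g y z" "g x (y + z) = g x y + g x z"
    "g (scale (mpoly_const c) x) y = c * g x y" "g x (scale (mpoly_const c) y) = c * g x y" for x y z c
    using bil by blast+
  show **: "g 0 x = 0" "g x 0 = 0" for x using *(1)[of 0 0] *(2)[of x 0 0] by simp_all
  show "g (- x) y = - g x y" "g x (- y) = - g x y"
    using *(1)[of "- x" x y] *(2)[of x "- y" y] ** by (simp_all add: eq_neg_iff_add_eq_0)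
qed

text \<open>The forms of degree \<open>d\<close> are dual to the part of degree \<open>d\<close> of the tensor square of the module
  over the field. The family \<open>V \<pi>\<close> is dual to the part of parity \<open>\<pi>\<close> of the Koszul matrix
  factorization tensored with this square: \<open>f A\<close> is the component of \<open>f\<close> at the exterior monomial
  \<open>A\<close>. Giving the exterior generators the degree \<open>1 - b\<close> makes both halves of the differential
  homogeneous of the same degree \<open>b\<close>.\<close>

definition forms :: "int \<Rightarrow> ('m \<Rightarrow> 'm \<Rightarrow> 'k) set" where
  "forms d = {g. bilin g \<and> (\<forall>i l. \<forall>u\<in>gr i. \<forall>v\<in>gr l. i + l \<noteq> d \<longrightarrow> g u v = 0)}"

text \<open>The transposed action of the polynomial \<Sum> p(x) q(y) that the list of pairs stands
  for.\<close>

definition actg :: "('n, 'k) mpoly_pairs \<Rightarrow> ('m \<Rightarrow> 'm \<Rightarrow> 'k) \<Rightarrow> 'm \<Rightarrow> 'm \<Rightarrow> 'k" where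
  "actg M g = (\<lambda>u v. \<Sum>(p, q)\<leftarrow>M. g (scale p u) (scale q v))"

abbreviation fscale :: "'k \<Rightarrow> ('n set \<Rightarrow> 'm \<Rightarrow> 'm \<Rightarrow> 'k) \<Rightarrow> 'n set \<Rightarrow> 'm \<Rightarrow> 'm \<Rightarrow> 'k" where
  "fscale \<equiv> \<lambda>c f A u v. c * f A u v"

definition acts where "acts M f = (\<lambda>A :: 'n set. actg M (f A))"

text \<open>The 2n variables of k[x, y]: \<open>Inl i\<close> is x_i and \<open>Inr i\<close> is
  y_i.\<close>

definition ops where
  "ops i = (case i of Inl i \<Rightarrow> acts [(pvar i, 1)] | Inr i \<Rightarrow> acts [(1, pvar i)])" for i :: "'n + 'n"

definition wt :: "'n set \<Rightarrow> int" where "wt A = (1 - int b) * int (card A)"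

definition V :: "bool \<Rightarrow> int \<Rightarrow> ('n set \<Rightarrow> 'm \<Rightarrow> 'm \<Rightarrow> 'k) set" where
  "V \<pi> s = {f. \<forall>A. f A \<in> forms (s - wt A) \<and> (even (card A) \<noteq> \<pi> \<longrightarrow> f A = 0)}"

definition Dl :: "'n \<Rightarrow> ('n, 'k) mpoly_pairs" where
  "Dl i = [(pvar i, 1), (- 1, pvar i)]"

definition P where "P i A = (if i \<in> A then Dl i else L i)"

text \<open>Transpose of the differential: the value at \<open>A\<close> is \<open>f\<close>
  evaluated on the differential of e_A. Contraction terms, with \<open>i\<close> in
  \<open>A\<close>, carry x_i - y_i, and multiplication terms carry w_i; this is the case
  distinction in \<open>P\<close>.\<close>

definition \<delta> where
  "\<delta> f = (\<lambda>A u v. \<Sum>i\<in>UNIV. sg i A * actg (P i A) (f (flip i A)) u v)" for f :: "'n set \<Rightarrow> 'm \<Rightarrow> 'm \<Rightarrow> 'k"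

text \<open>\<open>\<kappa> True i\<close> is the transpose of contraction with the i-th dual
  generator, \<open>\<kappa> False i\<close> that of multiplication by e_i. They are the
  null-homotopies for w_i and for x_i - y_i.\<close>

definition \<kappa> where
  "\<kappa> \<sigma> i f = (\<lambda>A u v. if (i \<in> A) = \<sigma> then sg i A * f (flip i A) u v else 0)" for f :: "'n set \<Rightarrow> 'm \<Rightarrow> 'm \<Rightarrow> 'k"

lemma actg_Nil [simp]: "actg [] g = 0"
  by (simp add: actg_def fun_eq_iff)

lemma actg_Cons: "actg ((p, q) # M) g u v = g (scale p u) (scale q v) + actg M g u v"
  by (simp add: actg_def)

lemma actg_add: "actg M (g + h) = actg M g + actg M h"
  by (simp add: actg_def fun_eq_iff sum_list_addf case_prod_unfold)

lemma actg_0 [simp]: "actg M 0 = 0"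
  by (simp add: actg_def fun_eq_iff case_prod_unfold)

lemma actg_cmult: "actg M (\<lambda>u v. c * g u v) u v = c * actg M g u v"
  by (simp add: actg_def case_prod_unfold sum_list_const_mult)

lemma actg_sum: "actg M (\<lambda>u v. \<Sum>x\<in>S. c x * g x u v) u v = (\<Sum>x\<in>S. c x * actg M (g x) u v)"
  by (induction M) (auto simp: actg_Cons sum.distrib distrib_left actg_def)

lemma actg_commute: "actg M (actg M' g) = actg M' (actg M g)"
  unfolding actg_def fun_eq_iff case_prod_unfold
  by (intro allI, subst sum_list_swap) (simp add: mult.commute)

lemma bilin_zero [simp]: "bilin 0"
  by (simp add: bilin_def)

lemma bilin_add: "bilin g \<Longrightarrow> bilin h \<Longrightarrow> bilin (g + h)"
  by (simp add: bilin_def distrib_left)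

lemma forms_zero [simp]: "0 \<in> forms d"
  by (simp add: forms_def)

lemma forms_add: "g \<in> forms d \<Longrightarrow> h \<in> forms d \<Longrightarrow> g + h \<in> forms d"
  by (auto simp: forms_def bilin_add)

lemma forms_cmult: "g \<in> forms d \<Longrightarrow> (\<lambda>u v. c * g u v) \<in> forms d"
  by (auto simp: forms_def bilin_def distrib_left)

lemma forms_sum: "(\<And>x. x \<in> S \<Longrightarrow> g x \<in> forms d) \<Longrightarrow> (\<lambda>u v. \<Sum>x\<in>S. c x * g x u v) \<in> forms d"
proof (induction S rule: infinite_finite_induct)
  case (insert x S)
  have "(\<lambda>u v. \<Sum>x\<in>insert x S. c x * g x u v) = (\<lambda>u v. c x * g x u v) + (\<lambda>u v. \<Sum>x\<in>S. c x * g x u v)"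
    using insert.hyps by (simp add: fun_eq_iff)
  then show ?case using forms_add[OF forms_cmult insert.IH] insert.prems by simp
qed (use forms_zero in \<open>auto simp: zero_fun_def\<close>)

lemma forms_pair:
  assumes g: "g \<in> forms d" and p: "homogeneous \<alpha> p" and q: "homogeneous \<beta> q"
  shows "(\<lambda>u v. g (scale p u) (scale q v)) \<in> forms (d - int (\<alpha> + \<beta>))"
proof -
  have bil: "bilin g" using g by (simp add: forms_def)
  have "bilin (\<lambda>u v. g (scale p u) (scale q v))"
  proof -
    have "scale p (scale (mpoly_const c) x) = scale (mpoly_const c) (scale p x)" for p c x
      by (simp add: mult.commute)
    then show ?thesis using bilinD[OF bil] unfolding bilin_def const_scale_def
      by (simp add: scale_right_distrib del: scale_scale)
  qed
  moreover have "g (scale p u) (scale q v) = 0" if "u \<in> gr i" "v \<in> gr l" "i + l \<noteq> d - int (\<alpha> + \<beta>)" for u v i l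
  proof -
    have "scale p u \<in> gr (int \<alpha> + i)" "scale q v \<in> gr (int \<beta> + l)" using scale_gr p q that by blast+
    moreover have "(int \<alpha> + i) + (int \<beta> + l) \<noteq> d" using that(3) by simp
    ultimately show ?thesis using g unfolding forms_def by blast
  qed
  ultimately show ?thesis unfolding forms_def by blast
qed

definition hom_list where
  "hom_list t M \<longleftrightarrow> (\<forall>(p, q)\<in>set M. \<exists>\<alpha> \<beta>. homogeneous \<alpha> p \<and> homogeneous \<beta> q \<and> \<alpha> + \<beta> = t)"
  for M :: "('n, 'k) mpoly_pairs"

lemma actg_forms:
  assumes "g \<in> forms d"
  shows "hom_list t M \<Longrightarrow> actg M g \<in> forms (d - int t)"
proof (induction M)
  case (Cons x M)
  obtain p q where x: "x = (p, q)" by fastforce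
  have "\<exists>\<alpha> \<beta>. homogeneous \<alpha> p \<and> homogeneous \<beta> q \<and> \<alpha> + \<beta> = t"
    using Cons.prems unfolding hom_list_def x by simp
  then obtain \<alpha> \<beta> where "homogeneous \<alpha> p" "homogeneous \<beta> q" "\<alpha> + \<beta> = t" by blast
  then have "(\<lambda>u v. g (scale p u) (scale q v)) \<in> forms (d - int t)"
    using forms_pair[OF assms] by blast
  moreover have "hom_list t M" using Cons.prems unfolding hom_list_def by simp
  moreover have "actg (x # M) g = (\<lambda>u v. g (scale p u) (scale q v)) + actg M g"
    by (simp add: fun_eq_iff x actg_Cons)
  ultimately show ?case using Cons.IH forms_add by metis
qed simp

lemma hom_list_Dl: "hom_list 1 (Dl i)"
proof -
  have "\<exists>\<alpha> \<beta>. homogeneous \<alpha> (pvar i) \<and> homogeneous \<beta> (1 :: ('n, 'k) mpoly) \<and> \<alpha> + \<beta> = 1"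
    by (intro exI[of _ 1] exI[of _ 0]) simp
  moreover have "\<exists>\<alpha> \<beta>. homogeneous \<alpha> (- 1 :: ('n, 'k) mpoly) \<and> homogeneous \<beta> (pvar i) \<and> \<alpha> + \<beta> = 1"
    by (intro exI[of _ 0] exI[of _ 1]) simp
  ultimately show ?thesis unfolding hom_list_def Dl_def by simp
qed

lemma hom_list_L: "hom_list (2 * b - 1) (L i)"
  using polarization b_pos unfolding polarization_def hom_list_def by fastforce

lemma V_acts:
  assumes "f \<in> V \<pi> s" "hom_list t M"
  shows "acts M f \<in> V \<pi> (s - int t)"
  unfolding V_def mem_Collect_eq acts_def
proof (intro allI conjI impI)
  fix A
  have "actg M (f A) \<in> forms (s - wt A - int t)" using assms actg_forms unfolding V_def by blast
  then show "actg M (f A) \<in> forms (s - int t - wt A)" by (simp add: algebra_simps)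
  show "actg M (f A) = 0" if "even (card A) \<noteq> \<pi>" using assms(1) that unfolding V_def by simp
qed

lemma wt_flip: "wt (flip i A) = wt A + (if i \<in> A then int b - 1 else 1 - int b)"
  unfolding wt_def by (subst card_flip) (simp_all add: algebra_simps)

text \<open>The degree count behind the weight 1 - b: a contraction term lowers the degree by (b -
  1) + 1, a multiplication term by (1 - b) + (2b - 1), and both are b.\<close>

lemma V_\<delta>:
  assumes f: "f \<in> V \<pi> s"
  shows "\<delta> f \<in> V (\<not> \<pi>) (s - int b)"
  unfolding V_def mem_Collect_eq
proof (intro allI conjI impI)
  fix A :: "'n set"
  have fl: "f (flip i A) \<in> forms (s - wt (flip i A))" for i using f unfolding V_def by blast
  have "actg (P i A) (f (flip i A)) \<in> forms (s - int b - wt A)" for i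
  proof (cases "i \<in> A")
    case True
    then have "f (flip i A) \<in> forms (s - (wt A + (int b - 1)))"
      using fl[of i] by (simp add: wt_flip)
    from actg_forms[OF this hom_list_Dl] show ?thesis using True by (simp add: P_def algebra_simps)
  next
    case False
    then have "f (flip i A) \<in> forms (s - (wt A + (1 - int b)))"
      using fl[of i] by (simp add: wt_flip)
    from actg_forms[OF this hom_list_L] show ?thesis using False b_pos
      by (simp add: P_def algebra_simps of_nat_diff)
  qed
  then show "\<delta> f A \<in> forms (s - int b - wt A)" unfolding \<delta>_def by (rule forms_sum)
  assume "even (card A) \<noteq> (\<not> \<pi>)"
  then have *: "f (flip i A) = 0" for i using f even_card_flip[of A i] unfolding V_def by auto
  show "\<delta> f A = 0" unfolding \<delta>_def * by (simp add: fun_eq_iff)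
qed

lemma V_\<kappa>:
  assumes f: "f \<in> V \<pi> s"
  shows "\<kappa> \<sigma> i f \<in> V (\<not> \<pi>) (s + (if \<sigma> then 1 - int b else int b - 1))"
  unfolding V_def mem_Collect_eq
proof (intro allI conjI impI)
  fix A :: "'n set"
  let ?s = "s + (if \<sigma> then 1 - int b else int b - 1)"
  show "\<kappa> \<sigma> i f A \<in> forms (?s - wt A)"
  proof (cases "(i \<in> A) = \<sigma>")
    case True
    have "f (flip i A) \<in> forms (s - wt (flip i A))" using f unfolding V_def by blast
    then have "f (flip i A) \<in> forms (?s - wt A)" using True by (auto simp: wt_flip algebra_simps)
    from forms_cmult[OF this] show ?thesis using True by (simp add: \<kappa>_def)
  next
    case False
    then have "\<kappa> \<sigma> i f A = 0" by (simp add: \<kappa>_def fun_eq_iff)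
    then show ?thesis by simp
  qed
  assume "even (card A) \<noteq> (\<not> \<pi>)"
  then have *: "f (flip i A) = 0" using f even_card_flip[of A i] unfolding V_def by auto
  show "\<kappa> \<sigma> i f A = 0" unfolding \<kappa>_def * by (simp add: fun_eq_iff)
qed

lemma V_bilin: "f \<in> V \<pi> s \<Longrightarrow> bilin (f A)"
  unfolding V_def forms_def by blast

lemma acts_commute: "acts M (acts M' f) = acts M' (acts M f)"
  by (simp add: acts_def actg_commute)

lemma \<delta>_acts: "\<delta> (acts M f) = acts M (\<delta> f)"
  unfolding \<delta>_def acts_def by (simp add: fun_eq_iff actg_sum actg_commute)

lemma \<delta>_add: "\<delta> (f + g) = \<delta> f + \<delta> g"
  by (simp add: \<delta>_def fun_eq_iff actg_add sum.distrib distrib_left)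

lemma \<delta>_scale: "\<delta> (fscale c f) = fscale c (\<delta> f)"
  by (simp add: \<delta>_def fun_eq_iff actg_cmult sum_distrib_left mult.left_commute)

text \<open>The sum is the action of w(x) - w(y), by \<open>telescopes\<close>, and \<open>w\<close>
  annihilates both arguments of the form.\<close>

lemma actg_Dl_L:
  assumes g: "bilin g"
  shows "(\<Sum>i\<in>UNIV. actg (L i) (actg (Dl i) g) u v) = 0"
proof -
  let ?g = "\<lambda>p q. g (scale p u) (scale q v)"
  have "balanced ?g"
    unfolding balanced_def
    by (auto simp: scale_left_distrib bilinD[OF g] simp flip: scale_scale)
  then have "(\<Sum>i\<in>UNIV. \<Sum>(p, q)\<leftarrow>L i. ?g (pvar i * p) q - ?g p (pvar i * q)) = ?g w 1 - ?g 1 w"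
    using telescopes unfolding telescopes_def by blast
  also have "\<dots> = 0" by (simp add: scale_w bilinD[OF g])
  finally have "(\<Sum>i\<in>UNIV. \<Sum>(p, q)\<leftarrow>L i. ?g (pvar i * p) q - ?g p (pvar i * q)) = 0" .
  moreover have "actg (L i) (actg (Dl i) g) u v = (\<Sum>(p, q)\<leftarrow>L i. ?g (pvar i * p) q - ?g p (pvar i * q))" for i
    by (simp add: actg_def Dl_def bilinD[OF g] scale_minus_left)
  ultimately show ?thesis by simp
qed

text \<open>Terms toggling two different indices cancel in pairs by \<open>sg_anticommute\<close>.
  Toggling the same index twice uses x_i - y_i once and w_i once, in either order, so the remaining
  terms add up to w(x) - w(y).\<close>

lemma \<delta>_\<delta>:
  assumes f: "\<And>A. bilin (f A)"
  shows "\<delta> (\<delta> f) = 0"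
proof (intro ext)
  fix A :: "'n set" and u v
  define t where "t i j = sg i A * sg j (flip i A) * actg (P i A) (actg (P j (flip i A)) (f (flip j (flip i A)))) u v" for i j
  have eq: "\<delta> (\<delta> f) A u v = (\<Sum>i\<in>UNIV. \<Sum>j\<in>UNIV. t i j)"
    unfolding t_def \<delta>_def by (simp add: actg_sum sum_distrib_left mult.assoc)
  have off: "t i j + t j i = 0" if "i \<noteq> j" for i j
  proof -
    have P: "P j (flip i A) = P j A" "P i (flip j A) = P i A" using that by (auto simp: P_def)
    show ?thesis unfolding t_def P sg_anticommute[OF that, of A]
      by (simp add: actg_commute[of "P i A"] flip_commute[of i])
  qed
  have diag: "t i i = actg (L i) (actg (Dl i) (f A)) u v" for i
    unfolding t_def by (simp add: sg_flip_le P_def actg_commute[of "Dl i"])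
  \<comment> \<open>The double sum is added to its transpose to bring the cancelling pairs together;
    the factor 2 is removed at the end, in characteristic zero.\<close>
  have "(\<Sum>i\<in>UNIV. \<Sum>j\<in>UNIV. t i j) + (\<Sum>i\<in>UNIV. \<Sum>j\<in>UNIV. t i j) = (\<Sum>i\<in>UNIV. \<Sum>j\<in>UNIV. t i j + t j i)"
    unfolding sum.distrib by (subst (2) sum.swap) (rule refl)
  also have "\<dots> = (\<Sum>i\<in>UNIV. \<Sum>j\<in>UNIV. if j = i then t i i + t i i else 0)"
    by (intro sum.cong refl) (use off in auto)
  also have "\<dots> = 2 * (\<Sum>i\<in>UNIV. t i i)" by (simp add: sum_distrib_left)
  also have "(\<Sum>i\<in>UNIV. t i i) = 0" unfolding diag by (rule actg_Dl_L[OF f])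
  finally have "2 * (\<Sum>i\<in>UNIV. \<Sum>j\<in>UNIV. t i j) = 0" by simp
  then show "\<delta> (\<delta> f) A u v = 0 A u v" unfolding eq by simp
qed

text \<open>Toggling \<open>j\<close> different from \<open>i\<close> anticommutes with toggling
  \<open>i\<close>, so only j = i survives. There exactly one of the two composites is nonzero at a
  given \<open>A\<close>, and in both cases its coefficient is \<open>L i\<close> or
  \<open>Dl i\<close> as \<open>\<sigma>\<close> prescribes.\<close>

lemma \<delta>_\<kappa>: "\<delta> (\<kappa> \<sigma> i f) + \<kappa> \<sigma> i (\<delta> f) = acts (if \<sigma> then L i else Dl i) f"
proof (intro ext)
  fix A :: "'n set" and u v
  define t where "t j = (if (i \<in> flip j A) = \<sigma> then sg j A * sg i (flip j A) * actg (P j A) (f (flip i (flip j A))) u v else 0)" for j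
  define t' where "t' j = (if (i \<in> A) = \<sigma> then sg i A * sg j (flip i A) * actg (P j (flip i A)) (f (flip j (flip i A))) u v else 0)" for j
  have "actg (P j A) (\<kappa> \<sigma> i f (flip j A)) u v = (if (i \<in> flip j A) = \<sigma> then sg i (flip j A) * actg (P j A) (f (flip i (flip j A))) u v else 0)" for j
  proof (cases "(i \<in> flip j A) = \<sigma>")
    case True
    then have "\<kappa> \<sigma> i f (flip j A) = (\<lambda>u v. sg i (flip j A) * f (flip i (flip j A)) u v)"
      unfolding \<kappa>_def by (simp only: True refl if_True)
    then show ?thesis by (simp only: True actg_cmult refl if_True)
  next
    case False
    then have "\<kappa> \<sigma> i f (flip j A) = 0" unfolding \<kappa>_def by (simp only: False if_False zero_fun_def)
    then show ?thesis using False by (simp only: actg_0 zero_fun_apply if_False)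
  qed
  then have 1: "\<delta> (\<kappa> \<sigma> i f) A u v = (\<Sum>j\<in>UNIV. t j)"
    unfolding \<delta>_def t_def by (intro sum.cong refl) (simp only: mult_zero_right mult.assoc if_distrib[of "(*) _"])
  have 2: "\<kappa> \<sigma> i (\<delta> f) A u v = (\<Sum>j\<in>UNIV. t' j)"
    unfolding \<kappa>_def \<delta>_def t'_def by (simp add: sum_distrib_left mult.assoc)
  have "t j + t' j = (if j = i then actg (if \<sigma> then L i else Dl i) (f A) u v else 0)" for j
  proof (cases "j = i")
    case True
    then show ?thesis unfolding t_def t'_def by (cases \<sigma>) (auto simp: P_def sg_flip_le)
  next
    case False
    then have P: "P j (flip i A) = P j A" by (auto simp: P_def)
    have m: "(i \<in> flip j A) = (i \<in> A)" using False by auto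
    show ?thesis
      unfolding t_def t'_def P m flip_commute[of i j A] sg_anticommute[OF False, of A] using False by simp
  qed
  then have "(\<Sum>j\<in>UNIV. t j) + (\<Sum>j\<in>UNIV. t' j) = actg (if \<sigma> then L i else Dl i) (f A) u v"
    by (simp flip: sum.distrib)
  then show "(\<delta> (\<kappa> \<sigma> i f) + \<kappa> \<sigma> i (\<delta> f)) A u v = acts (if \<sigma> then L i else Dl i) f A u v"
    using 1 2 by (simp add: acts_def)
qed

lemma vector_space_fscale: "vector_space fscale"
  by unfold_locales (simp_all add: fun_eq_iff algebra_simps)

lemma acts_add: "acts M (f + g) = acts M f + acts M g"
  by (simp add: acts_def fun_eq_iff actg_add)

lemma acts_scale: "acts M (fscale c f) = fscale c (acts M f)"
  by (simp add: acts_def fun_eq_iff actg_cmult)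

lemma linear_ops: "Vector_Spaces.linear fscale fscale (ops i)"
  unfolding Vector_Spaces.linear_iff ops_def using vector_space_fscale
  by (auto simp: acts_add acts_scale split: sum.split)

lemma ops_commute: "ops i (ops j f) = ops j (ops i f)"
  unfolding ops_def by (auto simp: acts_commute split: sum.split)

sublocale fs: lowering_ops fscale ops
  by (intro lowering_ops.intro vspace.intro vector_space_fscale lowering_ops_axioms.intro linear_ops ops_commute)

end

text \<open>The maps \<open>e t\<close> are coordinate functionals with dual basis
  \<open>\<beta> t\<close>. Separation of points is asked on U only.\<close>

lemma (in vspace) dim_by_evaluation:
  assumes T: "finite T" and U: "subspace U"
    and e_add: "\<And>t f g. e t (f + g) = e t f + e t g" and e_scale: "\<And>t c f. e t (scale c f) = c * e t f"
    and \<beta>: "\<And>t. t \<in> T \<Longrightarrow> \<beta> t \<in> U"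
    and dual: "\<And>t t'. t \<in> T \<Longrightarrow> t' \<in> T \<Longrightarrow> e t (\<beta> t') = (if t = t' then 1 else 0)"
    and inj: "\<And>f. f \<in> U \<Longrightarrow> (\<And>t. t \<in> T \<Longrightarrow> e t f = 0) \<Longrightarrow> f = 0"
  shows "dim U = card T \<and> fdim U"
proof -
  have e_0: "e t 0 = 0" for t using e_scale[of t 0 0] by simp
  have e_sum: "e t (\<Sum>x\<in>S. F x) = (\<Sum>x\<in>S. e t (F x))" for t S and F :: "'t \<Rightarrow> 'b"
    by (induction S rule: infinite_finite_induct) (simp_all add: e_0 e_add)
  have inj_\<beta>: "inj_on \<beta> T" by (rule inj_onI) (metis dual zero_neq_one)
  have ind: "independent (\<beta> ` T)"
    unfolding dependent_def
  proof clarify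
    fix t assume t: "t \<in> T" and sp: "\<beta> t \<in> span (\<beta> ` T - {\<beta> t})"
    have "subspace {f. e t f = 0}" by (rule subspaceI) (simp_all add: e_0 e_add e_scale)
    moreover have "\<beta> ` T - {\<beta> t} \<subseteq> {f. e t f = 0}" using dual t by auto
    ultimately have "\<beta> t \<in> {f. e t f = 0}" using sp span_minimal by blast
    then show False using dual[OF t t] by simp
  qed
  have sp: "U \<subseteq> span (\<beta> ` T)"
  proof
    fix f assume f: "f \<in> U"
    define h where "h = (\<Sum>t\<in>T. scale (e t f) (\<beta> t))"
    have hU: "h \<in> U" unfolding h_def by (intro subspace_sum U subspace_scale \<beta>)
    have "e t (f - h) = 0" if t: "t \<in> T" for t
    proof -
      have "e t h = (\<Sum>t'\<in>T. e t' f * (if t = t' then 1 else 0))"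
        unfolding h_def e_sum e_scale using dual t by (intro sum.cong) auto
      also have "\<dots> = (\<Sum>t'\<in>T. if t = t' then e t' f else 0)" by (intro sum.cong) auto
      also have "\<dots> = e t f" using t T by simp
      finally have "e t h = e t f" .
      moreover have "e t f = e t (f - h) + e t h" by (simp flip: e_add)
      ultimately show ?thesis by simp
    qed
    then have "f - h = 0" using inj[OF subspace_diff[OF U f hU]] by blast
    then have "f = h" by simp
    moreover have "h \<in> span (\<beta> ` T)" unfolding h_def by (intro span_sum span_scale span_base imageI)
    ultimately show "f \<in> span (\<beta> ` T)" by simp
  qed
  have "fdim U" unfolding fdim_def using sp T by blast
  moreover
  have "dim U = card (\<beta> ` T)" by (rule dim_unique[OF _ sp ind refl]) (use \<beta> in auto)
  then have "dim U = card T" using inj_\<beta> card_image by metis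
  ultimately show ?thesis by blast
qed

section \<open>Dimensions and Hilbert series of the complex\<close>

context hypersurface_module
begin

lemma bilin_sum:
  assumes "bilin g"
  shows "g (\<Sum>x\<in>S. F x) v = (\<Sum>x\<in>S. g (F x) v)" "g v (\<Sum>x\<in>S. F x) = (\<Sum>x\<in>S. g v (F x))"
  by (induction S rule: infinite_finite_induct) (simp_all add: bilinD[OF assms])

lemma bilin_eq_0I:
  assumes g: "bilin g" and z: "\<And>i l u v. u \<in> gr i \<Longrightarrow> v \<in> gr l \<Longrightarrow> g u v = 0"
  shows "g = 0"
proof (intro ext)
  fix u v
  have 1: "g x v = 0" if "x \<in> gr i" for x i
  proof -
    have "g x v = (\<Sum>l | component v l \<noteq> 0. g x (component v l))"
      using arg_cong[OF component_sum[OF finite_component order_refl, of v], of "g x"] by (simp only: bilin_sum[OF g])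
    then show ?thesis using z[OF that component_in_gr] by simp
  qed
  have "g u v = (\<Sum>i | component u i \<noteq> 0. g (component u i) v)"
    using arg_cong[OF component_sum[OF finite_component order_refl, of u], of "\<lambda>x. g x v"] by (simp only: bilin_sum[OF g])
  then show "g u v = 0 u v" using 1[OF component_in_gr] by simp
qed

lemma bilin_span1:
  assumes g: "bilin g" and "\<And>x. x \<in> S \<Longrightarrow> g x v = 0" and "u \<in> vs.span S"
  shows "g u v = 0"
  using assms(3)
proof (induction rule: vs.span_induct)
  case base
  show ?case using g unfolding bilin_def by (intro vs.subspaceI) (auto simp: bilinD(5)[OF g])
qed (rule assms(2))

lemma bilin_span2:
  assumes g: "bilin g" and "\<And>x. x \<in> S \<Longrightarrow> g v x = 0" and "u \<in> vs.span S"
  shows "g v u = 0"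
  using assms(3)
proof (induction rule: vs.span_induct)
  case base
  show ?case using g unfolding bilin_def by (intro vs.subspaceI) (auto simp: bilinD(6)[OF g])
qed (rule assms(2))

text \<open>The lower bound for the degrees of the complex: 2 \<open>j0\<close> for the tensor
  square, plus the least weight, which belongs to the full set of indices.\<close>

definition s0 :: int where "s0 = 2 * j0 + (1 - int b) * int CARD('n)"

text \<open>The excess of the weight of \<open>A\<close> over the least weight, as a natural number;
  it becomes an exponent of the series variable.\<close>

definition shift :: "'n set \<Rightarrow> nat" where "shift A = (b - 1) * (CARD('n) - card A)"

lemma card_le_CARD: "card (A :: 'n set) \<le> CARD('n)"
  by (rule card_mono) auto

lemma s0_shift: "s0 + int r - wt A = 2 * j0 + int r - int (shift A)"
proof -
  have "int (shift A) = (int b - 1) * (int CARD('n) - int (card A))"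
    unfolding shift_def of_nat_mult of_nat_diff[OF b_pos] of_nat_diff[OF card_le_CARD] by simp
  then show ?thesis by (simp add: s0_def wt_def algebra_simps)
qed

lemma V_add: "f \<in> V \<pi> s \<Longrightarrow> g \<in> V \<pi> s \<Longrightarrow> f + g \<in> V \<pi> s"
  unfolding V_def by (auto simp: forms_add)

lemma V_subspace: "fs.subspace (V \<pi> s)"
proof (rule fs.subspaceI)
  show "0 \<in> V \<pi> s" unfolding V_def by simp
  show "fscale c f \<in> V \<pi> s" if "f \<in> V \<pi> s" for c f
    using that unfolding V_def by (auto simp: forms_cmult zero_fun_def)
qed (rule V_add)

lemma hom_list_ops: "hom_list 1 [(pvar i, 1)]" "hom_list 1 [(1, pvar i)]"
proof -
  have "\<exists>\<alpha> \<beta>. homogeneous \<alpha> (pvar i) \<and> homogeneous \<beta> (1 :: ('n, 'k) mpoly) \<and> \<alpha> + \<beta> = 1"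
    by (intro exI[of _ 1] exI[of _ 0]) simp
  moreover have "\<exists>\<alpha> \<beta>. homogeneous \<alpha> (1 :: ('n, 'k) mpoly) \<and> homogeneous \<beta> (pvar i) \<and> \<alpha> + \<beta> = 1"
    by (intro exI[of _ 0] exI[of _ 1]) simp
  ultimately show "hom_list 1 [(pvar i, 1)]" "hom_list 1 [(1, pvar i)]" unfolding hom_list_def by simp_all
qed

lemma V_ops: "f \<in> V \<pi> s \<Longrightarrow> ops i f \<in> V \<pi> (s - 1)"
  using V_acts[OF _ hom_list_ops(1)] V_acts[OF _ hom_list_ops(2)]
  unfolding ops_def by (cases i) auto

lemma fam_V: "fs.fam (V \<pi>)"
  unfolding fs.fam_def using V_subspace V_ops by blast

lemma V_low: "s < s0 \<Longrightarrow> V \<pi> s \<subseteq> {0}"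
proof
  fix f assume s: "s < s0" and f: "f \<in> V \<pi> s"
  have "f A = 0" for A
  proof (rule bilin_eq_0I[OF V_bilin[OF f]])
    fix i l u v assume uv: "u \<in> gr i" "v \<in> gr l"
    have bil: "bilin (f A)" using V_bilin[OF f] .
    consider "i < j0" | "l < j0" | "i \<ge> j0" "l \<ge> j0" by linarith
    then show "f A u v = 0"
    proof cases
      case 3
      have "s - wt A < 2 * j0" using s s0_shift[of 0 A] by simp
      then have "i + l \<noteq> s - wt A" using 3 by simp
      then show ?thesis using f uv unfolding V_def forms_def by blast
    qed (use uv gr_low bilinD[OF bil] in auto)
  qed
  then show "f \<in> {0}" by (simp add: fun_eq_iff)
qed

text \<open>Weights are at most 0, so from degree 2 \<open>j1\<close> + 1 on one of the two
  arguments has degree above \<open>j1\<close>. That argument is a combination of multiples of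
  variables, on which a form killed by all operators vanishes.\<close>

lemma V_cogenerated:
  assumes "s \<ge> 2 * j1 + 1" and f: "f \<in> V \<pi> s" and z: "\<And>i. ops i f \<in> {0}"
  shows "f \<in> {0}"
proof -
  have "f A = 0" for A
  proof (rule bilin_eq_0I[OF V_bilin[OF f]])
    fix i l u v assume uv: "u \<in> gr i" "v \<in> gr l"
    have bil: "bilin (f A)" using V_bilin[OF f] .
    have wt: "wt A \<le> 0" using b_pos by (simp add: wt_def mult_nonpos_nonneg)
    have z1: "f A (scale (pvar k) y) v = 0" for k y v
    proof -
      have "ops (Inl k) f A y v = 0" using z[of "Inl k"] by simp
      then show ?thesis by (simp add: ops_def acts_def actg_def)
    qed
    have z2: "f A u (scale (pvar k) y) = 0" for k y u
    proof -
      have "ops (Inr k) f A u y = 0" using z[of "Inr k"] by simp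
      then show ?thesis by (simp add: ops_def acts_def actg_def)
    qed
    consider "i + l \<noteq> s - wt A" | "i \<ge> j1 + 1" | "l \<ge> j1 + 1" using assms(1) wt by linarith
    then show "f A u v = 0"
    proof cases
      case 1
      then show ?thesis using f uv unfolding V_def forms_def by blast
    next
      case 2
      then have "u \<in> vs.span {scale (pvar k) y | k y. y \<in> gr (i - 1)}" using gr_gen[of "i - 1"] uv(1) by auto
      from bilin_span1[OF bil _ this] show ?thesis using z1 by blast
    next
      case 3
      then have "v \<in> vs.span {scale (pvar k) y | k y. y \<in> gr (l - 1)}" using gr_gen[of "l - 1"] uv(2) by auto
      from bilin_span2[OF bil _ this] show ?thesis using z2 by blast
    qed
  qed
  then show ?thesis by (simp add: fun_eq_iff)
qed

definition gr_basis where
  "gr_basis j = (SOME B. B \<subseteq> gr j \<and> vs.independent B \<and> gr j \<subseteq> vs.span B \<and> card B = vs.dim (gr j))"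

lemma gr_basis: "gr_basis j \<subseteq> gr j" "vs.independent (gr_basis j)" "gr j \<subseteq> vs.span (gr_basis j)" "card (gr_basis j) = vs.dim (gr j)" "finite (gr_basis j)"
proof -
  have "\<exists>B. B \<subseteq> gr j \<and> vs.independent B \<and> gr j \<subseteq> vs.span B \<and> card B = vs.dim (gr j)"
    using vs.basis_exists by metis
  from someI_ex[OF this, folded gr_basis_def]
  show *: "gr_basis j \<subseteq> gr j" "vs.independent (gr_basis j)" "gr j \<subseteq> vs.span (gr_basis j)" "card (gr_basis j) = vs.dim (gr j)" by blast+
  obtain B where "finite B" "gr j \<subseteq> vs.span B" using gr_finite by blast
  then show "finite (gr_basis j)" using vs.independent_span_bound[of B "gr_basis j"] * by blast
qed

text \<open>Coordinate functions of \<open>gr j\<close>, extended to the whole module by zero on the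
  other components.\<close>

definition coord where "coord j u x = vs.representation (gr_basis j) (component u j) x"

lemma component_span: "component u j \<in> vs.span (gr_basis j)"
  using gr_basis(3) component_in_gr by blast

lemma coord_add: "coord j (u + v) x = coord j u x + coord j v x"
  unfolding coord_def component_add by (subst vs.representation_add[OF gr_basis(2) component_span component_span]) simp

lemma coord_scale: "coord j (const_scale scale c u) x = c * coord j u x"
  unfolding coord_def component_scale by (subst vs.representation_scale[OF gr_basis(2) component_span]) simp

lemma coord_other: "u \<in> gr i \<Longrightarrow> i \<noteq> j \<Longrightarrow> coord j u x = 0"
  unfolding coord_def by (simp add: component_homogeneous vs.representation_zero)

lemma coord_basis: "y \<in> gr_basis j \<Longrightarrow> coord j y x = (if x = y then 1 else 0)"
  using gr_basis(1)[of j] vs.representation_basis[OF gr_basis(2)[of j], of y]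
  unfolding coord_def by (subst component_homogeneous[of y j]) auto

text \<open>Indexes a basis in degree s0 + r: an exterior monomial, the degree p of the first
  argument above \<open>j0\<close>, and a basis vector for each argument. The bound on p ensures
  that no subtraction is truncated.\<close>

definition T where
  "T \<pi> r = (SIGMA A : {A :: 'n set. even (card A) = \<pi>}. SIGMA p : {p. p + shift A \<le> r}.
      gr_basis (j0 + int p) \<times> gr_basis (j0 + int (r - shift A - p)))"

lemma finite_le_add: "finite {p. p + k \<le> (r::nat)}"
  by (rule finite_subset[of _ "{..r}"]) auto

lemma card_T: "card (T \<pi> r) = (\<Sum>A | even (card (A :: 'n set)) = \<pi>. \<Sum>p | p + shift A \<le> r.
    vs.dim (gr (j0 + int p)) * vs.dim (gr (j0 + int (r - shift A - p))))"
  unfolding T_def by (simp add: card_SigmaI finite_le_add gr_basis card_cartesian_product finite_SigmaI)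

lemma finite_T: "finite (T \<pi> r)"
  unfolding T_def by (intro finite_SigmaI finite_le_add gr_basis(5)) simp

text \<open>A form of fixed degree is determined by its values on pairs of basis vectors of
  complementary degrees; products of coordinate functions form the dual basis.\<close>

lemma dim_V: "fs.dim (V \<pi> (s0 + int r)) = card (T \<pi> r)" and fdim_V_aux: "fs.fdim (V \<pi> (s0 + int r))"
proof -
  define e where "e = (\<lambda>(A, p :: nat, x, y) (f :: 'n set \<Rightarrow> 'm \<Rightarrow> 'm \<Rightarrow> 'k). f A x y)"
  define \<beta> where "\<beta> = (\<lambda>(A :: 'n set, p, x, y) A' u v. if A' = A then coord (j0 + int p) u x * coord (j0 + int (r - shift A - p)) v y else 0)"
  have "fs.dim (V \<pi> (s0 + int r)) = card (T \<pi> r) \<and> fs.fdim (V \<pi> (s0 + int r))"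
  proof (rule fs.dim_by_evaluation[where e = e and \<beta> = \<beta>, OF finite_T V_subspace])
    fix t f g c
    show "e t (f + g) = e t f + e t g" by (simp add: e_def split: prod.split)
    show "e t (fscale c f) = c * e t f" by (simp add: e_def split: prod.split)
  next
    fix t assume "t \<in> T \<pi> r"
    then obtain A p x y where t: "t = (A, p, x, y)" "even (card A) = \<pi>" "p + shift A \<le> r"
      unfolding T_def by auto
    show "\<beta> t \<in> V \<pi> (s0 + int r)"
      unfolding V_def mem_Collect_eq
    proof (intro allI conjI impI)
      fix A'
      let ?d = "s0 + int r - wt A'"
      show "\<beta> t A' \<in> forms ?d"
      proof (cases "A' = A")
        case True
        have d: "?d = (j0 + int p) + (j0 + int (r - shift A - p))"
          unfolding s0_shift True using t(3) by simp
        have "bilin (\<lambda>u v. coord (j0 + int p) u x * coord (j0 + int (r - shift A - p)) v y)"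
          unfolding bilin_def by (simp add: coord_add coord_scale distrib_left distrib_right)
        moreover have "coord (j0 + int p) u x * coord (j0 + int (r - shift A - p)) v y = 0"
          if "u \<in> gr i" "v \<in> gr l" "i + l \<noteq> ?d" for i l u v
          using that coord_other[OF that(1), of "j0 + int p" x] coord_other[OF that(2), of "j0 + int (r - shift A - p)" y]
          unfolding d by fastforce
        ultimately show ?thesis unfolding forms_def by (simp add: \<beta>_def t True)
      next
        case False
        then have "\<beta> t A' = 0" by (simp add: \<beta>_def t fun_eq_iff)
        then show ?thesis by simp
      qed
      show "\<beta> t A' = 0" if "even (card A') \<noteq> \<pi>" using that t(2) by (auto simp: \<beta>_def t(1) fun_eq_iff)
    qed
  next
    fix t t' assume "t \<in> T \<pi> r" "t' \<in> T \<pi> r"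
    then obtain A p x y A' p' x' y' where t: "t = (A, p, x, y)" "x \<in> gr_basis (j0 + int p)" "y \<in> gr_basis (j0 + int (r - shift A - p))"
       and t': "t' = (A', p', x', y')" unfolding T_def by auto
    show "e t (\<beta> t') = (if t = t' then 1 else 0)"
    proof (cases "A = A' \<and> p = p'")
      case True
      then show ?thesis using coord_basis[OF t(2)] coord_basis[OF t(3)] by (auto simp: e_def \<beta>_def t(1) t')
    next
      case False
      then have "A \<noteq> A' \<or> coord (j0 + int p') x x' = 0" using coord_other[of x "j0 + int p" "j0 + int p'"] t(2) gr_basis(1) by auto
      then show ?thesis using False by (auto simp: e_def \<beta>_def t(1) t')
    qed
  next
    fix f assume f: "f \<in> V \<pi> (s0 + int r)" and z: "\<And>t. t \<in> T \<pi> r \<Longrightarrow> e t f = 0"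
    have "f A = 0" for A
    proof (cases "even (card A) = \<pi>")
      case False
      then show ?thesis using f unfolding V_def by blast
    next
      case A: True
      have bil: "bilin (f A)" using V_bilin[OF f] .
      show ?thesis
      proof (rule bilin_eq_0I[OF bil])
        fix i l u v assume uv: "u \<in> gr i" "v \<in> gr l"
        consider "i < j0" | "l < j0" | "i + l \<noteq> s0 + int r - wt A"
          | "i \<ge> j0" "l \<ge> j0" "i + l = s0 + int r - wt A" by linarith
        then show "f A u v = 0"
        proof cases
          case 3
          then show ?thesis using f uv unfolding V_def forms_def by blast
        next
          case 4
          define p where "p = nat (i - j0)"
          have p: "i = j0 + int p" "p + shift A \<le> r" "l = j0 + int (r - shift A - p)"
            using 4 unfolding s0_shift p_def by auto
          have "f A x y = 0" if "x \<in> gr_basis i" "y \<in> gr_basis l" for x y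
            using z[of "(A, p, x, y)"] that A p unfolding T_def e_def by simp
          then have "f A x v = 0" if "x \<in> gr_basis i" for x
            using bilin_span2[OF bil, of "gr_basis l" x v] that gr_basis(3) uv(2) by blast
          then show ?thesis using bilin_span1[OF bil, of "gr_basis i" v u] gr_basis(3) uv(1) by blast
        qed (use uv gr_low bilinD[OF bil] in auto)
      qed
    qed
    then show "f = 0" by (simp add: fun_eq_iff)
  qed
  then show "fs.dim (V \<pi> (s0 + int r)) = card (T \<pi> r)" "fs.fdim (V \<pi> (s0 + int r))" by blast+
qed

lemma fdim_V: "fs.fdim (V \<pi> s)"
proof (cases "s < s0")
  case True
  then show ?thesis using V_low[OF True] unfolding fs.fdim_def by (intro exI[of _ "{}"]) simp
next
  case False
  then have "s = s0 + int (nat (s - s0))" by simp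
  then show ?thesis using fdim_V_aux by metis
qed

text \<open>The Hilbert series of the module times t^(-\<open>j0\<close>), which makes it a power
  series.\<close>

definition Hm :: "rat fps" where "Hm = Abs_fps (\<lambda>p. of_nat (vs.dim (gr (j0 + int p))))"

text \<open>The sum over p in \<open>card_T\<close> is the Cauchy product of \<open>Hm\<close> with
  itself.\<close>

lemma V_series:
  "Abs_fps (\<lambda>r. of_nat (fs.dim (V \<pi> (s0 + int r)))) = (\<Sum>A | even (card (A :: 'n set)) = \<pi>. fps_X ^ shift A * (Hm * Hm))"
proof (rule fps_ext)
  fix r
  have "(\<Sum>p | p + shift A \<le> r. of_nat (vs.dim (gr (j0 + int p))) * of_nat (vs.dim (gr (j0 + int (r - shift A - p)))))
      = (fps_X ^ shift A * (Hm * Hm)) $ r" for A :: "'n set"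
  proof (cases "r < shift A")
    case True
    then have "{p. p + shift A \<le> r} = {}" by auto
    then show ?thesis using True by (simp add: fps_X_power_mult_nth)
  next
    case False
    then have "{p. p + shift A \<le> r} = {0..r - shift A}" by auto
    then show ?thesis
      by (simp only: fps_X_power_mult_nth False if_False) (simp add: fps_mult_nth Hm_def)
  qed
  then show "Abs_fps (\<lambda>r. of_nat (fs.dim (V \<pi> (s0 + int r)))) $ r
     = (\<Sum>A | even (card (A :: 'n set)) = \<pi>. fps_X ^ shift A * (Hm * Hm)) $ r"
    by (simp add: dim_V card_T fps_sum_nth)
qed

end

section \<open>Homology and the Euler characteristic\<close>

text \<open>The degree is read off the polarization, whose products p q on the diagonal all have
  degree D - 1.\<close>

lemma homogeneous_partial_deriv:
  fixes w :: "('n::finite, 'k::comm_ring_1) mpoly"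
  assumes "polarization D w L"
  shows "homogeneous (D - 1) (partial_deriv i w)"
proof -
  have "(\<forall>(p, q)\<in>set M. \<exists>a b. homogeneous a p \<and> homogeneous b q \<and> a + b + 1 = D) \<Longrightarrow>
      homogeneous (D - 1) (\<Sum>(p, q)\<leftarrow>M. p * q)"
    for M :: "('n, 'k) mpoly_pairs"
  proof (induction M)
    case (Cons x M)
    obtain p q where x: "x = (p, q)" by fastforce
    have "\<exists>a b. homogeneous a p \<and> homogeneous b q \<and> a + b + 1 = D" using Cons.prems by (simp add: x)
    then obtain a b where ab: "homogeneous a p" "homogeneous b q" "a + b + 1 = D" by blast
    have "homogeneous (D - 1) (p * q)" using homogeneous_mult[OF ab(1,2)] ab(3) by auto
    moreover have "homogeneous (D - 1) (\<Sum>(p, q)\<leftarrow>M. p * q)" using Cons by simp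
    ultimately show ?case by (simp add: x homogeneous_add)
  qed simp
  from this[of "L i"] show ?thesis using assms unfolding polarization_def by simp
qed

section \<open>Cycles, boundaries and the operators on homology\<close>

context hypersurface_module
begin

lemma linear_\<delta>: "Vector_Spaces.linear fscale fscale \<delta>"
  unfolding Vector_Spaces.linear_iff using vector_space_fscale \<delta>_add \<delta>_scale by blast

lemma \<kappa>_0: "\<kappa> \<sigma> i 0 = 0"
  by (simp add: \<kappa>_def fun_eq_iff)

lemma \<delta>_ops: "\<delta> (ops i f) = ops i (\<delta> f)"
  unfolding ops_def by (auto simp: \<delta>_acts split: sum.split)

definition Z where "Z \<pi> s = {f \<in> V \<pi> s. \<delta> f = 0}"

definition Bd where "Bd \<pi> s = \<delta> ` V (\<not> \<pi>) (s + int b)"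

lemma ops_0: "ops i 0 = 0"
  by (cases i) (simp_all add: ops_def acts_def actg_def fun_eq_iff)

lemma fam_zero: "fs.fam (\<lambda>_. {0})"
  unfolding fs.fam_def by (auto simp: ops_0 fs.subspace_single_0)

lemma fam_Z: "fs.fam (Z \<pi>)"
proof -
  have "fs.fam (fs.ker_fam \<delta> (int b) (V \<pi>) (\<lambda>_. {0}))"
    by (rule fs.fam_ker[OF linear_\<delta> \<delta>_ops fam_V fam_zero])
  moreover have "fs.ker_fam \<delta> (int b) (V \<pi>) (\<lambda>_. {0}) = Z \<pi>"
    by (auto simp: fs.ker_fam_def Z_def fun_eq_iff)
  ultimately show ?thesis by simp
qed

lemma im_fam_Bd: "fs.im_fam \<delta> (int b) (V (\<not> \<pi>)) (\<lambda>_. {0}) = Bd \<pi>"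
  by (rule ext) (auto simp: fs.im_fam_def Bd_def)

lemma fam_Bd: "fs.fam (Bd \<pi>)"
  using fs.fam_im[OF linear_\<delta> \<delta>_ops fam_V fam_zero, of "int b" "\<not> \<pi>"] unfolding im_fam_Bd .

lemma Bd_le_Z: "Bd \<pi> \<le> Z \<pi>"
proof (rule le_funI, rule subsetI)
  fix s f assume "f \<in> Bd \<pi> s"
  then obtain g where g: "f = \<delta> g" "g \<in> V (\<not> \<pi>) (s + int b)" unfolding Bd_def by blast
  have "f \<in> V \<pi> s" using V_\<delta>[OF g(2)] g(1) by simp
  moreover have "\<delta> f = 0" unfolding g(1) by (rule \<delta>_\<delta>[OF V_bilin[OF g(2)]])
  ultimately show "f \<in> Z \<pi> s" unfolding Z_def by blast
qed

lemma Z_le_V: "Z \<pi> \<le> V \<pi>"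
  by (auto simp: le_fun_def Z_def)

lemma zero_le_fam: "fs.fam U \<Longrightarrow> (\<lambda>_. {0}) \<le> U"
  using fs.fam_subspace fs.subspace_0 by (fastforce simp: le_fun_def)

lemma dim_V_split: "fs.dim (V \<pi> s) = fs.dim (Z \<pi> s) + fs.dim (Bd (\<not> \<pi>) (s - int b))"
proof -
  have "fs.fdim {0}" unfolding fs.fdim_def by (intro exI[of _ "{}"]) simp
  from fs.dim_preimage_image_sum[OF linear_\<delta> V_subspace fdim_V fs.subspace_single_0 this, of \<pi> s]
  have "fs.dim (V \<pi> s) + fs.dim {0} = fs.dim {u \<in> V \<pi> s. \<delta> u \<in> {0}} + fs.dim {\<delta> u + v | u v. u \<in> V \<pi> s \<and> v \<in> {0}}" .
  moreover have "{u \<in> V \<pi> s. \<delta> u \<in> {0}} = Z \<pi> s" by (auto simp: Z_def)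
  moreover have "{\<delta> u + v | u v. u \<in> V \<pi> s \<and> v \<in> {0}} = Bd (\<not> \<pi>) (s - int b)" by (auto simp: Bd_def)
  moreover have "fs.dim {0} = 0" using fs.dim_le_card[of "{0}" "{}"] by simp
  ultimately show ?thesis by simp
qed

text \<open>Finite generation of the module enters here, dualized through
  \<open>V_cogenerated\<close>. The condition then passes to cycles, to boundaries and to their
  quotient.\<close>

lemma dcc_V: "fs.dcc (\<lambda>_. {0}) (V \<pi>)"
proof (rule fs.dcc_of_cogenerated[of UNIV])
  show "V \<pi> j \<subseteq> {0}" if "j < s0" for j using V_low that by blast
  show "u \<in> {0}" if "2 * j1 + 1 \<le> j" "u \<in> V \<pi> j" "\<And>i. i \<in> UNIV \<Longrightarrow> ops i u \<in> {0}" for j u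
    using V_cogenerated that by blast
qed (simp_all add: fam_zero fam_V zero_le_fam fdim_V)

lemma fdim_Z: "fs.fdim (Z \<pi> s)" and fdim_Bd: "fs.fdim (Bd \<pi> s)"
proof -
  show Z: "fs.fdim (Z \<pi> s)" by (rule fs.fdim_subset[OF fdim_V le_funD[OF Z_le_V]])
  show "fs.fdim (Bd \<pi> s)" by (rule fs.fdim_subset[OF Z le_funD[OF Bd_le_Z]])
qed

lemma has_val_subfamily:
  assumes "fs.fam U" "U \<le> V \<pi>" "\<And>s. fs.fdim (U s)"
  shows "\<exists>c. has_val (Abs_fps (\<lambda>r. of_nat (fs.dim (U (s0 + int r))))) c"
proof -
  have d0: "fs.dim {0} = 0" using fs.dim_le_card[of "{0}" "{}"] by simp
  have "\<exists>c. has_val (Abs_fps (\<lambda>r. of_nat (fs.dim (U (s0 + int r))) - of_nat (fs.dim {0}))) c"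
  proof (rule fs.hilbert_serre[of UNIV])
    show "U j \<subseteq> {0}" if "j < s0" for j using V_low[OF that, of \<pi>] assms(2) by (auto simp: le_fun_def)
    show "fs.dcc (\<lambda>_. {0}) U" using fs.dcc_sub[OF dcc_V order_refl assms(2)] .
    show "fs.fam (\<lambda>_. {0})" "fs.fam U" "(\<lambda>_. {0}) \<le> U" "fs.fdim (U j)" for j
      by (rule fam_zero assms zero_le_fam)+
  qed simp_all
  then show ?thesis by (simp add: d0)
qed

text \<open>Multiplication by \<open>x\<^sub>i - y\<^sub>i\<close> and by \<open>w\<^sub>i(x, y)\<close> is null-homotopic, so the homology is
  annihilated by the Jacobian ideal acting through either set of variables.\<close>

lemma Bd_add: "f \<in> Bd \<pi> s \<Longrightarrow> g \<in> Bd \<pi> s \<Longrightarrow> f + g \<in> Bd \<pi> s"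
  and Bd_diff: "f \<in> Bd \<pi> s \<Longrightarrow> g \<in> Bd \<pi> s \<Longrightarrow> f - g \<in> Bd \<pi> s"
  and Bd_scale: "f \<in> Bd \<pi> s \<Longrightarrow> fscale c f \<in> Bd \<pi> s"
  and Bd_0: "0 \<in> Bd \<pi> s"
  using fs.fam_subspace[OF fam_Bd, of \<pi> s] fs.subspace_add fs.subspace_diff fs.subspace_scale fs.subspace_0
  by blast+

lemma homotopy_Bd:
  assumes "f \<in> Z \<pi> s"
  shows "acts (Dl i) f \<in> Bd \<pi> (s - 1)" "acts (L i) f \<in> Bd \<pi> (s - int (2 * b - 1))"
proof -
  have f: "f \<in> V \<pi> s" "\<delta> f = 0" using assms unfolding Z_def by blast+
  have eq: "acts (if \<sigma> then L i else Dl i) f = \<delta> (\<kappa> \<sigma> i f)" for \<sigma>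
    unfolding \<delta>_\<kappa>[symmetric] f(2) \<kappa>_0 by simp
  have "\<kappa> False i f \<in> V (\<not> \<pi>) (s - 1 + int b)" using V_\<kappa>[OF f(1), of False i] by (simp add: algebra_simps)
  then show "acts (Dl i) f \<in> Bd \<pi> (s - 1)" unfolding Bd_def using eq[of False] by auto
  have "\<kappa> True i f \<in> V (\<not> \<pi>) (s - int (2 * b - 1) + int b)"
    using V_\<kappa>[OF f(1), of True i] b_pos by (simp add: algebra_simps of_nat_diff)
  then show "acts (L i) f \<in> Bd \<pi> (s - int (2 * b - 1))" unfolding Bd_def using eq[of True] by auto
qed

abbreviation pr where "pr p q \<equiv> acts [(p, q)]"

lemma pr_apply: "pr p q f A u v = f A (scale p u) (scale q v)"
  by (simp add: acts_def actg_def)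

lemma pr_pr: "pr p q (pr p' q' f) = pr (p * p') (q * q') f"
  by (intro ext) (simp add: pr_apply mult.commute)

lemma pr_1 [simp]: "pr 1 1 f = f"
  by (intro ext) (simp add: pr_apply)

lemma pr_ops: "ops (Inl i) f = pr (pvar i) 1 f" "ops (Inr i) f = pr 1 (pvar i) f"
  by (simp_all add: ops_def)

lemma pr_add:
  assumes "\<And>A. bilin (f A)"
  shows "pr (p + p') q f = pr p q f + pr p' q f" "pr p (q + q') f = pr p q f + pr p q' f"
  by (intro ext; simp add: pr_apply scale_left_distrib bilinD[OF assms])+

lemma pr_0:
  assumes "\<And>A. bilin (f A)"
  shows "pr 0 q f = 0" "pr p 0 f = 0"
  by (intro ext; simp add: pr_apply bilinD[OF assms])+

lemma pr_single:
  assumes "\<And>A. bilin (f A)"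
  shows "pr (single m c) q f = fscale c (pr (mon m) q f)"
    "pr p (single m c) f = fscale c (pr p (mon m) f)"
  unfolding single_eq_const_mult[of m c]
  by (intro ext; simp add: pr_apply bilinD[OF assms] flip: scale_scale)+

lemma pr_diff_Dl:
  assumes "\<And>A. bilin (f A)"
  shows "pr 1 (pvar i) f - pr (pvar i) 1 f = - acts (Dl i) f"
  by (intro ext) (simp add: pr_apply acts_def Dl_def actg_def bilinD[OF assms])

lemma fam_pr_mon:
  assumes "fs.fam U" "f \<in> U s"
  shows "pr (mon m) 1 f \<in> U (s - int (mdeg m))" "pr 1 (mon m) f \<in> U (s - int (mdeg m))"
proof -
  have "mdeg m = d \<Longrightarrow> pr (mon m) 1 f \<in> U (s - int d) \<and> pr 1 (mon m) f \<in> U (s - int d)" for d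
  proof (induction d arbitrary: m)
    case 0
    then show ?case using assms by simp
  next
    case (Suc d)
    obtain i m' where m: "m = single i 1 + m'" "mdeg m' = d"
      using monomial_degree_SucE[OF Suc.prems] by metis
    have "pr (mon m) 1 f = ops (Inl i) (pr (mon m') 1 f)" "pr 1 (mon m) f = ops (Inr i) (pr 1 (mon m') f)"
      unfolding pr_ops pr_pr m(1) mon_add by simp_all
    moreover have "s - int (Suc d) = s - int d - 1" by simp
    ultimately show ?case using fs.fam_act[OF assms(1)] Suc.IH[OF m(2)] by metis
  qed
  then show "pr (mon m) 1 f \<in> U (s - int (mdeg m))" "pr 1 (mon m) f \<in> U (s - int (mdeg m))"
    by blast+
qed

lemma fam_pr:
  assumes U: "fs.fam U" "f \<in> U s" and bil: "\<And>A. bilin (f A)" and p: "homogeneous d p"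
  shows "pr p 1 f \<in> U (s - int d)"
proof -
  note S = fs.fam_subspace[OF U(1), of "s - int d"]
  show ?thesis
    using p
  proof (induction rule: homogeneous_induct)
    case zero
    show ?case unfolding pr_0(1)[OF bil] by (rule fs.subspace_0[OF S])
  next
    case (single m c)
    show ?case unfolding pr_single(1)[OF bil, of m c]
      by (rule fs.subspace_scale[OF S]) (use fam_pr_mon(1)[OF U, of m] single in simp)
  next
    case (add p q)
    show ?case unfolding pr_add(1)[OF bil] by (rule fs.subspace_add[OF S add.IH])
  qed
qed

lemma Z_bilin: "f \<in> Z \<pi> s \<Longrightarrow> bilin (f A)"
  unfolding Z_def using V_bilin by blast

text \<open>On homology y may be replaced by x, one variable at a time: y_i y^m' - x_i x^m' = y_i
  (y^m' - x^m') + (y_i - x_i) x^m'.\<close>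

lemma pr_mon_diff_Bd:
  assumes "f \<in> Z \<pi> s"
  shows "pr 1 (mon m) f - pr (mon m) 1 f \<in> Bd \<pi> (s - int (mdeg m))"
proof -
  have "mdeg m = d \<Longrightarrow> pr 1 (mon m) f - pr (mon m) 1 f \<in> Bd \<pi> (s - int d)" for d
  proof (induction d arbitrary: m)
    case 0
    then show ?case using Bd_0[of \<pi> s] by (simp add: zero_fun_def)
  next
    case (Suc d)
    obtain i m' where m: "m = single i 1 + m'" "mdeg m' = d"
      using monomial_degree_SucE[OF Suc.prems] by metis
    define g where "g = pr (mon m') 1 f"
    have g: "g \<in> Z \<pi> (s - int d)" unfolding g_def using fam_pr_mon(1)[OF fam_Z assms, of m'] m(2) by simp
    have "fscale (- 1) (acts (Dl i) g) \<in> Bd \<pi> (s - int d - 1)" by (rule Bd_scale[OF homotopy_Bd(1)[OF g]])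
    moreover have "fscale (- 1) (acts (Dl i) g) = pr 1 (pvar i) g - pr (pvar i) 1 g"
      unfolding pr_diff_Dl[OF Z_bilin[OF g]] by (simp add: fun_eq_iff)
    ultimately have 1: "pr 1 (pvar i) g - pr (pvar i) 1 g \<in> Bd \<pi> (s - int d - 1)" by simp
    have 2: "ops (Inr i) (pr 1 (mon m') f - g) \<in> Bd \<pi> (s - int d - 1)"
      unfolding g_def by (rule fs.fam_act[OF fam_Bd Suc.IH[OF m(2)]])
    have "ops (Inr i) (pr 1 (mon m') f - g) = pr 1 (mon m) f - pr 1 (pvar i) g"
      by (intro ext) (simp add: pr_ops pr_apply m(1) mult_single add.commute)
    moreover have "pr (pvar i) 1 g = pr (mon m) 1 f" unfolding g_def pr_pr m(1) mon_add by simp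
    ultimately have eq: "pr 1 (mon m) f - pr (mon m) 1 f
       = ops (Inr i) (pr 1 (mon m') f - g) + (pr 1 (pvar i) g - pr (pvar i) 1 g)" by simp
    have "s - int (Suc d) = s - int d - 1" by simp
    then show ?case unfolding eq using Bd_add[OF 2 1] by (simp only:)
  qed
  then show ?thesis by blast
qed

lemma pr_diff_Bd:
  assumes f: "f \<in> Z \<pi> s" and q: "homogeneous d q"
  shows "pr 1 q f - pr q 1 f \<in> Bd \<pi> (s - int d)"
proof -
  note bil = Z_bilin[OF f]
  show ?thesis using q
  proof (induction rule: homogeneous_induct)
    case zero
    show ?case unfolding pr_0[OF bil] using Bd_0[of \<pi> "s - int d"] by (simp add: zero_fun_def)
  next
    case (single m c)
    have "fscale c (pr 1 (mon m) f - pr (mon m) 1 f) \<in> Bd \<pi> (s - int d)"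
      using Bd_scale[OF pr_mon_diff_Bd[OF f, of m]] single by simp
    moreover have "fscale c (pr 1 (mon m) f - pr (mon m) 1 f) = pr 1 (single m c) f - pr (single m c) 1 f"
      unfolding pr_single(1)[OF bil, of m c] pr_single(2)[OF bil, of _ m c] by (simp add: fun_eq_iff right_diff_distrib)
    ultimately show ?case by (simp only:)
  next
    case (add p q)
    have "pr 1 (p + q) f - pr (p + q) 1 f = (pr 1 p f - pr p 1 f) + (pr 1 q f - pr q 1 f)"
      unfolding pr_add[OF bil] by simp
    then show ?case using Bd_add[OF add.IH] by (simp only:)
  qed
qed

lemma pr_prod_diff_Bd:
  assumes f: "f \<in> Z \<pi> s" and p: "homogeneous d p" and q: "homogeneous e q"
  shows "pr p q f - pr (p * q) 1 f \<in> Bd \<pi> (s - int (d + e))"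
proof -
  have "pr p 1 f \<in> Z \<pi> (s - int d)" by (rule fam_pr[OF fam_Z f Z_bilin[OF f] p])
  from pr_diff_Bd[OF this q] show ?thesis by (simp add: pr_pr mult.commute algebra_simps)
qed

lemma acts_list_diff_Bd:
  assumes f: "f \<in> Z \<pi> s"
  shows "hom_list t M \<Longrightarrow> acts M f - pr (\<Sum>(p, q)\<leftarrow>M. p * q) 1 f \<in> Bd \<pi> (s - int t)"
proof (induction M)
  case Nil
  have "acts [] f = 0" by (simp add: acts_def fun_eq_iff)
  then show ?case using Bd_0[of \<pi> "s - int t"] by (simp add: pr_0[OF Z_bilin[OF f]] zero_fun_def)
next
  case (Cons x M)
  obtain p q where x: "x = (p, q)" by fastforce
  have "\<exists>d e. homogeneous d p \<and> homogeneous e q \<and> d + e = t"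
    using Cons.prems unfolding hom_list_def x by simp
  then obtain d e where "homogeneous d p" "homogeneous e q" "d + e = t" by blast
  then have 1: "pr p q f - pr (p * q) 1 f \<in> Bd \<pi> (s - int t)" using pr_prod_diff_Bd[OF f] by blast
  have "hom_list t M" using Cons.prems unfolding hom_list_def by simp
  note 2 = Cons.IH[OF this]
  have "acts (x # M) f = pr p q f + acts M f" by (intro ext) (simp add: acts_def x actg_Cons)
  then have "acts (x # M) f - pr (\<Sum>(p, q)\<leftarrow>x # M. p * q) 1 f
     = (pr p q f - pr (p * q) 1 f) + (acts M f - pr (\<Sum>(p, q)\<leftarrow>M. p * q) 1 f)"
    by (simp add: x pr_add[OF Z_bilin[OF f]])
  then show ?case using Bd_add[OF 1 2] by (simp only:)
qed

text \<open>On homology w_i(x, y) acts as zero by homotopy, and it acts as w_i(x, x), which is the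
  partial derivative, because y may be replaced by x.\<close>

lemma pr_partial_deriv_Bd:
  assumes f: "f \<in> Z \<pi> s"
  shows "pr (partial_deriv i w) 1 f \<in> Bd \<pi> (s - int (2 * b - 1))"
proof -
  have "(\<Sum>(p, q)\<leftarrow>L i. p * q) = partial_deriv i w" using polarization unfolding polarization_def by blast
  then have "acts (L i) f - pr (partial_deriv i w) 1 f \<in> Bd \<pi> (s - int (2 * b - 1))"
    using acts_list_diff_Bd[OF f hom_list_L] by metis
  from Bd_diff[OF homotopy_Bd(2)[OF f, of i] this] show ?thesis by simp
qed

text \<open>By smoothness all monomials of some degree N lie in the Jacobian ideal, so they kill
  homology through x; mixed monomials in x and y reduce to this case.\<close>

lemma monomials_annihilate_homology:
  obtains N where "\<And>\<pi> s f m m'. f \<in> Z \<pi> s \<Longrightarrow> mdeg m + mdeg m' = N \<Longrightarrow>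
    pr (mon m) (mon m') f \<in> Bd \<pi> (s - int N)"
proof -
  obtain N where N: "\<And>m. mdeg m = N \<Longrightarrow>
       \<exists>g e. (\<forall>i. homogeneous e (g i)) \<and> mon m = (\<Sum>i\<in>UNIV. g i * partial_deriv i w)"
    using jacobian by blast
  have X: "pr (mon m) 1 f \<in> Bd \<pi> (s - int N)" if f: "f \<in> Z \<pi> s" and m: "mdeg m = N" for f \<pi> s m
  proof -
    obtain g e where g: "\<And>i. homogeneous e (g i)" "mon m = (\<Sum>i\<in>UNIV. g i * partial_deriv i w)"
      using N[OF m] by blast
    \<comment> \<open>The cofactors have an unspecified degree \<open>e\<close>. It is determined
      because the monomial is nonzero, and it is needed to land in degree
      \<open>s - int N\<close>.\<close>
    have "homogeneous (e + (2 * b - 1)) (mon m :: ('n, 'k) mpoly)"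
      unfolding g(2) by (intro homogeneous_sum homogeneous_mult g(1) homogeneous_partial_deriv[OF polarization])
    moreover have "homogeneous N (mon m :: ('n, 'k) mpoly)" by (rule homogeneous_single[OF m])
    moreover have "mon m \<noteq> (0 :: ('n, 'k) mpoly)" by (metis lookup_single_eq lookup_zero zero_neq_one)
    ultimately have N': "e + (2 * b - 1) = N" by (rule homogeneous_unique)
    note bil = Z_bilin[OF f]
    have "pr (g i * partial_deriv i w) 1 f \<in> Bd \<pi> (s - int N)" for i
    proof -
      have h: "pr (partial_deriv i w) 1 f \<in> Bd \<pi> (s - int (2 * b - 1))" by (rule pr_partial_deriv_Bd[OF f])
      then have "bilin (pr (partial_deriv i w) 1 f A)" for A using Bd_le_Z Z_bilin by (meson le_fun_def subsetD)
      from fam_pr[OF fam_Bd h this g(1)[of i]] show ?thesis unfolding N'[symmetric] by (simp add: pr_pr algebra_simps)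
    qed
    moreover have "pr (\<Sum>i\<in>S. g i * partial_deriv i w) 1 f = (\<Sum>i\<in>S. pr (g i * partial_deriv i w) 1 f)" for S
      by (induction S rule: infinite_finite_induct) (simp_all add: pr_0[OF bil] pr_add[OF bil])
    ultimately show ?thesis unfolding g(2)
      by (simp only:) (rule fs.subspace_sum[OF fs.fam_subspace[OF fam_Bd]])
  qed
  show thesis
  proof (rule that)
    fix \<pi> s f and m m' :: "'n \<Rightarrow>\<^sub>0 nat" assume f: "f \<in> Z \<pi> s" and m: "mdeg m + mdeg m' = N"
    have "pr (mon m) (mon m') f - pr (mon m * mon m') 1 f \<in> Bd \<pi> (s - int N)"
      using pr_prod_diff_Bd[OF f homogeneous_single[OF refl] homogeneous_single[OF refl], of m 1 m' 1] m by simp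
    moreover have "pr (mon m * mon m') 1 f \<in> Bd \<pi> (s - int N)"
      using X[OF f, of "m + m'"] m by (simp add: mult_single)
    ultimately have "(pr (mon m) (mon m') f - pr (mon m * mon m') 1 f) + pr (mon m * mon m') 1 f \<in> Bd \<pi> (s - int N)"
      by (rule Bd_add)
    then show "pr (mon m) (mon m') f \<in> Bd \<pi> (s - int N)" by simp
  qed
qed

text \<open>The chain condition bounds the socle of homology by some degree \<open>s2\<close>. If
  all words of length k kill a class of degree at least s2 + k, induction on k shows that each
  operator kills it, so it is a socle element in too high a degree and vanishes. All words of length
  N kill every class.\<close>

lemma homology_finite: "\<exists>s1. \<forall>s\<ge>s1. Z \<pi> s = Bd \<pi> s"
proof -
  obtain N where N: "\<And>\<pi> s f m m'. f \<in> Z \<pi> s \<Longrightarrow> mdeg m + mdeg m' = N \<Longrightarrow>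
    pr (mon m) (mon m') f \<in> Bd \<pi> (s - int N)" using monomials_annihilate_homology by blast
  have "fs.dcc (Bd \<pi>) (Z \<pi>)" using fs.dcc_sub[OF dcc_V zero_le_fam[OF fam_Bd] Z_le_V] .
  then obtain s2 where s2: "\<And>j u. j \<ge> s2 \<Longrightarrow> u \<in> Z \<pi> j \<Longrightarrow> (\<And>i. ops i u \<in> Bd \<pi> (j - 1)) \<Longrightarrow> u \<in> Bd \<pi> j"
    using fs.dcc_cogenerated[OF fam_Bd fam_Z Bd_le_Z] by blast
  have main: "f \<in> Z \<pi> s \<Longrightarrow> s \<ge> s2 + int k \<Longrightarrow>
     (\<And>m m'. mdeg m + mdeg m' = k \<Longrightarrow> pr (mon m) (mon m') f \<in> Bd \<pi> (s - int k)) \<Longrightarrow> f \<in> Bd \<pi> s" for k s f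
  proof (induction k arbitrary: s f)
    case 0
    then show ?case using 0(3)[of 0 0] by simp
  next
    case (Suc k)
    have "ops i f \<in> Bd \<pi> (s - 1)" for i
    proof (rule Suc.IH)
      show "ops i f \<in> Z \<pi> (s - 1)" by (rule fs.fam_act[OF fam_Z Suc.prems(1)])
      show "s2 + int k \<le> s - 1" using Suc.prems(2) by simp
      fix m m' :: "'n \<Rightarrow>\<^sub>0 nat" assume m: "mdeg m + mdeg m' = k"
      show "pr (mon m) (mon m') (ops i f) \<in> Bd \<pi> (s - 1 - int k)"
      proof (cases i)
        case (Inl l)
        have "pr (mon (m + single l 1)) (mon m') f \<in> Bd \<pi> (s - int (Suc k))"
          by (rule Suc.prems(3)) (use m in simp)
        then show ?thesis unfolding Inl pr_ops pr_pr by (simp add: mult_single algebra_simps)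
      next
        case (Inr l)
        have "pr (mon m) (mon (m' + single l 1)) f \<in> Bd \<pi> (s - int (Suc k))"
          by (rule Suc.prems(3)) (use m in simp)
        then show ?thesis unfolding Inr pr_ops pr_pr by (simp add: mult_single algebra_simps)
      qed
    qed
    then show ?case using s2[of s f] Suc.prems(1,2) by simp
  qed
  have "Z \<pi> s = Bd \<pi> s" if "s \<ge> s2 + int N" for s
  proof
    show "Z \<pi> s \<subseteq> Bd \<pi> s" using main[OF _ that] N by blast
    show "Bd \<pi> s \<subseteq> Z \<pi> s" using Bd_le_Z by (simp add: le_fun_def)
  qed
  then show ?thesis by blast
qed

text \<open>Rank-nullity writes the series of the complex as Z(\<pi>) + X^b B(not \<pi>). Weighting
  the odd part by -(-1)^b turns the values at -1 into differences of cycles and boundaries of equal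
  parity, which are integers, and gives all 2^n exterior monomials the same sign.\<close>

lemma euler_characteristic:
  assumes h: "has_val Hm h"
  shows "2 ^ CARD('n) * h ^ 2 \<in> \<int>"
proof -
  define ZF where "ZF \<pi> = (Abs_fps (\<lambda>r. of_nat (fs.dim (Z \<pi> (s0 + int r)))) :: rat fps)" for \<pi>
  define BF where "BF \<pi> = (Abs_fps (\<lambda>r. of_nat (fs.dim (Bd \<pi> (s0 + int r)))) :: rat fps)" for \<pi>
  define VF where "VF \<pi> = (Abs_fps (\<lambda>r. of_nat (fs.dim (V \<pi> (s0 + int r)))) :: rat fps)" for \<pi>
  have BV: "Bd \<pi> \<le> V \<pi>" for \<pi> using order_trans[OF Bd_le_Z Z_le_V] .
  obtain z where z: "\<And>\<pi>. has_val (ZF \<pi>) (z \<pi>)"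
    using has_val_subfamily[OF fam_Z Z_le_V fdim_Z] unfolding ZF_def by metis
  obtain \<beta> where \<beta>: "\<And>\<pi>. has_val (BF \<pi>) (\<beta> \<pi>)"
    using has_val_subfamily[OF fam_Bd BV fdim_Bd] unfolding BF_def by metis
  have split: "VF \<pi> = ZF \<pi> + fps_X ^ b * BF (\<not> \<pi>)" for \<pi>
  proof (rule fps_ext)
    fix r
    show "VF \<pi> $ r = (ZF \<pi> + fps_X ^ b * BF (\<not> \<pi>)) $ r"
    proof (cases "r < b")
      case True
      then have "Bd (\<not> \<pi>) (s0 + int r - int b) \<subseteq> {0}"
        using V_low[of "s0 + int r - int b" "\<not> \<pi>"] BV[of "\<not> \<pi>"] by (auto simp: le_fun_def)
      then have "fs.dim (Bd (\<not> \<pi>) (s0 + int r - int b)) = 0"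
        using fs.dim_le_card[of "Bd (\<not> \<pi>) (s0 + int r - int b)" "{}"] by simp
      then show ?thesis using True by (simp add: VF_def ZF_def dim_V_split[of \<pi>] fps_X_power_mult_nth)
    next
      case False
      then show ?thesis
        by (simp add: VF_def ZF_def BF_def dim_V_split[of \<pi>] fps_X_power_mult_nth of_nat_diff algebra_simps)
    qed
  qed
  have v1: "has_val (VF \<pi>) (z \<pi> + (- 1) ^ b * \<beta> (\<not> \<pi>))" for \<pi>
    unfolding split by (intro has_val_add z has_val_mult has_val_X_power \<beta>)
  have v2: "has_val (VF \<pi>) (\<Sum>A | even (card (A :: 'n set)) = \<pi>. (- 1) ^ shift A * (h * h))" for \<pi>
    unfolding VF_def V_series by (intro has_val_sum has_val_mult has_val_X_power h)
  have v: "z \<pi> + (- 1) ^ b * \<beta> (\<not> \<pi>) = (\<Sum>A | even (card (A :: 'n set)) = \<pi>. (- 1) ^ shift A * (h * h))" for \<pi>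
    by (rule has_val_unique[OF v1 v2])
  have hom: "z \<pi> - \<beta> \<pi> \<in> \<int>" for \<pi>
  proof -
    obtain s1 where s1: "\<And>s. s \<ge> s1 \<Longrightarrow> Z \<pi> s = Bd \<pi> s" using homology_finite by blast
    \<comment> \<open>Homology vanishes from degree \<open>s1\<close> on, so this difference of
      series is a polynomial with integer coefficients.\<close>
    define a where "a r = (of_nat (fs.dim (Z \<pi> (s0 + int r))) - of_nat (fs.dim (Bd \<pi> (s0 + int r))) :: rat)" for r
    have "a r = 0" if "r \<ge> nat (s1 - s0)" for r using s1[of "s0 + int r"] that by (simp add: a_def)
    from has_val_finite_support[of _ a, OF this]
    have "has_val (Abs_fps a) (\<Sum>r<nat (s1 - s0). a r * (- 1) ^ r)" .
    moreover have "Abs_fps a = ZF \<pi> - BF \<pi>" by (rule fps_ext) (simp add: a_def ZF_def BF_def)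
    ultimately have "z \<pi> - \<beta> \<pi> = (\<Sum>r<nat (s1 - s0). a r * (- 1) ^ r)"
      using has_val_unique[OF has_val_diff[OF z \<beta>]] by metis
    also have "\<dots> \<in> \<int>" by (intro Ints_sum Ints_mult Ints_power) (simp_all add: a_def)
    finally show ?thesis .
  qed
  \<comment> \<open>The value at -1 of X^(shift A) for the empty \<open>A\<close>, a common sign of
    the whole sum.\<close>
  define \<eta> where "\<eta> = ((- 1) ^ ((b - 1) * CARD('n)) :: rat)"
  obtain c where c: "b = Suc c" using b_pos by (cases b) auto
  \<comment> \<open>Modulo 2 the shift differs from that of the empty set by (b - 1) card A, so odd
    sets acquire the sign (-1)^(b - 1), which the weight of the odd part compensates.\<close>
  have sign: "(- 1) ^ shift A = (if even (card A) then \<eta> else - ((- 1) ^ b) * \<eta>)" for A :: "'n set"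
  proof -
    have "(- 1) ^ shift A * (- 1) ^ (c * card A) = \<eta>"
    proof -
      have "shift A + c * card A = (b - 1) * CARD('n)"
        unfolding shift_def using card_le_CARD[of A] by (simp add: c flip: distrib_left)
      then show ?thesis unfolding \<eta>_def by (metis power_add)
    qed
    moreover have "((- 1) ^ (c * card A) :: rat) = (if even (card A) then 1 else (- 1) ^ c)"
      by (cases "even c") auto
    moreover have "((- 1) ^ c * (- 1) ^ c :: rat) = 1" by (simp flip: power_mult_distrib)
    ultimately show ?thesis by (auto simp: c mult.commute mult.assoc split: if_splits)
  qed
  let ?E = "(\<Sum>A | even (card (A :: 'n set)). \<eta> * (h * h))" and ?O = "(\<Sum>A | odd (card (A :: 'n set)). \<eta> * (h * h))"
    and ?N = "(\<Sum>A | odd (card (A :: 'n set)). - ((- 1) ^ b) * \<eta> * (h * h))"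
  have "(z True - \<beta> True) - (- 1) ^ b * (z False - \<beta> False)
      = (z True + (- 1) ^ b * \<beta> False) - (- 1) ^ b * (z False + (- 1) ^ b * \<beta> True)"
  proof -
    have "(- 1) ^ b * ((- 1) ^ b * \<beta> True) = \<beta> True" by (simp add: mult.assoc[symmetric] flip: power_mult_distrib)
    then show ?thesis by (simp add: algebra_simps)
  qed
  also have "\<dots> = ?E - (- 1) ^ b * ?N"
  proof -
    have "z True + (- 1) ^ b * \<beta> False = (\<Sum>A | even (card (A :: 'n set)). (- 1) ^ shift A * (h * h))"
      using v[of True] by simp
    also have "\<dots> = ?E"
      unfolding sign by (rule sum.cong) auto
    finally have 1: "z True + (- 1) ^ b * \<beta> False = ?E" .
    have "z False + (- 1) ^ b * \<beta> True = (\<Sum>A | odd (card (A :: 'n set)). (- 1) ^ shift A * (h * h))"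
      using v[of False] by simp
    also have "\<dots> = ?N"
      unfolding sign by (rule sum.cong) auto
    finally have 2: "z False + (- 1) ^ b * \<beta> True = ?N" .
    show ?thesis unfolding 1 2 ..
  qed
  also have "\<dots> = ?E + ?O"
  proof -
    have "((- 1) ^ b * (- 1) ^ b :: rat) = 1" by (simp flip: power_mult_distrib)
    then have "(- 1) ^ b * (- ((- 1) ^ b) * \<eta> * (h * h)) = - (\<eta> * (h * h))"
      by (metis (no_types) minus_mult_left mult.assoc mult_1 mult_minus_right)
    then show ?thesis unfolding sum_distrib_left by (simp add: sum_negf)
  qed
  also have "\<dots> = (\<Sum>A\<in>(UNIV :: 'n set set). \<eta> * (h * h))"
  proof -
    have "(UNIV :: 'n set set) = {A. even (card A)} \<union> {A. odd (card A)}" by auto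
    moreover have "(\<Sum>A\<in>{A :: 'n set. even (card A)} \<union> {A. odd (card A)}. \<eta> * (h * h))
       = ?E + ?O"
      by (rule sum.union_disjoint) auto
    ultimately show ?thesis by (simp only:)
  qed
  also have "\<dots> = \<eta> * (2 ^ CARD('n) * h ^ 2)"
    by (simp add: card_UNIV_set power2_eq_square)
  finally have "\<eta> * (2 ^ CARD('n) * h ^ 2) \<in> \<int>"
    using hom by (metis Ints_1 Ints_diff Ints_minus Ints_mult Ints_power)
  then have "\<eta> * (\<eta> * (2 ^ CARD('n) * h ^ 2)) \<in> \<int>" by (rule Ints_mult[rotated]) (simp add: \<eta>_def)
  moreover have "\<eta> * \<eta> = 1" by (simp add: \<eta>_def flip: power_mult_distrib)
  ultimately show ?thesis by (simp add: mult.assoc[symmetric])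
qed

end

section \<open>Divisibility\<close>

text \<open>The 2-adic valuation of 2 z^2 is odd for nonzero z, so the additional factor 2 cannot
  help to reach the even exponent 2c.\<close>

lemma dvd_of_dvd_two_times_square: "(2::int) ^ (2 * c) dvd 2 * z ^ 2 \<Longrightarrow> 2 ^ c dvd z"
proof (induction c arbitrary: z)
  case (Suc c)
  have "(2::int) * 2 dvd 2 * z ^ 2"
    by (rule dvd_trans[OF _ Suc.prems]) simp
  then have "2 dvd z ^ 2" by (simp only: dvd_times_left_cancel_iff)
  then have "even z" by simp
  then obtain y where z: "z = 2 * y" by blast
  have "(2::int) ^ (2 * Suc c) = 4 * 2 ^ (2 * c)" "2 * z ^ 2 = 4 * (2 * y ^ 2)"
    by (simp_all add: z power2_eq_square)
  then have "(4::int) * 2 ^ (2 * c) dvd 4 * (2 * y ^ 2)" using Suc.prems by (simp only:)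
  then have "(2::int) ^ (2 * c) dvd 2 * y ^ 2"
    by (rule iffD1[OF dvd_times_left_cancel_iff, rotated]) simp
  then show ?case using Suc.IH[of y] by (simp add: z)
qed simp

text \<open>After cancelling the even part of the exponent n, a factor 2^(n mod 2) is left beside
  z^2. For odd n it is absorbed by \<open>dvd_of_dvd_two_times_square\<close>, which is why n/2 may
  be rounded down.\<close>

lemma divisibility_from_square:
  fixes z :: int and n d :: nat
  assumes "2 ^ n * (of_int z / 2 ^ d) ^ 2 \<in> (\<int> :: rat set)"
  shows "of_int z / 2 powi (int d - int (n div 2)) \<in> (\<int> :: rat set)"
proof (cases "d \<le> n div 2")
  case True
  then have eq: "int d - int (n div 2) = - int (n div 2 - d)" by simp
  have "of_int z / 2 powi (int d - int (n div 2)) = (of_int z * 2 ^ (n div 2 - d) :: rat)"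
    unfolding eq power_int_minus power_int_of_nat divide_inverse inverse_inverse_eq ..
  then show ?thesis by (simp only:) (intro Ints_mult Ints_of_int Ints_power Ints_numeral)
next
  case False
  define c where "c = d - n div 2"
  have d: "d = c + n div 2" using False by (simp add: c_def)
  obtain m where m: "(2 ^ n * (of_int z / 2 ^ d) ^ 2 :: rat) = of_int m" using assms Ints_cases by blast
  then have "(2 ^ n * of_int z ^ 2 :: rat) = of_int m * (2 ^ d) ^ 2"
    by (simp add: power_divide field_simps)
  then have "(of_int (2 ^ n * z ^ 2) :: rat) = of_int (m * (2 ^ d) ^ 2)" by simp
  then have eq: "2 ^ n * z ^ 2 = m * (2 ^ d) ^ 2" by (simp only: of_int_eq_iff)
  have n: "n = 2 * (n div 2) + n mod 2" by simp
  have "(2::int) ^ n = 2 ^ (2 * (n div 2)) * 2 ^ (n mod 2)"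
    by (subst n) (simp only: power_add)
  moreover have "((2::int) ^ d) ^ 2 = 2 ^ (2 * (n div 2)) * 2 ^ (2 * c)"
    by (subst d) (simp only: power_add power_mult_distrib power_mult[symmetric] mult.commute)
  ultimately have "2 ^ (2 * (n div 2)) * (2 ^ (n mod 2) * z ^ 2) = 2 ^ (2 * (n div 2)) * (m * 2 ^ (2 * c))"
    using eq by (simp add: mult_ac)
  then have "2 ^ (n mod 2) * z ^ 2 = m * 2 ^ (2 * c)" by simp
  then have "2 ^ (2 * c) dvd 2 ^ (n mod 2) * z ^ 2" by simp
  moreover have "2 ^ (n mod 2) * z ^ 2 dvd 2 * z ^ 2"
    by (intro mult_dvd_mono dvd_refl) (cases "even n"; simp add: odd_iff_mod_2_eq_one)
  ultimately have "2 ^ c dvd z" using dvd_of_dvd_two_times_square dvd_trans by blast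
  then obtain y where "z = 2 ^ c * y" by blast
  moreover have "int d - int (n div 2) = int c" by (simp add: d)
  ultimately show ?thesis by simp
qed

lemma minus_one_powi_Ints: "(- 1) powi j \<in> (\<int> :: rat set)"
  by (auto simp: power_int_def power_inverse[symmetric] intro!: Ints_power)

lemma laurent_eval_Ints: "laurent_eval e (- 1) \<in> \<int>"
  unfolding laurent_eval_def by (intro Ints_sum Ints_mult minus_one_powi_Ints) simp

section \<open>From the Laurent polynomial to the value at -1\<close>

context graded_module
begin

text \<open>The sign \<open>\<epsilon>\<close> is (-1)^j0, caused by the shift by t^(-j0) that makes
  the Hilbert series a power series. Only the square of the value matters later.\<close>

lemma has_val_hilbert_series:
  assumes low: "\<And>j. j < j0 \<Longrightarrow> gr j = {0}"
    and H: "hilbert_series scale gr = laurent_fls e / (1 - fls_X) ^ d"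
  shows "\<exists>\<epsilon>. \<epsilon> ^ 2 = 1 \<and> has_val (Abs_fps (\<lambda>p. of_nat (vs.dim (gr (j0 + int p))))) (\<epsilon> * laurent_eval e (- 1) / 2 ^ d)"
proof -
  let ?H = "hilbert_series scale gr"
  let ?Hm = "Abs_fps (\<lambda>p. of_nat (vs.dim (gr (j0 + int p)))) :: rat fps"
  have d0: "vs.dim (gr j) = 0" if "j < j0" for j
    using vs.dim_le_card[of "gr j" "{}"] low[OF that] by simp
  have nth: "fls_nth ?H j = of_nat (vs.dim (gr j))" for j
    unfolding hilbert_series_def
  proof (rule nth_Abs_fls)
    show "\<forall>\<^sub>\<infinity>n. of_nat (vs.dim (gr (- int n))) = (0 :: rat)"
      unfolding MOST_nat by (intro exI[of _ "nat (- j0)"]) (auto intro!: d0)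
  qed
  have nz: "(1 - fls_X :: rat fls) \<noteq> 0"
  proof
    assume "(1 - fls_X :: rat fls) = 0"
    then have "fls_nth (1 - fls_X :: rat fls) 0 = 0" by simp
    then show False by simp
  qed
  have HX: "?H * (1 - fls_X) ^ d = laurent_fls e" using H nz by simp
  have "?H = fls_shift (- j0) (fps_to_fls ?Hm)"
    by (rule fls_eqI) (auto simp: nth d0)
  then have "fls_shift (- j0) (fps_to_fls ?Hm * (1 - fls_X) ^ d) = laurent_fls e"
    using HX by (simp add: fls_shifted_times_simps)
  moreover have "(1 - fls_X) ^ d = fps_to_fls ((1 - fps_X :: rat fps) ^ d)"
    by (simp add: fps_to_fls_power)
  ultimately have sh: "fls_shift (- j0) (fps_to_fls (?Hm * (1 - fps_X) ^ d)) = laurent_fls e"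
    by (simp add: fls_times_fps_to_fls)
  have key: "of_int (lookup e j) = fls_nth (fps_to_fls (?Hm * (1 - fps_X) ^ d)) (j - j0)" for j
    using arg_cong[OF sh, of "\<lambda>F. fls_nth F j"] by simp
  define a where "a r = (of_int (lookup e (j0 + int r)) :: rat)" for r
  have eq: "?Hm * (1 - fps_X) ^ d = Abs_fps a"
    by (rule fps_ext) (simp add: a_def key)
  \<comment> \<open>The lower bound holds because e is t^j0 times a power series, by
    \<open>key\<close>; the upper bound because e has finitely many terms.\<close>
  obtain K where K: "keys e \<subseteq> {j0..<j0 + int K}"
  proof -
    have "j0 \<le> j" if "j \<in> keys e" for j
      using that key[of j] by (auto simp: in_keys_iff split: if_splits)
    moreover have "j < j0 + int (nat (Max (insert 0 (keys e)) + 1 - j0))" if "j \<in> keys e" for j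
    proof -
      have "j \<le> Max (insert 0 (keys e))" using that by simp
      then show ?thesis by linarith
    qed
    ultimately have "keys e \<subseteq> {j0..<j0 + int (nat (Max (insert 0 (keys e)) + 1 - j0))}"
      unfolding subset_iff atLeastLessThan_iff by blast
    then show thesis by (rule that)
  qed
  have "a r = 0" if "r \<ge> K" for r
  proof -
    have "j0 + int r \<notin> keys e" using K that by auto
    then show ?thesis by (simp add: a_def not_in_keys_iff_lookup_eq_zero)
  qed
  from has_val_finite_support[of K a, OF this]
  have "has_val (?Hm * (1 - fps_X) ^ d) (\<Sum>r<K. a r * (- 1) ^ r)" unfolding eq .
  from has_val_cancel[OF this] have hv: "has_val ?Hm ((\<Sum>r<K. a r * (- 1) ^ r) / 2 ^ d)" .
  have "laurent_eval e (- 1) = (\<Sum>j\<in>{j0..<j0 + int K}. of_int (lookup e j) * (- 1) powi j)"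
    unfolding laurent_eval_def
    by (rule sum.mono_neutral_left) (use K in \<open>auto simp: not_in_keys_iff_lookup_eq_zero\<close>)
  also have "\<dots> = (\<Sum>r<K. a r * (- 1) powi (j0 + int r))"
    by (rule sum.reindex_bij_witness[of _ "\<lambda>r. j0 + int r" "\<lambda>j. nat (j - j0)"]) (auto simp: a_def)
  also have "\<dots> = (- 1) powi j0 * (\<Sum>r<K. a r * (- 1) ^ r)"
    by (simp add: power_int_add sum_distrib_left mult_ac)
  finally have le: "laurent_eval e (- 1) = (- 1) powi j0 * (\<Sum>r<K. a r * (- 1) ^ r)" .
  have s: "((- 1) powi j0) * ((- 1) powi j0) = (1 :: rat)"
    by (simp flip: power_int_mult_distrib)
  then have "(\<Sum>r<K. a r * (- 1) ^ r) = (- 1) powi j0 * laurent_eval e (- 1)"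
    unfolding le mult.assoc[symmetric] by simp
  then show ?thesis using hv s by (intro exI[of _ "(- 1) powi j0"]) (simp add: power2_eq_square)
qed

end

text \<open>For a constant all partial derivatives vanish, so the point with all coordinates 1 would
  be a forbidden common zero. Positivity keeps \<open>b - 1\<close> and \<open>2 * b - 1\<close>
  from being truncated.\<close>

lemma smooth_imp_degree_pos:
  fixes w :: "('n::finite, 'k::field) mpoly"
  assumes "homogeneous D w" "smooth_projective_hypersurface w"
  shows "D > 0"
proof (rule ccontr)
  assume "\<not> D > 0"
  then have zero: "m = 0" if "m \<in> keys w" for m
    using assms(1) that by (auto simp: homogeneous_def)
  have "partial_deriv i w = 0" for i
    unfolding partial_deriv_def
  proof (intro sum.neutral ballI)
    fix m assume "m \<in> keys w"
    then have "m = 0" using zero by blast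
    then show "single (m - single i 1) (of_nat (lookup m i) * lookup w m) = 0"
      by simp
  qed
  then have "(\<forall>i. eval_alg_closure (partial_deriv i w) (\<lambda>_. 1) = 0)"
    by (simp add: eval_alg_closure_def)
  then have "(\<lambda>_ :: 'n. 1 :: 'k alg_closure) = (\<lambda>_. 0)"
    using assms(2) unfolding smooth_projective_hypersurface_def by blast
  then show False by (metis zero_neq_one)
qed

theorem corollary3p21:
  fixes scale :: "('n::finite, 'k::field_char_0) mpoly \<Rightarrow> 'm::ab_group_add \<Rightarrow> 'm"
    and gr :: "int \<Rightarrow> 'm set"
    and w :: "('n, 'k) mpoly"
    and e :: laurent_poly
    and d D :: nat
  assumes "graded_module scale gr"
    and "finitely_generated_module scale"
    and "\<exists>x::'m. x \<noteq> 0"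
    and "krull_dim_module scale = enat d"
    and "hilbert_series scale gr = laurent_fls e / (1 - fls_X) ^ d"
    and "homogeneous D w" and "even D"
    and "smooth_projective_hypersurface w"
    and "w \<in> annihilator scale"
  shows "laurent_eval e (-1) / 2 powi (int d - int (CARD('n) div 2)) \<in> \<int>"
proof -
  interpret graded_module scale gr by (rule assms(1))
  obtain b where b: "D = 2 * b" using \<open>even D\<close> by blast
  have b1: "b \<ge> 1" using smooth_imp_degree_pos[OF assms(6,8)] b by simp
  obtain j0 j1 where j: "\<And>j. \<exists>B. finite B \<and> gr j \<subseteq> vs.span B" "\<And>j. j < j0 \<Longrightarrow> gr j = {0}"
    "\<And>j. j \<ge> j1 \<Longrightarrow> gr (j + 1) \<subseteq> vs.span {scale (pvar i) y | i y. y \<in> gr j}"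
    using gr_structure[OF assms(2)] by blast
  obtain L where L: "polarization D w L"
    "\<And>g :: _ \<Rightarrow> _ \<Rightarrow> 'k. balanced g \<Longrightarrow> telescopes w L g"
    using polarization_exists[OF assms(6)] by blast
  have jac: "\<exists>s. \<forall>m. mdeg m = s \<longrightarrow>
      (\<exists>g e. (\<forall>i. homogeneous e (g i)) \<and> mon m = (\<Sum>i\<in>UNIV. g i * partial_deriv i w))"
  proof (rule projective_nullstellensatz_alg_closure)
    show "homogeneous (D - 1) (partial_deriv i w)" for i by (rule homogeneous_partial_deriv[OF L(1)])
    show "a = (\<lambda>_. 0)" if "\<forall>i. eval_alg_closure (partial_deriv i w) a = 0" for a
      using assms(8) that unfolding smooth_projective_hypersurface_def by blast
  qed
  interpret hypersurface_module scale gr w L b j0 j1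
  proof
    show "scale w x = 0" for x using assms(9) unfolding annihilator_def by blast
    show "polarization (2 * b) w L" using L(1) b by simp
  qed (use b1 L(2) j jac in blast)+
  obtain \<epsilon> where \<epsilon>: "\<epsilon> ^ 2 = 1" "has_val Hm (\<epsilon> * laurent_eval e (- 1) / 2 ^ d)"
    using has_val_hilbert_series[OF j(2) assms(5)] unfolding Hm_def by blast
  obtain z where z: "laurent_eval e (- 1) = of_int z" using laurent_eval_Ints Ints_cases by blast
  have "2 ^ CARD('n) * (\<epsilon> * laurent_eval e (- 1) / 2 ^ d) ^ 2 \<in> \<int>"
    by (rule euler_characteristic[OF \<epsilon>(2)])
  \<comment> \<open>Squaring removes the sign caused by the shift of degrees.\<close>
  also have "(\<epsilon> * laurent_eval e (- 1) / 2 ^ d) ^ 2 = (of_int z / 2 ^ d) ^ 2"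
    using \<epsilon>(1) by (simp add: z power_divide power_mult_distrib)
  finally show ?thesis unfolding z by (rule divisibility_from_square)
qed

end
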